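(* Let $T$ be an integral domain, $M$ a nonzero maximal ideal of $T$, $k=T/M$, $\varphi:T\to k$ the canonical projection, $D$ a proper subring of $k$ whose quotient field is $k$, and $R=\varphi^{-1}(D)$. Suppose that the map $\tilde\varphi:\mathcal U(T)\to k^\bullet/\mathcal U(D)$, $u\mapsto\varphi(u)\,\mathcal U(D)$, is surjective. Then the sequence $$0\longrightarrow \mathrm{Cl}^{t_D}(D)\stackrel{\overline{\alpha}}{\longrightarrow}\mathrm{Cl}^{t_R}(R)\stackrel{\overline{\beta}}{\longrightarrow}\mathrm{Cl}^{(t_R)_T}(T)\longrightarrow 0,$$ where $\overline\alpha([J])=[\varphi^{-1}(J)]$ and $\overline\beta([H])=[HT]$, is split exact.
   Context: $\mathcal U(\cdot)$ denotes the group of units of a ring, and $k^\bullet=k\setminus\{0\}$. For an integral domain $A$ with quotient field $K$, $\boldsymbol F(A)$ is the set of nonzero fractional ideals of $A$ and $\boldsymbol f(A)$ the set of nonzero finitely generated ones; $I^{-1}=(A:_K I)$. A star operation on $A$ is a map $\ast:\boldsymbol F(A)\to\boldsymbol F(A)$, $E\mapsto E^\ast$, such that for all $0\ne x\in K$ and $E,F\in\boldsymbol F(A)$: $(xA)^\ast=xA$ and $(xE)^\ast=xE^\ast$; $E\subseteq F$ implies $E^\ast\subseteq F^\ast$; $E\subseteq E^\ast=(E^\ast)^\ast$. Put $E^{\ast_f}=\bigcup\{F^\ast\mid F\in\boldsymbol f(A),\,F\subseteq E\}$. The $v$-operation is $E^{v_A}=(E^{-1})^{-1}$ and $t_A=(v_A)_f$.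 A $\ast$-ideal is $E\in\boldsymbol F(A)$ with $E=E^\ast$; $I\in\boldsymbol F(A)$ is $\ast$-invertible if $(II^{-1})^\ast=A$. $\mathrm{Inv}^\ast(A)$ is the abelian group of $\ast$-invertible $\ast$-ideals under $(I,J)\mapsto(IJ)^\ast$, $\mathrm{Prin}(A)$ its subgroup of nonzero principal fractional ideals, and $\mathrm{Cl}^\ast(A)=\mathrm{Inv}^\ast(A)/\mathrm{Prin}(A)$. Extension: $R$ and $T$ have the same quotient field and $(R:T)=M\neq0$, so $\boldsymbol F(T)\subseteq\boldsymbol F(R)$; for a star operation $\ast$ on $R$, $(\ast)_T$ is the star operation on $T$ given by $E^{(\ast)_T}=E^\ast\cap E^{v_T}$ for $E\in\boldsymbol F(T)$. Under the stated hypotheses $\overline\alpha$ and $\overline\beta$ are well-defined group homomorphisms. *)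

theory Defs
  imports "HOL-Algebra.Algebra"
begin

(* Throughout, K is the record of an ambient field and an integral domain is given by its
   carrier A, a subring of K. *)

definition is_quotient_field :: "('a, 'm) ring_scheme \<Rightarrow> 'a set \<Rightarrow> bool" where
  "is_quotient_field K A \<longleftrightarrow>
     (\<forall>x \<in> carrier K. \<exists>a \<in> A. \<exists>b \<in> A - {\<zero>\<^bsub>K\<^esub>}. x = a \<otimes>\<^bsub>K\<^esub> inv\<^bsub>K\<^esub> b)"

subsection \<open>Fractional ideals and star operations\<close>

(* subalgebra A E K of the library says only that E is an A-submodule of K. *)
definition frac_ideals :: "('a, 'm) ring_scheme \<Rightarrow> 'a set \<Rightarrow> 'a set set" where
  "frac_ideals K A = {E. subalgebra A E K \<and> E \<noteq> {\<zero>\<^bsub>K\<^esub>} \<and>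
     (\<exists>d \<in> A - {\<zero>\<^bsub>K\<^esub>}. \<forall>x \<in> E. d \<otimes>\<^bsub>K\<^esub> x \<in> A)}"

definition fg_frac_ideals :: "('a, 'm) ring_scheme \<Rightarrow> 'a set \<Rightarrow> 'a set set" where
  "fg_frac_ideals K A =
     {E \<in> frac_ideals K A. \<exists>us. set us \<subseteq> carrier K \<and> E = ring.Span K A us}"

definition colon :: "('a, 'm) ring_scheme \<Rightarrow> 'a set \<Rightarrow> 'a set \<Rightarrow> 'a set" where
  "colon K I J = {x \<in> carrier K. \<forall>y \<in> J. x \<otimes>\<^bsub>K\<^esub> y \<in> I}"

definition v_op :: "('a, 'm) ring_scheme \<Rightarrow> 'a set \<Rightarrow> 'a set \<Rightarrow> 'a set" where
  "v_op K A E = colon K A (colon K A E)"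

definition finite_type ::
    "('a, 'm) ring_scheme \<Rightarrow> 'a set \<Rightarrow> ('a set \<Rightarrow> 'a set) \<Rightarrow> 'a set \<Rightarrow> 'a set" where
  "finite_type K A star E = \<Union> {star F | F. F \<in> fg_frac_ideals K A \<and> F \<subseteq> E}"

definition t_op :: "('a, 'm) ring_scheme \<Rightarrow> 'a set \<Rightarrow> 'a set \<Rightarrow> 'a set" where
  "t_op K A = finite_type K A (v_op K A)"

(* For a star operation star on R, star_ext K T star is the induced operation (star)_T on T. *)
definition star_ext ::
    "('a, 'm) ring_scheme \<Rightarrow> 'a set \<Rightarrow> ('a set \<Rightarrow> 'a set) \<Rightarrow> 'a set \<Rightarrow> 'a set" where
  "star_ext K T star E = star E \<inter> v_op K T E"

subsection \<open>Class groups\<close>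

(* ideal_prod K I J is the set of finite sums of products, formed in the field K, so it is also
   the product of fractional ideals. *)
definition Inv_group ::
    "('a, 'm) ring_scheme \<Rightarrow> 'a set \<Rightarrow> ('a set \<Rightarrow> 'a set) \<Rightarrow> 'a set monoid" where
  "Inv_group K A star =
     \<lparr> carrier = {I \<in> frac_ideals K A. star I = I \<and> star (ideal_prod K I (colon K A I)) = A},
       monoid.mult = (\<lambda>I J. star (ideal_prod K I J)),
       one = A \<rparr>"

definition Prin :: "('a, 'm) ring_scheme \<Rightarrow> 'a set \<Rightarrow> 'a set set" where
  "Prin K A = {A #>\<^bsub>K\<^esub> x | x. x \<in> carrier K - {\<zero>\<^bsub>K\<^esub>}}"

definition Cl_group ::
    "('a, 'm) ring_scheme \<Rightarrow> 'a set \<Rightarrow> ('a set \<Rightarrow> 'a set) \<Rightarrow> 'a set set monoid" where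
  "Cl_group K A star = Inv_group K A star Mod Prin K A"

definition ideal_class ::
    "('a, 'm) ring_scheme \<Rightarrow> 'a set \<Rightarrow> ('a set \<Rightarrow> 'a set) \<Rightarrow> 'a set \<Rightarrow> 'a set set" where
  "ideal_class K A star I = Prin K A #>\<^bsub>Inv_group K A star\<^esub> I"

subsection \<open>The pullback\<close>

definition residue_field :: "('a, 'm) ring_scheme \<Rightarrow> 'a set \<Rightarrow> 'a set \<Rightarrow> 'a set ring" where
  "residue_field K T M = (K\<lparr>carrier := T\<rparr>) Quot M"

definition residue_map :: "('a, 'm) ring_scheme \<Rightarrow> 'a set \<Rightarrow> 'a set \<Rightarrow> 'a \<Rightarrow> 'a set" where
  "residue_map K T M x = M +>\<^bsub>K\<lparr>carrier := T\<rparr>\<^esub> x"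

definition residue_preimage ::
    "('a, 'm) ring_scheme \<Rightarrow> 'a set \<Rightarrow> 'a set \<Rightarrow> 'a set set \<Rightarrow> 'a set" where
  "residue_preimage K T M J = {x \<in> T. residue_map K T M x \<in> J}"

subsection \<open>Split exact sequences\<close>

(* The library's exact_seq forces all groups of the sequence to have the same element type,
   which is not the case for class groups of D and of R. *)
definition split_short_exact ::
    "('a, 'm) monoid_scheme \<Rightarrow> ('a \<Rightarrow> 'b) \<Rightarrow> ('b, 'n) monoid_scheme \<Rightarrow> ('b \<Rightarrow> 'c) \<Rightarrow>
     ('c, 'o) monoid_scheme \<Rightarrow> bool" where
  "split_short_exact A f B g C \<longleftrightarrow>
     comm_group A \<and> comm_group B \<and> comm_group C \<and>
     f \<in> mon A B \<and> g \<in> epi B C \<and> f ` carrier A = kernel B C g \<and>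
     (\<exists>s \<in> hom C B. \<forall>z \<in> carrier C. g (s z) = z)"

end

theory Submission
  imports Defs
begin

text \<open>
  Write P(J) for the preimage of J under the projection of T onto k. If E is a fractional ideal of R
  with ET = T, then (R : E) = P(D : \<phi>(E)), so that the v- and t-closures of E are the preimages of
  those of \<phi>(E). Hence P embeds the t-invertible t-ideals of D into those of R, with image the H such
  that HT = T; the condition on units makes preimages of principal ideals principal. This gives the
  injectivity on the left and the exactness in the middle.

  As M = (R : T) is divisorial in R, a t-invertible product H(R : H) is not contained in M, and
  membership of y in a T-module Y can be tested by fy \<in> Y for a single f in T - M together with
  My \<subseteq> Y. This yields that the extension of the t-closure of H is the (t)_T-closure of HT.

  An invertible ideal of T can be scaled to an integral ideal I that is not contained in M. Then
  (I \<inter> R)T = I and I \<inter> R is a t-invertible t-ideal, whose class depends only on that of I by the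
  condition on units. The class of I is sent to that of I \<inter> R by the splitting.
\<close>

subsection \<open>Submodules of a field\<close>

text \<open>The obstacle to the splitting is that contraction to R respects neither scaling nor, at
  first sight, products. Products are handled by elements of residue one: if an R-module A inside R
  contains such an element a, then 1 = a + m with m in M, and y = ya + my shows that AT meets R only
  in A. So A is recovered from AT, and the contraction of a closed product can be identified after
  extension to T. Scaling by x multiplies the residues of a comaximal ideal by one fixed c in k,
  which need not lie in D. The condition on units writes c = \<phi>(u) d with d in U(D); dividing x
  by the unit u of T leaves the T-ideal unchanged and turns the factor into d, which preserves D.
  The same factorisation gives Dc = D\<phi>(u), with preimage Ru.

  The formula for (R : E) needs ET = T, which may fail for the finite subsets S of E, the only sets
  that a t-closure sees. Since 1 in ET involves finitely many elements of E, one finite set can be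
  adjoined to every S. This is why colons and v-closures are studied for arbitrary sets.\<close>

lemma subalgebraE:
  assumes "subalgebra A E K"
  shows "E \<subseteq> carrier K" "\<And>x. x \<in> E \<Longrightarrow> x \<in> carrier K"
    "\<zero>\<^bsub>K\<^esub> \<in> E" "\<And>x y. x \<in> E \<Longrightarrow> y \<in> E \<Longrightarrow> x \<oplus>\<^bsub>K\<^esub> y \<in> E"
    "\<And>x. x \<in> E \<Longrightarrow> \<ominus>\<^bsub>K\<^esub> x \<in> E"
    "\<And>a x. a \<in> A \<Longrightarrow> x \<in> E \<Longrightarrow> a \<otimes>\<^bsub>K\<^esub> x \<in> E"
proof -
  interpret subgroup E "add_monoid K" using assms by (simp add: subalgebra_def)
  show 1: "E \<subseteq> carrier K" using subset by simp
  then show "\<And>x. x \<in> E \<Longrightarrow> x \<in> carrier K" by blast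
  show "\<zero>\<^bsub>K\<^esub> \<in> E" "\<And>x y. x \<in> E \<Longrightarrow> y \<in> E \<Longrightarrow> x \<oplus>\<^bsub>K\<^esub> y \<in> E" "\<And>x. x \<in> E \<Longrightarrow> \<ominus>\<^bsub>K\<^esub> x \<in> E"
    using one_closed m_closed m_inv_closed by (auto simp: a_inv_def)
  show "\<And>a x. a \<in> A \<Longrightarrow> x \<in> E \<Longrightarrow> a \<otimes>\<^bsub>K\<^esub> x \<in> E"
    using assms by (simp add: subalgebra_def subalgebra_axioms_def)
qed

lemma ideal_prod_mono: "I \<subseteq> I' \<Longrightarrow> J \<subseteq> J' \<Longrightarrow> ideal_prod K I J \<subseteq> ideal_prod K I' J'"
proof
  fix x assume "I \<subseteq> I'" "J \<subseteq> J'" and x: "x \<in> ideal_prod K I J"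
  from x show "x \<in> ideal_prod K I' J'"
    by (induction x rule: ideal_prod.induct)
      (use \<open>I \<subseteq> I'\<close> \<open>J \<subseteq> J'\<close> in \<open>auto intro: ideal_prod.intros\<close>)
qed

lemma ideal_prod_least:
  fixes K :: "('a, 'm) ring_scheme"
  assumes "\<And>i j. i \<in> I \<Longrightarrow> j \<in> J \<Longrightarrow> i \<otimes>\<^bsub>K\<^esub> j \<in> Y"
    and "\<And>x y. x \<in> Y \<Longrightarrow> y \<in> Y \<Longrightarrow> x \<oplus>\<^bsub>K\<^esub> y \<in> Y"
  shows "ideal_prod K I J \<subseteq> Y"
proof
  fix x assume "x \<in> ideal_prod K I J"
  then show "x \<in> Y" by (induction x rule: ideal_prod.induct) (auto intro: assms)
qed

text \<open>Needed for t-closures, which see only finite subsets: it yields a finite part of a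
  fractional ideal that already generates \<open>T\<close>.\<close>

lemma ideal_prod_finite_support:
  assumes "x \<in> ideal_prod K I J"
  obtains S where "finite S" "S \<subseteq> I" "x \<in> ideal_prod K S J"
proof -
  have "\<exists>S. finite S \<and> S \<subseteq> I \<and> x \<in> ideal_prod K S J"
    using assms
  proof (induction x rule: ideal_prod.induct)
    case (prod i j)
    then show ?case by (intro exI[of _ "{i}"]) (auto intro: ideal_prod.prod)
  next
    case (sum x y)
    then obtain S S' where "finite S" "S \<subseteq> I" "x \<in> ideal_prod K S J"
      "finite S'" "S' \<subseteq> I" "y \<in> ideal_prod K S' J" by blast
    then show ?case
      using ideal_prod_mono[of S "S \<union> S'" J J K] ideal_prod_mono[of S' "S \<union> S'" J J K]
      by (intro exI[of _ "S \<union> S'"]) (auto intro!: ideal_prod.sum)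
  qed
  then show thesis using that by blast
qed

lemma colonI: "x \<in> carrier K \<Longrightarrow> (\<And>y. y \<in> S \<Longrightarrow> x \<otimes>\<^bsub>K\<^esub> y \<in> Y) \<Longrightarrow> x \<in> colon K Y S"
  by (simp add: colon_def)

lemma colonD: "x \<in> colon K Y S \<Longrightarrow> y \<in> S \<Longrightarrow> x \<otimes>\<^bsub>K\<^esub> y \<in> Y"
  by (simp add: colon_def)

lemma colon_carrier: "x \<in> colon K Y S \<Longrightarrow> x \<in> carrier K"
  by (simp add: colon_def)

lemma colon_antimono: "S \<subseteq> S' \<Longrightarrow> colon K Y S' \<subseteq> colon K Y S"
  by (auto simp: colon_def)

lemma v_op_mono: "S \<subseteq> S' \<Longrightarrow> v_op K A S \<subseteq> v_op K A S'"
  by (simp add: v_op_def colon_antimono)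

lemma v_op_carrier: "v_op K A S \<subseteq> carrier K"
  by (auto simp: v_op_def colon_def)

lemma r_coset_mem: "y \<in> E #>\<^bsub>K\<^esub> x \<longleftrightarrow> (\<exists>e\<in>E. y = e \<otimes>\<^bsub>K\<^esub> x)"
  by (auto simp: r_coset_def)

context field
begin

lemma subalgebraI:
  assumes "E \<subseteq> carrier R" "\<zero> \<in> E" "\<And>x y. x \<in> E \<Longrightarrow> y \<in> E \<Longrightarrow> x \<oplus> y \<in> E"
    "\<And>x. x \<in> E \<Longrightarrow> \<ominus> x \<in> E" "\<And>a x. a \<in> A \<Longrightarrow> x \<in> E \<Longrightarrow> a \<otimes> x \<in> E"
  shows "subalgebra A E R"
proof -
  have "subgroup E (add_monoid R)"
    using assms by (intro add.subgroupI) (auto simp: a_inv_def)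
  then show ?thesis using assms by (simp add: subalgebra_def subalgebra_axioms_def)
qed

lemma subalgebra_subset: "subalgebra A E R \<Longrightarrow> B \<subseteq> A \<Longrightarrow> subalgebra B E R"
  by (rule subalgebraI) (auto dest: subalgebraE)

lemma subalgebra_Int: "subalgebra A E R \<Longrightarrow> subalgebra A F R \<Longrightarrow> subalgebra A (E \<inter> F) R"
  by (rule subalgebraI) (auto dest: subalgebraE)

lemma subring_subalgebra: "subring A R \<Longrightarrow> subalgebra A A R"
  by (intro subalgebraI) (auto dest: subringE)

lemma nonzero_inv:
  assumes "x \<in> carrier R - {\<zero>}"
  shows "inv x \<in> carrier R - {\<zero>}" "x \<otimes> inv x = \<one>" "inv x \<otimes> x = \<one>" "inv (inv x) = x"
proof -
  have u: "x \<in> Units R" using assms by (simp add: field_Units)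
  then show "inv x \<in> carrier R - {\<zero>}" using Units_inv_Units[of x] field_Units by blast
  show "x \<otimes> inv x = \<one>" "inv x \<otimes> x = \<one>" "inv (inv x) = x" using u by auto
qed

lemma nonzero_mult: "x \<in> carrier R - {\<zero>} \<Longrightarrow> y \<in> carrier R - {\<zero>} \<Longrightarrow> x \<otimes> y \<in> carrier R - {\<zero>}"
  by (auto simp: integral_iff)

lemma inv_cancel:
  assumes "x \<in> carrier R - {\<zero>}" "y \<in> carrier R"
  shows "x \<otimes> (inv x \<otimes> y) = y" "inv x \<otimes> (x \<otimes> y) = y" "y \<otimes> x \<otimes> inv x = y" "y \<otimes> inv x \<otimes> x = y"
  using assms nonzero_inv[OF assms(1)] by (auto simp: m_assoc) (auto simp flip: m_assoc)

lemma scale_mem_iff: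
  assumes "E \<subseteq> carrier R" "x \<in> carrier R - {\<zero>}" "y \<in> carrier R"
  shows "y \<in> E #> x \<longleftrightarrow> y \<otimes> inv x \<in> E"
proof
  assume "y \<in> E #> x"
  then obtain e where "e \<in> E" "y = e \<otimes> x" by (auto simp: r_coset_mem)
  then show "y \<otimes> inv x \<in> E" using inv_cancel(3)[OF assms(2)] assms(1) by auto
next
  assume "y \<otimes> inv x \<in> E"
  then show "y \<in> E #> x" using inv_cancel(4)[OF assms(2,3)] by (metis r_coset_mem)
qed

lemma scale_in_scale: "e \<in> E \<Longrightarrow> e \<otimes> x \<in> E #> x"
  by (auto simp: r_coset_mem)

lemma scale_carrier: "E \<subseteq> carrier R \<Longrightarrow> x \<in> carrier R \<Longrightarrow> E #> x \<subseteq> carrier R"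
  by (rule r_coset_subset_G)

lemma scale_scale:
  "E \<subseteq> carrier R \<Longrightarrow> x \<in> carrier R \<Longrightarrow> y \<in> carrier R \<Longrightarrow> (E #> x) #> y = E #> (x \<otimes> y)"
  by (auto simp: r_coset_def m_assoc subsetD)

lemma scale_inv:
  assumes "E \<subseteq> carrier R" "x \<in> carrier R - {\<zero>}"
  shows "(E #> x) #> inv x = E" "(E #> inv x) #> x = E"
proof -
  have "E #> \<one> = E" using assms(1) by (force simp: r_coset_def subsetD)
  then show "(E #> x) #> inv x = E" "(E #> inv x) #> x = E"
    using assms nonzero_inv[OF assms(2)] by (simp_all add: scale_scale)
qed

lemma scale_mono: "E \<subseteq> F \<Longrightarrow> E #> x \<subseteq> F #> x"
  by (auto simp: r_coset_def)

lemma scale_subalgebra: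
  assumes "subalgebra A E R" "A \<subseteq> carrier R" "x \<in> carrier R"
  shows "subalgebra A (E #> x) R"
proof (rule subalgebraI)
  note E = subalgebraE[OF assms(1)]
  show "E #> x \<subseteq> carrier R" using E(1) assms(3) by (rule scale_carrier)
  show "\<zero> \<in> E #> x" using E(3) assms(3) by (auto simp: r_coset_mem intro!: bexI[of _ \<zero>])
  fix y assume y: "y \<in> E #> x"
  then obtain e where e: "e \<in> E" "y = e \<otimes> x" by (auto simp: r_coset_mem)
  show "\<ominus> y \<in> E #> x" 
    using e E assms(3) by (auto simp: r_coset_mem l_minus[symmetric] intro!: bexI[of _ "\<ominus> e"])
  show "a \<otimes> y \<in> E #> x" if "a \<in> A" for a
    using e E assms(2,3) that by (auto simp: r_coset_mem m_assoc intro!: bexI[of _ "a \<otimes> e"])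
  fix z assume "z \<in> E #> x"
  then obtain f where f: "f \<in> E" "z = f \<otimes> x" by (auto simp: r_coset_mem)
  show "y \<oplus> z \<in> E #> x"
    using e f E assms(3) by (auto simp: r_coset_mem l_distr intro!: bexI[of _ "e \<oplus> f"])
qed

section \<open>Products of submodules of the field\<close>

lemma ideal_prod_carrier: "I \<subseteq> carrier R \<Longrightarrow> J \<subseteq> carrier R \<Longrightarrow> I \<cdot> J \<subseteq> carrier R"
  by (rule ideal_prod_least) auto

lemma ideal_prod_subalgebra:
  assumes "subalgebra A J R" "I \<subseteq> carrier R" "I \<noteq> {}" "A \<subseteq> carrier R"
  shows "subalgebra A (I \<cdot> J) R"
proof (rule subalgebraI)
  note J = subalgebraE[OF assms(1)]
  show "I \<cdot> J \<subseteq> carrier R" using assms(2) J(1) by (rule ideal_prod_carrier)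
  obtain i where i: "i \<in> I" using assms(3) by blast
  show "\<zero> \<in> I \<cdot> J" using ideal_prod.prod[OF i J(3), of R] i assms(2) by (auto simp: subsetD)
  fix x assume x: "x \<in> I \<cdot> J"
  show "\<ominus> x \<in> I \<cdot> J"
    using x
  proof (induction x rule: ideal_prod.induct)
    case (prod i j)
    then show ?case
      using ideal_prod.prod[OF prod(1) J(5)[OF prod(2)], of R] assms(2) J(1) by (simp add: r_minus subsetD)
  next
    case (sum x y)
    then have "x \<in> carrier R" "y \<in> carrier R" using ideal_prod_carrier[OF assms(2) J(1)] by blast+
    then show ?case using ideal_prod.sum[OF sum(3,4)] by (simp add: minus_add)
  qed
  show "a \<otimes> x \<in> I \<cdot> J" if "a \<in> A" for a
    using x
  proof (induction x rule: ideal_prod.induct)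
    case (prod i j)
    then show ?case
      using ideal_prod.prod[OF prod(1) J(6)[OF that prod(2)], of R] assms(2,4) J(1) that
      by (simp add: subsetD m_lcomm)
  next
    case (sum x y)
    then have "x \<in> carrier R" "y \<in> carrier R" using ideal_prod_carrier[OF assms(2) J(1)] by blast+
    then show ?case using ideal_prod.sum[OF sum(3,4)] that assms(4) by (simp add: r_distr subsetD)
  qed
  show "\<And>y. y \<in> I \<cdot> J \<Longrightarrow> x \<oplus> y \<in> I \<cdot> J" using x by (rule ideal_prod.sum)
qed

lemma ideal_prod_comm:
  assumes "I \<subseteq> carrier R" "J \<subseteq> carrier R"
  shows "I \<cdot> J = J \<cdot> I"
proof -
  have "I \<cdot> J \<subseteq> J \<cdot> I" if "I \<subseteq> carrier R" "J \<subseteq> carrier R" for I J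
  proof (rule ideal_prod_least)
    show "i \<otimes> j \<in> J \<cdot> I" if "i \<in> I" "j \<in> J" for i j
      using ideal_prod.prod[OF that(2,1), of R] that \<open>I \<subseteq> _\<close> \<open>J \<subseteq> _\<close> by (simp add: m_comm subsetD)
  qed (rule ideal_prod.sum)
  then show ?thesis using assms by blast
qed

text \<open>The elements that \<open>z\<close> multiplies into \<open>Y\<close> are closed under
  addition, so it is enough to look at single products. Most inclusions about products are checked
  in this form.\<close>

lemma ideal_prod_colon_subset:
  assumes "\<And>x y. x \<in> Y \<Longrightarrow> y \<in> Y \<Longrightarrow> x \<oplus> y \<in> Y" "I \<subseteq> carrier R" "J \<subseteq> carrier R" "z \<in> carrier R"
    and "\<And>i j. i \<in> I \<Longrightarrow> j \<in> J \<Longrightarrow> z \<otimes> i \<otimes> j \<in> Y"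
    and "x \<in> I \<cdot> J"
  shows "z \<otimes> x \<in> Y"
proof -
  have "I \<cdot> J \<subseteq> {x \<in> carrier R. z \<otimes> x \<in> Y}"
    by (rule ideal_prod_least) (use assms in \<open>auto simp: r_distr m_assoc subsetD\<close>)
  then show ?thesis using assms(6) by blast
qed

lemma ideal_prod_assoc:
  assumes "I \<subseteq> carrier R" "J \<subseteq> carrier R" "L \<subseteq> carrier R"
  shows "I \<cdot> J \<cdot> L = I \<cdot> (J \<cdot> L)"
proof -
  have *: "I \<cdot> J \<cdot> L \<subseteq> I \<cdot> (J \<cdot> L)" if "I \<subseteq> carrier R" "J \<subseteq> carrier R" "L \<subseteq> carrier R" for I J L
  proof (rule ideal_prod_least)
    fix x l assume x: "x \<in> I \<cdot> J" and l: "l \<in> L"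
    have "l \<otimes> x \<in> I \<cdot> (J \<cdot> L)"
    proof (rule ideal_prod_colon_subset[OF _ that(1,2) _ _ x])
      show "l \<otimes> i \<otimes> j \<in> I \<cdot> (J \<cdot> L)" if "i \<in> I" "j \<in> J" for i j
      proof -
        have "i \<otimes> (j \<otimes> l) \<in> I \<cdot> (J \<cdot> L)" using that l by (intro ideal_prod.prod)
        moreover have "i \<otimes> (j \<otimes> l) = l \<otimes> i \<otimes> j"
          using that l \<open>I \<subseteq> _\<close> \<open>J \<subseteq> _\<close> \<open>L \<subseteq> _\<close> by (simp add: m_ac subsetD)
        ultimately show ?thesis by simp
      qed
    qed (use that l in \<open>auto intro: ideal_prod.sum\<close>)
    then show "x \<otimes> l \<in> I \<cdot> (J \<cdot> L)"
      using x l that ideal_prod_carrier[of I J] by (simp add: m_comm subsetD)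
  qed (rule ideal_prod.sum)
  \<comment> \<open>By commutativity the other inclusion is the one just proved, with the factors in
    reverse order.\<close>
  have "I \<cdot> (J \<cdot> L) = L \<cdot> J \<cdot> I"
    using assms by (metis ideal_prod_carrier ideal_prod_comm)
  also have "\<dots> \<subseteq> L \<cdot> (J \<cdot> I)" using * assms by blast
  also have "\<dots> = I \<cdot> J \<cdot> L"
    using assms by (metis ideal_prod_carrier ideal_prod_comm)
  finally show ?thesis using * assms by blast
qed

lemma ideal_prod_subring:
  assumes "subalgebra A E R" "subring A R"
  shows "E \<cdot> A = E"
proof
  note E = subalgebraE[OF assms(1)] and A = subringE[OF assms(2)]
  show "E \<cdot> A \<subseteq> E"
  proof (rule ideal_prod_least)
    show "i \<otimes> j \<in> E" if "i \<in> E" "j \<in> A" for i j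
      using E(6)[OF that(2,1)] that E(1) A(1) by (simp add: m_comm subsetD)
  qed (use E in blast)
  show "E \<subseteq> E \<cdot> A"
  proof
    fix x assume "x \<in> E"
    then show "x \<in> E \<cdot> A" using ideal_prod.prod[of x E \<one> A R] A(3) E(1) by (simp add: subsetD)
  qed
qed

lemma ideal_prod_scale:
  assumes "I \<subseteq> carrier R" "J \<subseteq> carrier R" "x \<in> carrier R - {\<zero>}"
  shows "(I #> x) \<cdot> J = (I \<cdot> J) #> x"
proof -
  have *: "(I #> x) \<cdot> J \<subseteq> (I \<cdot> J) #> x" if "I \<subseteq> carrier R" "J \<subseteq> carrier R" "x \<in> carrier R" for I J x
  proof (rule ideal_prod_least)
    fix y j assume "y \<in> I #> x" and j: "j \<in> J"
    then obtain i where i: "i \<in> I" "y = i \<otimes> x" by (auto simp: r_coset_mem)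
    then have "y \<otimes> j = (i \<otimes> j) \<otimes> x" using that j by (simp add: m_ac subsetD)
    then show "y \<otimes> j \<in> (I \<cdot> J) #> x" using ideal_prod.prod[OF i(1) j, of R] by (auto simp: r_coset_mem)
  next
    fix y z assume "y \<in> (I \<cdot> J) #> x" "z \<in> (I \<cdot> J) #> x"
    then obtain e f where ef: "e \<in> I \<cdot> J" "y = e \<otimes> x" "f \<in> I \<cdot> J" "z = f \<otimes> x"
      by (auto simp: r_coset_mem)
    then have "y \<oplus> z = (e \<oplus> f) \<otimes> x"
      using ideal_prod_carrier[of I J] that by (simp add: l_distr subsetD)
    then show "y \<oplus> z \<in> (I \<cdot> J) #> x" using ideal_prod.sum[OF ef(1,3)] by (auto simp: r_coset_mem)
  qed
  have ix: "inv x \<in> carrier R" and x: "x \<in> carrier R" using assms(3) nonzero_inv by auto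
  have c: "I #> x \<subseteq> carrier R" using assms(1) x by (rule scale_carrier)
  \<comment> \<open>The reverse inclusion is the first one for \<open>I #> x\<close> and the scalar
    \<open>inv x\<close>, scaled back by \<open>x\<close>.\<close>
  have "((I #> x) #> inv x) \<cdot> J \<subseteq> ((I #> x) \<cdot> J) #> inv x"
    using c assms(2) ix by (rule *)
  then have "I \<cdot> J \<subseteq> ((I #> x) \<cdot> J) #> inv x" using assms by (simp add: scale_inv)
  then have "(I \<cdot> J) #> x \<subseteq> (((I #> x) \<cdot> J) #> inv x) #> x" by (rule scale_mono)
  also have "\<dots> = (I #> x) \<cdot> J" using ideal_prod_carrier[OF c assms(2)] assms(3) by (rule scale_inv)
  finally show ?thesis using *[OF assms(1,2) x] by blast
qed

section \<open>Colon modules and v-closures\<close>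

lemma colon_subalgebra:
  assumes "subalgebra A Y R" "S \<subseteq> carrier R" "A \<subseteq> carrier R"
  shows "subalgebra A (colon R Y S) R"
  by (rule subalgebraI)
    (use subalgebraE[OF assms(1)] assms(2,3) in \<open>auto simp: colon_def subsetD l_distr l_minus m_assoc\<close>)

lemma v_op_subalgebra: "subring A R \<Longrightarrow> subalgebra A (v_op R A S) R"
  unfolding v_op_def
  by (rule colon_subalgebra) (auto simp: subring_subalgebra colon_def dest: subringE(1))

lemma v_op_extensive: "S \<subseteq> carrier R \<Longrightarrow> S \<subseteq> v_op R A S"
  by (auto simp: v_op_def colon_def subsetD m_comm)

text \<open>Forming the colon into \<open>A\<close> is an antitone Galois connection with itself, so
  three applications collapse to one.\<close>

lemma colon_v_op: "S \<subseteq> carrier R \<Longrightarrow> colon R A (v_op R A S) = colon R A S"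
proof
  assume S: "S \<subseteq> carrier R"
  show "colon R A (v_op R A S) \<subseteq> colon R A S" using v_op_extensive[OF S] by (rule colon_antimono)
  show "colon R A S \<subseteq> colon R A (v_op R A S)"
    by (auto simp: v_op_def colon_def m_comm)
qed

lemma v_op_idem: "S \<subseteq> carrier R \<Longrightarrow> v_op R A (v_op R A S) = v_op R A S"
  by (simp add: v_op_def[of R A "v_op R A S"] v_op_def[of R A S, symmetric] colon_v_op)

lemma v_op_least: "S \<subseteq> v_op R A S' \<Longrightarrow> S' \<subseteq> carrier R \<Longrightarrow> v_op R A S \<subseteq> v_op R A S'"
  using v_op_mono[of S "v_op R A S'" R A] by (simp add: v_op_idem)

lemma colon_scale:
  assumes "S \<subseteq> carrier R" "x \<in> carrier R - {\<zero>}"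
  shows "colon R A (S #> x) = colon R A S #> inv x"
proof -
  note ix = nonzero_inv[OF assms(2)]
  have "y \<in> colon R A (S #> x) \<longleftrightarrow> y \<in> colon R A S #> inv x" if "y \<in> carrier R" for y
  proof -
    have "y \<in> colon R A S #> inv x \<longleftrightarrow> y \<otimes> x \<in> colon R A S"
      using scale_mem_iff[OF _ ix(1) that, of "colon R A S"] ix by (auto simp: colon_def)
    also have "\<dots> \<longleftrightarrow> y \<in> colon R A (S #> x)"
      using that assms by (auto simp: colon_def r_coset_def m_ac subsetD)
    finally show ?thesis by simp
  qed
  moreover have "colon R A S #> inv x \<subseteq> carrier R" using ix(1) by (intro scale_carrier) (auto simp: colon_def)
  ultimately show ?thesis using colon_carrier[of _ R A "S #> x"] by blast
qed

lemma v_op_scale: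
  assumes "S \<subseteq> carrier R" "x \<in> carrier R - {\<zero>}"
  shows "v_op R A (S #> x) = v_op R A S #> x"
proof -
  have "colon R A (colon R A S #> inv x) = colon R A (colon R A S) #> inv (inv x)"
    using colon_scale[OF _ nonzero_inv(1)[OF assms(2)], of "colon R A S"] by (auto simp: colon_def)
  then show ?thesis using nonzero_inv(4)[OF assms(2)] assms by (simp add: v_op_def colon_scale)
qed

lemma colon_self: "subring A R \<Longrightarrow> colon R A A = A"
  using subringE[of A R] by (force simp: colon_def)

lemma v_op_self: "subring A R \<Longrightarrow> v_op R A A = A"
  by (simp add: v_op_def colon_self)

text \<open>Multiplication by \<open>z\<close> carries \<open>colon R A S'\<close> into
  \<open>colon R A S\<close>, and the second colon reverses the direction again. No inverse of
  \<open>z\<close> enters, so \<open>z\<close> may be zero.\<close>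

lemma v_op_mult_mem:
  assumes "S \<subseteq> carrier R" "S' \<subseteq> carrier R" "z \<in> carrier R" "\<And>s. s \<in> S \<Longrightarrow> z \<otimes> s \<in> S'" "y \<in> v_op R A S"
  shows "z \<otimes> y \<in> v_op R A S'"
  unfolding v_op_def
proof (rule colonI)
  have y: "y \<in> carrier R" using assms(5) v_op_carrier[of R A S] by blast
  then show "z \<otimes> y \<in> carrier R" using assms(3) by simp
  fix w assume w: "w \<in> colon R A S'"
  have "z \<otimes> w \<in> colon R A S"
  proof (rule colonI)
    show "z \<otimes> w \<otimes> s \<in> A" if s: "s \<in> S" for s
      using colonD[OF w assms(4)[OF s]] colon_carrier[OF w] assms(1,3) s
      by (simp add: m_ac subsetD)
  qed (use assms(3) colon_carrier[OF w] in auto)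
  then have "y \<otimes> (z \<otimes> w) \<in> A" using colonD[of y R A "colon R A S"] assms(5) by (simp add: v_op_def)
  then show "z \<otimes> y \<otimes> w \<in> A" using y assms(3) colon_carrier[OF w] by (simp add: m_ac)
qed

end

subsection \<open>Star operations and their class groups\<close>

locale qf_subring = field K for K (structure) +
  fixes A
  assumes subr: "subring A K" and qf: "is_quotient_field K A"
begin

lemma A_carrier: "A \<subseteq> carrier K" and A_zero: "\<zero> \<in> A" and A_one: "\<one> \<in> A"
  and A_mult: "\<And>x y. x \<in> A \<Longrightarrow> y \<in> A \<Longrightarrow> x \<otimes> y \<in> A"
  using subringE[OF subr] by auto

text \<open>A denominator from the field suffices: if \<open>d = a / b\<close> with \<open>a\<close>
  and \<open>b\<close> in \<open>A\<close>, then \<open>a = b d\<close> clears denominators as well.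
  This is where the quotient field hypothesis enters.\<close>

lemma frac_idealsI:
  assumes "subalgebra A E K" "e \<in> E" "e \<noteq> \<zero>" "d \<in> carrier K - {\<zero>}" "\<And>x. x \<in> E \<Longrightarrow> d \<otimes> x \<in> A"
  shows "E \<in> frac_ideals K A"
proof -
  obtain a b where ab: "a \<in> A" "b \<in> A - {\<zero>}" "d = a \<otimes> inv b"
    using qf assms(4) unfolding is_quotient_field_def by blast
  have c: "a \<in> carrier K" "b \<in> carrier K - {\<zero>}" using ab A_carrier by auto
  have "a \<noteq> \<zero>" using ab(3) assms(4) nonzero_inv(1)[OF c(2)] by auto
  have eq: "a = b \<otimes> d" using inv_cancel(1)[OF c(2,1)] nonzero_inv(1)[OF c(2)] c ab(3) by (simp add: m_comm)
  have "a \<otimes> x \<in> A" if "x \<in> E" for x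
  proof -
    have "a \<otimes> x = b \<otimes> (d \<otimes> x)"
      using that c assms(4) subalgebraE(1)[OF assms(1)] by (simp add: eq m_assoc subsetD)
    then show ?thesis using ab(2) assms(5)[OF that] A_mult by simp
  qed
  then show ?thesis
    unfolding frac_ideals_def using assms(1-3) ab(1) \<open>a \<noteq> \<zero>\<close> by blast
qed

lemma frac_idealsE:
  assumes "E \<in> frac_ideals K A"
  shows "subalgebra A E K" "E \<subseteq> carrier K" "\<exists>e\<in>E. e \<noteq> \<zero>"
    "\<exists>d\<in>carrier K - {\<zero>}. \<forall>x\<in>E. d \<otimes> x \<in> A"
proof -
  show "subalgebra A E K" using assms by (simp add: frac_ideals_def)
  note E = subalgebraE[OF this]
  show "E \<subseteq> carrier K" by (rule E)
  show "\<exists>e\<in>E. e \<noteq> \<zero>" using assms E(3) by (auto simp: frac_ideals_def)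
  show "\<exists>d\<in>carrier K - {\<zero>}. \<forall>x\<in>E. d \<otimes> x \<in> A"
    using assms A_carrier by (auto simp: frac_ideals_def)
qed

lemma frac_ideals_self: "A \<in> frac_ideals K A"
  by (rule frac_idealsI[OF subring_subalgebra[OF subr] A_one, of \<one>]) (use A_carrier in auto)

lemma frac_ideals_scale:
  assumes "E \<in> frac_ideals K A" "x \<in> carrier K - {\<zero>}"
  shows "E #> x \<in> frac_ideals K A"
proof -
  note E = frac_idealsE[OF assms(1)]
  obtain e d where e: "e \<in> E" "e \<noteq> \<zero>" and d: "d \<in> carrier K - {\<zero>}" "\<forall>x\<in>E. d \<otimes> x \<in> A"
    using E by blast
  show ?thesis
  proof (rule frac_idealsI)
    show "subalgebra A (E #> x) K" using E(1) A_carrier assms(2) by (intro scale_subalgebra) auto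
    show "e \<otimes> x \<in> E #> x" using e(1) by (rule scale_in_scale)
    show "e \<otimes> x \<noteq> \<zero>" using e E(2) assms(2) nonzero_mult[of e x] by auto
    show "d \<otimes> inv x \<in> carrier K - {\<zero>}" using d(1) nonzero_inv(1)[OF assms(2)] by (rule nonzero_mult)
    fix y assume "y \<in> E #> x"
    then obtain f where f: "f \<in> E" "y = f \<otimes> x" by (auto simp: r_coset_mem)
    have "d \<otimes> inv x \<otimes> y = d \<otimes> (f \<otimes> x \<otimes> inv x)"
      using f E(2) d(1) assms(2) nonzero_inv(1)[OF assms(2)] by (simp add: subsetD m_ac)
    also have "\<dots> = d \<otimes> f" using f E(2) assms(2) by (simp add: inv_cancel subsetD)
    finally show "d \<otimes> inv x \<otimes> y \<in> A" using d(2) f(1) by simp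
  qed
qed

lemma frac_ideals_prod:
  assumes "E \<in> frac_ideals K A" "F \<in> frac_ideals K A"
  shows "E \<cdot> F \<in> frac_ideals K A"
proof -
  note E = frac_idealsE[OF assms(1)] and F = frac_idealsE[OF assms(2)]
  obtain e d where e: "e \<in> E" "e \<noteq> \<zero>" and d: "d \<in> carrier K - {\<zero>}" "\<forall>x\<in>E. d \<otimes> x \<in> A"
    using E by blast
  obtain f c where f: "f \<in> F" "f \<noteq> \<zero>" and c: "c \<in> carrier K - {\<zero>}" "\<forall>x\<in>F. c \<otimes> x \<in> A"
    using F by blast
  show ?thesis
  proof (rule frac_idealsI)
    show "subalgebra A (E \<cdot> F) K" using E F A_carrier by (intro ideal_prod_subalgebra) auto
    show "e \<otimes> f \<in> E \<cdot> F" using e f by (intro ideal_prod.prod)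
    show "e \<otimes> f \<noteq> \<zero>" using e f E(2) F(2) nonzero_mult[of e f] by auto
    show dc: "d \<otimes> c \<in> carrier K - {\<zero>}" using d c by (intro nonzero_mult)
    show "d \<otimes> c \<otimes> x \<in> A" if "x \<in> E \<cdot> F" for x
    proof (rule ideal_prod_colon_subset[OF _ E(2) F(2) _ _ that])
      fix i j assume "i \<in> E" "j \<in> F"
      then have "(d \<otimes> i) \<otimes> (c \<otimes> j) \<in> A" using d(2) c(2) A_mult by blast
      then show "d \<otimes> c \<otimes> i \<otimes> j \<in> A"
        using \<open>i \<in> E\<close> \<open>j \<in> F\<close> d(1) c(1) E(2) F(2) by (simp add: m_ac subsetD)
    qed (use subringE[OF subr] dc in auto)
  qed
qed

text \<open>The roles are exchanged: a denominator of \<open>E\<close> is a nonzero element of the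
  colon, and a nonzero element of \<open>E\<close> is a denominator of the colon.\<close>

lemma frac_ideals_colon:
  assumes "E \<in> frac_ideals K A"
  shows "colon K A E \<in> frac_ideals K A"
proof -
  note E = frac_idealsE[OF assms(1)]
  obtain e d where e: "e \<in> E" "e \<noteq> \<zero>" and d: "d \<in> carrier K - {\<zero>}" "\<forall>x\<in>E. d \<otimes> x \<in> A"
    using E by blast
  show ?thesis
  proof (rule frac_idealsI)
    show "subalgebra A (colon K A E) K"
      using subring_subalgebra[OF subr] E A_carrier by (intro colon_subalgebra)
    show "d \<in> colon K A E" "d \<noteq> \<zero>" using d by (auto intro: colonI)
    show "e \<in> carrier K - {\<zero>}" using e E(2) by auto
    show "e \<otimes> x \<in> A" if "x \<in> colon K A E" for x
      using colonD[OF that e(1)] colon_carrier[OF that] e(1) E(2) by (simp add: m_comm subsetD)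
  qed
qed

lemma frac_ideals_v_op: "E \<in> frac_ideals K A \<Longrightarrow> v_op K A E \<in> frac_ideals K A"
  by (simp add: v_op_def frac_ideals_colon)

text \<open>The coefficients of \<open>Span\<close> come from the subring \<open>A\<close>, which
  need not be a field. The induction uses the description of each further step as sums
  \<open>a u + s\<close>, and identifies the span as the smallest \<open>A\<close>-submodule
  containing the list.\<close>

lemma Span_props:
  assumes "set us \<subseteq> carrier K"
  shows "subalgebra A (Span A us) K" "set us \<subseteq> Span A us"
    "\<And>E. subalgebra A E K \<Longrightarrow> set us \<subseteq> E \<Longrightarrow> Span A us \<subseteq> E"
proof -
  have mem: "x \<in> Span A (u # us) \<longleftrightarrow> (\<exists>a\<in>A. \<exists>s\<in>Span A us. x = a \<otimes> u \<oplus> s)" for x u us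
    by (simp add: line_extension_mem_iff)
  have "subalgebra A (Span A us) K \<and> set us \<subseteq> Span A us" using assms
  proof (induction us)
    case Nil
    show ?case using A_carrier by (auto intro!: subalgebraI)
  next
    case (Cons u us)
    then have u: "u \<in> carrier K" and IH: "subalgebra A (Span A us) K" "set us \<subseteq> Span A us" by auto
    note S = subalgebraE[OF IH(1)] and A = subringE[OF subr]
    have "subalgebra A (Span A (u # us)) K"
    proof (rule subalgebraI)
      show "Span A (u # us) \<subseteq> carrier K" 
      proof
        fix x assume "x \<in> Span A (u # us)"
        then obtain a s where "a \<in> A" "s \<in> Span A us" "x = a \<otimes> u \<oplus> s" using mem by blast
        then show "x \<in> carrier K" using u S(2) A(1) by (simp add: subsetD)
      qed
      have "\<zero> = \<zero> \<otimes> u \<oplus> \<zero>" using u by simp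
      then show "\<zero> \<in> Span A (u # us)" using S(3) A_zero mem by blast
      fix x assume "x \<in> Span A (u # us)"
      then obtain a s where x: "a \<in> A" "s \<in> Span A us" "x = a \<otimes> u \<oplus> s" using mem by blast
      have "\<ominus> x = (\<ominus> a) \<otimes> u \<oplus> \<ominus> s" using x u S(2) A(1) by (simp add: minus_add l_minus subsetD)
      then show "\<ominus> x \<in> Span A (u # us)" using A(5)[OF x(1)] S(5)[OF x(2)] mem by blast
      show "c \<otimes> x \<in> Span A (u # us)" if "c \<in> A" for c
      proof -
        have "c \<otimes> x = (c \<otimes> a) \<otimes> u \<oplus> c \<otimes> s"
          using x u S(2) A(1) that by (simp add: r_distr m_assoc subsetD)
        then show ?thesis using A_mult[OF that x(1)] S(6)[OF that x(2)] mem by blast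
      qed
      fix y assume "y \<in> Span A (u # us)"
      then obtain b t where y: "b \<in> A" "t \<in> Span A us" "y = b \<otimes> u \<oplus> t" using mem by blast
      have "x \<oplus> y = (a \<oplus> b) \<otimes> u \<oplus> (s \<oplus> t)"
        using x y u S(2) A(1) by (simp add: l_distr a_ac subsetD)
      then show "x \<oplus> y \<in> Span A (u # us)" using A(7)[OF x(1) y(1)] S(4)[OF x(2) y(2)] mem by blast
    qed
    moreover have "v \<in> Span A (u # us)" if "v \<in> Span A us" for v
    proof -
      have "v = \<zero> \<otimes> u \<oplus> v" using u S(2)[OF that] by simp
      then show ?thesis using that A_zero mem by blast
    qed
    moreover have "u \<in> Span A (u # us)"
    proof -
      have "u = \<one> \<otimes> u \<oplus> \<zero>" using u by simp
      then show ?thesis using S(3) A_one mem by blast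
    qed
    ultimately show ?case using IH(2) by auto
  qed
  then show "subalgebra A (Span A us) K" "set us \<subseteq> Span A us" by auto
  fix E assume E: "subalgebra A E K" "set us \<subseteq> E"
  then show "Span A us \<subseteq> E"
  proof (induction us)
    case Nil
    then show ?case using subalgebraE(3)[OF E(1)] by simp
  next
    case (Cons u us)
    show ?case
    proof
      fix x assume "x \<in> Span A (u # us)"
      then obtain a s where "a \<in> A" "s \<in> Span A us" "x = a \<otimes> u \<oplus> s" using mem by blast
      then show "x \<in> E" using Cons subalgebraE(4,6)[OF E(1)] by auto
    qed
  qed
qed

text \<open>Finite sets of generators suffice here, as the v-closure of a set is that of its span.\<close>

lemma t_op_eq:
  assumes "E \<in> frac_ideals K A"
  shows "t_op K A E = {x. \<exists>S. finite S \<and> S \<subseteq> E \<and> x \<in> v_op K A S}"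
proof -
  note E = frac_idealsE[OF assms]
  have "x \<in> t_op K A E \<longleftrightarrow> (\<exists>S. finite S \<and> S \<subseteq> E \<and> x \<in> v_op K A S)" for x
  proof
    assume "x \<in> t_op K A E"
    then obtain us where us: "set us \<subseteq> carrier K" "Span A us \<subseteq> E" "x \<in> v_op K A (Span A us)"
      by (auto simp: t_op_def finite_type_def fg_frac_ideals_def)
    have "Span A us \<subseteq> v_op K A (set us)"
      using Span_props(3)[OF us(1) v_op_subalgebra[OF subr]] v_op_extensive[OF us(1)] by blast
    then have "v_op K A (Span A us) \<subseteq> v_op K A (set us)" using us(1) by (rule v_op_least)
    then show "\<exists>S. finite S \<and> S \<subseteq> E \<and> x \<in> v_op K A S"
      using us Span_props(2)[OF us(1)] by (intro exI[of _ "set us"]) auto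
  next
    assume "\<exists>S. finite S \<and> S \<subseteq> E \<and> x \<in> v_op K A S"
    then obtain S where S: "finite S" "S \<subseteq> E" "x \<in> v_op K A S" by blast
    \<comment> \<open>\<open>S\<close> may be empty or consist of zero, whereas members of
      \<open>fg_frac_ideals\<close> are nonzero modules; adjoining a nonzero \<open>e\<close> of
      \<open>E\<close> makes the span admissible.\<close>
    obtain e where e: "e \<in> E" "e \<noteq> \<zero>" using E(3) by blast
    obtain us where us: "set us = insert e S" using S(1) finite_list[of "insert e S"] by auto
    then have sub: "set us \<subseteq> E" using S(2) e(1) by simp
    then have usc: "set us \<subseteq> carrier K" using E(2) by blast
    note sp = Span_props[OF usc]
    have le: "Span A us \<subseteq> E" using sp(3)[OF E(1) sub] .
    obtain d where d: "d \<in> carrier K - {\<zero>}" "\<forall>x\<in>E. d \<otimes> x \<in> A" using E(4) by blast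
    have "Span A us \<in> frac_ideals K A"
      using sp(1) _ e(2) d(1) by (rule frac_idealsI) (use sp(2) us le d(2) in auto)
    then have "Span A us \<in> fg_frac_ideals K A" unfolding fg_frac_ideals_def using usc by blast
    moreover have "x \<in> v_op K A (Span A us)" using v_op_mono[of S "Span A us" K A] S(3) sp(2) us by blast
    ultimately show "x \<in> t_op K A E" unfolding t_op_def finite_type_def using le by blast
  qed
  then show ?thesis by blast
qed

end

text \<open>The usual axiom that nonzero principal fractional ideals are closed is the combination
  of \<open>star_self\<close> and \<open>star_scale\<close>.\<close>

locale star_operation = qf_subring +
  fixes star
  assumes star_frac: "\<And>E. E \<in> frac_ideals K A \<Longrightarrow> star E \<in> frac_ideals K A"
    and star_scale: "\<And>E x. E \<in> frac_ideals K A \<Longrightarrow> x \<in> carrier K - {\<zero>} \<Longrightarrow> star (E #> x) = star E #> x"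
    and star_self: "star A = A"
    and star_mono: "\<And>E F. E \<in> frac_ideals K A \<Longrightarrow> F \<in> frac_ideals K A \<Longrightarrow> E \<subseteq> F \<Longrightarrow> star E \<subseteq> star F"
    and star_extensive: "\<And>E. E \<in> frac_ideals K A \<Longrightarrow> E \<subseteq> star E"
    and star_idem: "\<And>E. E \<in> frac_ideals K A \<Longrightarrow> star (star E) = star E"
begin

text \<open>Homogeneity and monotonicity, rephrased for elements: for nonzero \<open>z\<close> the
  hypothesis says that \<open>E #> z\<close> is contained in \<open>F\<close>. Allowing
  \<open>z\<close> to be zero spares case distinctions in all later uses.\<close>

lemma star_mult_mem:
  assumes "E \<in> frac_ideals K A" "F \<in> frac_ideals K A" "z \<in> carrier K"
    and "\<And>e. e \<in> E \<Longrightarrow> z \<otimes> e \<in> F" "y \<in> star E"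
  shows "z \<otimes> y \<in> star F"
proof (cases "z = \<zero>")
  case True
  then show ?thesis
    using subalgebraE(3)[OF frac_idealsE(1)[OF star_frac[OF assms(2)]]]
      frac_idealsE(2)[OF star_frac[OF assms(1)]] assms(5)
    by (simp add: subsetD)
next
  case False
  then have z: "z \<in> carrier K - {\<zero>}" using assms(3) by simp
  have "E #> z \<subseteq> F"
    using assms(4) frac_idealsE(2)[OF assms(1)] assms(3) by (auto simp: r_coset_mem m_comm subsetD)
  then have "star (E #> z) \<subseteq> star F"
    using star_mono[OF frac_ideals_scale[OF assms(1) z] assms(2)] by simp
  then have "y \<otimes> z \<in> star F" using star_scale[OF assms(1) z] scale_in_scale[OF assms(5)] by auto
  then show ?thesis
    using frac_idealsE(2)[OF star_frac[OF assms(1)]] assms(3,5) by (simp add: m_comm subsetD)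
qed

lemma star_least:
  assumes "E \<in> frac_ideals K A" "F \<in> frac_ideals K A" "E \<subseteq> star F"
  shows "star E \<subseteq> star F"
  using star_mono[OF assms(1) star_frac[OF assms(2)] assms(3)] star_idem[OF assms(2)] by simp

text \<open>For a fixed \<open>f\<close> in \<open>F\<close>, multiplication by \<open>f\<close>
  sends \<open>E\<close> into \<open>E \<cdot> F\<close>, hence the closure of \<open>E\<close> into
  the closure of \<open>E \<cdot> F\<close>.\<close>

lemma star_prod_left:
  assumes "E \<in> frac_ideals K A" "F \<in> frac_ideals K A"
  shows "star (star E \<cdot> F) = star (E \<cdot> F)"
proof
  note EF = frac_ideals_prod[OF assms] and c = frac_idealsE(2)
  note sE = star_frac[OF assms(1)]
  have "star E \<cdot> F \<subseteq> star (E \<cdot> F)"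
  proof (rule ideal_prod_least)
    fix e f assume e: "e \<in> star E" and f: "f \<in> F"
    have "f \<otimes> e \<in> star (E \<cdot> F)"
    proof (rule star_mult_mem[OF assms(1) EF _ _ e])
      show "f \<otimes> x \<in> E \<cdot> F" if "x \<in> E" for x
        using ideal_prod.prod[OF that f, of K] that f c[OF assms(1)] c[OF assms(2)] by (simp add: m_comm subsetD)
    qed (use f c[OF assms(2)] in auto)
    then show "e \<otimes> f \<in> star (E \<cdot> F)"
      using e f c[OF sE] c[OF assms(2)] by (simp add: m_comm subsetD)
  qed (rule subalgebraE(4)[OF frac_idealsE(1)[OF star_frac[OF EF]]])
  then show "star (star E \<cdot> F) \<subseteq> star (E \<cdot> F)"
    using star_least[OF frac_ideals_prod[OF sE assms(2)] EF] by simp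
  show "star (E \<cdot> F) \<subseteq> star (star E \<cdot> F)"
    using star_extensive[OF assms(1)]
    by (intro star_mono[OF EF frac_ideals_prod[OF sE assms(2)]] ideal_prod_mono) auto
qed

lemma star_prod_right:
  assumes "E \<in> frac_ideals K A" "F \<in> frac_ideals K A"
  shows "star (E \<cdot> star F) = star (E \<cdot> F)"
  using star_prod_left[OF assms(2,1)] ideal_prod_comm frac_idealsE(2) star_frac assms by metis

section \<open>Colons of closures and star-invertible ideals\<close>

lemma colon_star:
  assumes "E \<in> frac_ideals K A"
  shows "colon K A (star E) = colon K A E"
proof
  show "colon K A (star E) \<subseteq> colon K A E" using star_extensive[OF assms] by (rule colon_antimono)
  show "colon K A E \<subseteq> colon K A (star E)"
  proof
    fix x assume x: "x \<in> colon K A E"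
    show "x \<in> colon K A (star E)"
    proof (rule colonI)
      show "x \<otimes> y \<in> A" if "y \<in> star E" for y
        using star_mult_mem[OF assms frac_ideals_self colon_carrier[OF x] colonD[OF x] that]
        by (simp add: star_self)
    qed (rule colon_carrier[OF x])
  qed
qed

text \<open>Each \<open>e\<close> in \<open>E\<close> multiplies the colon into \<open>A\<close>,
  and so also its closure, because \<open>A\<close> is closed. Hence the inverse of a
  star-invertible ideal lies in the group without further closing.\<close>

lemma star_colon:
  assumes "E \<in> frac_ideals K A"
  shows "star (colon K A E) = colon K A E"
proof
  note C = frac_ideals_colon[OF assms]
  show "colon K A E \<subseteq> star (colon K A E)" using C by (rule star_extensive)
  show "star (colon K A E) \<subseteq> colon K A E"
  proof
    fix y assume y: "y \<in> star (colon K A E)"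
    then have yc: "y \<in> carrier K" using frac_idealsE(2)[OF star_frac[OF C]] by blast
    show "y \<in> colon K A E"
    proof (rule colonI[OF yc])
      fix e assume e: "e \<in> E"
      then have ec: "e \<in> carrier K" using frac_idealsE(2)[OF assms] by blast
      have "e \<otimes> y \<in> star A"
      proof (rule star_mult_mem[OF C frac_ideals_self ec _ y])
        show "e \<otimes> x \<in> A" if "x \<in> colon K A E" for x
          using colonD[OF that e] colon_carrier[OF that] ec by (simp add: m_comm)
      qed
      then show "y \<otimes> e \<in> A" using yc ec by (simp add: star_self m_comm)
    qed
  qed
qed

text \<open>In contrast to \<open>Inv_group\<close>, closedness is not demanded, so that products
  and extensions can be treated before they are closed.\<close>

definition invertible where
  "invertible E \<longleftrightarrow> E \<in> frac_ideals K A \<and> star (E \<cdot> colon K A E) = A"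

lemma invertible_frac: "invertible E \<Longrightarrow> E \<in> frac_ideals K A"
  by (simp add: invertible_def)

lemma prod_colon_subset: "E \<in> frac_ideals K A \<Longrightarrow> E \<cdot> colon K A E \<subseteq> A"
proof (rule ideal_prod_least)
  assume E: "E \<in> frac_ideals K A"
  show "i \<otimes> j \<in> A" if "i \<in> E" "j \<in> colon K A E" for i j
    using colonD[OF that(2,1)] colon_carrier[OF that(2)] that(1) frac_idealsE(2)[OF E] by (simp add: m_comm subsetD)
qed (use subringE[OF subr] in auto)

text \<open>Any witness \<open>J\<close> is contained in \<open>colon K A E\<close>, so
  \<open>E \<cdot> colon K A E\<close> lies between \<open>E \<cdot> J\<close> and \<open>A\<close>,
  and both of these have closure \<open>A\<close>.\<close>

lemma invertibleI:
  assumes "E \<in> frac_ideals K A" "J \<in> frac_ideals K A" "star (E \<cdot> J) = A"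
  shows "invertible E"
proof -
  note c = frac_idealsE(2)[OF assms(1)] frac_idealsE(2)[OF assms(2)]
  have EJ: "E \<cdot> J \<subseteq> A" using star_extensive[OF frac_ideals_prod[OF assms(1,2)]] assms(3) by simp
  have "J \<subseteq> colon K A E"
  proof
    fix j assume j: "j \<in> J"
    then show "j \<in> colon K A E"
    proof (intro colonI)
      show "j \<otimes> e \<in> A" if "e \<in> E" for e
        using subsetD[OF EJ ideal_prod.prod[OF that j]] that j c by (simp add: m_comm subsetD)
    qed (use c in auto)
  qed
  then have "A \<subseteq> star (E \<cdot> colon K A E)"
    using assms star_mono[OF frac_ideals_prod[OF assms(1,2)] frac_ideals_prod[OF assms(1) frac_ideals_colon[OF assms(1)]]]
      ideal_prod_mono[of E E J "colon K A E" K] by auto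
  moreover have "star (E \<cdot> colon K A E) \<subseteq> star A"
    using frac_ideals_prod[OF assms(1) frac_ideals_colon[OF assms(1)]] frac_ideals_self
      prod_colon_subset[OF assms(1)] by (rule star_mono)
  ultimately show ?thesis using assms(1) by (simp add: invertible_def star_self)
qed

lemma invertible_star: "invertible E \<Longrightarrow> invertible (star E)"
  using star_prod_left[of E "colon K A E"] frac_ideals_colon[of E] star_frac[of E]
  by (intro invertibleI[of "star E" "colon K A E"]) (auto simp: invertible_def)

lemma invertible_colon: "invertible E \<Longrightarrow> invertible (colon K A E)"
  using ideal_prod_comm[of E "colon K A E"] frac_ideals_colon[of E] frac_idealsE(2)[of E]
    frac_idealsE(2)[of "colon K A E"]
  by (intro invertibleI[of "colon K A E" E]) (auto simp: invertible_def)

lemma star_prod_both: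
  assumes "E \<in> frac_ideals K A" "F \<in> frac_ideals K A"
  shows "star (star E \<cdot> star F) = star (E \<cdot> F)"
  using star_prod_left[OF assms(1) star_frac[OF assms(2)]] star_prod_right[OF assms] by simp

lemma invertible_prod:
  assumes "invertible E" "invertible F"
  shows "invertible (E \<cdot> F)"
proof -
  let ?E = "colon K A E" and ?F = "colon K A F"
  have f: "E \<in> frac_ideals K A" "F \<in> frac_ideals K A" "?E \<in> frac_ideals K A" "?F \<in> frac_ideals K A"
    using assms frac_ideals_colon by (auto simp: invertible_def)
  note c = f[THEN frac_idealsE(2)]
  have "E \<cdot> F \<cdot> (?E \<cdot> ?F) = E \<cdot> ?E \<cdot> (F \<cdot> ?F)"
    using c by (metis ideal_prod_assoc ideal_prod_carrier ideal_prod_comm)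
  moreover have "star (E \<cdot> ?E \<cdot> (F \<cdot> ?F)) = star (A \<cdot> A)"
    using star_prod_both[of "E \<cdot> ?E" "F \<cdot> ?F"] assms frac_ideals_prod f by (simp add: invertible_def)
  ultimately show ?thesis
    using frac_ideals_prod f ideal_prod_subring[OF subring_subalgebra[OF subr] subr] star_self
    by (intro invertibleI[of "E \<cdot> F" "?E \<cdot> ?F"]) auto
qed

lemma invertible_scale:
  assumes "invertible E" "x \<in> carrier K - {\<zero>}"
  shows "invertible (E #> x)"
proof (rule invertibleI)
  let ?J = "colon K A E #> inv x"
  note E = invertible_frac[OF assms(1)] and ix = nonzero_inv(1)[OF assms(2)]
  note c = frac_idealsE(2)[OF E] frac_idealsE(2)[OF frac_ideals_colon[OF E]]
  show "E #> x \<in> frac_ideals K A" using E assms(2) by (rule frac_ideals_scale)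
  show "?J \<in> frac_ideals K A" using frac_ideals_colon[OF E] ix by (rule frac_ideals_scale)
  have "(E #> x) \<cdot> ?J = (E \<cdot> ?J) #> x"
    using c assms(2) ix by (intro ideal_prod_scale scale_carrier) auto
  also have "E \<cdot> ?J = (E \<cdot> colon K A E) #> inv x"
    using c ix scale_carrier[OF c(2), of "inv x"]
    by (metis DiffE ideal_prod_comm ideal_prod_scale)
  also have "\<dots> #> x = E \<cdot> colon K A E"
    using scale_inv(2)[OF ideal_prod_carrier[OF c] assms(2)] .
  finally show "star ((E #> x) \<cdot> ?J) = A" using assms(1) by (simp add: invertible_def)
qed

section \<open>The group of invertible closed ideals and its class group\<close>

lemma Inv_group_carrier: "I \<in> carrier (Inv_group K A star) \<longleftrightarrow> invertible I \<and> star I = I"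
  by (auto simp: Inv_group_def invertible_def)

lemma Inv_group_mult: "I \<otimes>\<^bsub>Inv_group K A star\<^esub> J = star (I \<cdot> J)"
  and Inv_group_one: "\<one>\<^bsub>Inv_group K A star\<^esub> = A"
  by (simp_all add: Inv_group_def)

lemma Inv_frac: "I \<in> carrier (Inv_group K A star) \<Longrightarrow> I \<in> frac_ideals K A"
  by (simp add: Inv_group_carrier invertible_frac)

lemma Inv_scale: "I \<in> carrier (Inv_group K A star) \<Longrightarrow> x \<in> carrier K - {\<zero>} \<Longrightarrow> I #> x \<in> carrier (Inv_group K A star)"
  using invertible_scale star_scale Inv_frac by (auto simp: Inv_group_carrier)

lemma Inv_self: "A \<in> carrier (Inv_group K A star)"
  using invertibleI[OF frac_ideals_self frac_ideals_self] 
    ideal_prod_subring[OF subring_subalgebra[OF subr] subr] star_self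
  by (simp add: Inv_group_carrier)

lemma self_prod: "E \<in> frac_ideals K A \<Longrightarrow> A \<cdot> E = E"
  using ideal_prod_subring[OF frac_idealsE(1) subr] ideal_prod_comm[OF A_carrier frac_idealsE(2)] by metis

lemma Inv_comm_group: "comm_group (Inv_group K A star)"
proof (rule comm_groupI, unfold Inv_group_mult Inv_group_one)
  let ?G = "carrier (Inv_group K A star)"
  show "A \<in> ?G" by (rule Inv_self)
  fix I assume I: "I \<in> ?G"
  note If = Inv_frac[OF I]
  show "star (A \<cdot> I) = I" using I self_prod[OF If] by (simp add: Inv_group_carrier)
  have "colon K A I \<in> ?G"
    using I star_colon[OF If] invertible_colon by (simp add: Inv_group_carrier)
  moreover have "star (colon K A I \<cdot> I) = A"
    using I ideal_prod_comm[OF frac_idealsE(2)[OF If] frac_idealsE(2)[OF frac_ideals_colon[OF If]]]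
    by (simp add: Inv_group_carrier invertible_def)
  ultimately show "\<exists>J\<in>?G. star (J \<cdot> I) = A" by blast
  fix J assume J: "J \<in> ?G"
  note Jf = Inv_frac[OF J]
  show "star (I \<cdot> J) \<in> ?G"
    using I J invertible_star[OF invertible_prod] star_idem[OF frac_ideals_prod[OF If Jf]]
    by (simp add: Inv_group_carrier)
  show "star (I \<cdot> J) = star (J \<cdot> I)" using ideal_prod_comm If Jf frac_idealsE(2) by metis
  fix L assume L: "L \<in> ?G"
  note Lf = Inv_frac[OF L]
  have "star (star (I \<cdot> J) \<cdot> L) = star (I \<cdot> J \<cdot> L)"
    using frac_ideals_prod[OF If Jf] Lf by (rule star_prod_left)
  also have "\<dots> = star (I \<cdot> (J \<cdot> L))"
    using If Jf Lf frac_idealsE(2) ideal_prod_assoc by metis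
  also have "\<dots> = star (I \<cdot> star (J \<cdot> L))"
    using star_prod_right[OF If frac_ideals_prod[OF Jf Lf]] by simp
  finally show "star (star (I \<cdot> J) \<cdot> L) = star (I \<cdot> star (J \<cdot> L))" .
qed

lemma Prin_prod:
  assumes "E \<in> frac_ideals K A" "x \<in> carrier K - {\<zero>}"
  shows "(A #> x) \<cdot> E = E #> x"
  using ideal_prod_scale[OF A_carrier frac_idealsE(2)[OF assms(1)] assms(2)] self_prod[OF assms(1)] by simp

lemma Prin_in_Inv: "Prin K A \<subseteq> carrier (Inv_group K A star)"
  using Inv_scale[OF Inv_self] by (auto simp: Prin_def)

lemma Prin_subgroup: "subgroup (Prin K A) (Inv_group K A star)"
proof -
  interpret G: comm_group "Inv_group K A star" by (rule Inv_comm_group)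
  have mult: "(A #> x) \<otimes>\<^bsub>Inv_group K A star\<^esub> (A #> y) = A #> (y \<otimes> x)"
    if "x \<in> carrier K - {\<zero>}" "y \<in> carrier K - {\<zero>}" for x y
  proof -
    have "(A #> x) \<cdot> (A #> y) = A #> (y \<otimes> x)"
      using Prin_prod[OF frac_ideals_scale[OF frac_ideals_self that(2)] that(1)] scale_scale[OF A_carrier] that by simp
    then show ?thesis
      using star_scale[OF frac_ideals_self] nonzero_mult[OF that(2,1)] by (simp add: Inv_group_mult star_self)
  qed
  have one: "A #> \<one> = A" using A_carrier by (force simp: r_coset_def)
  show ?thesis
  proof (rule G.subgroupI)
    show "Prin K A \<subseteq> carrier (Inv_group K A star)" by (rule Prin_in_Inv)
    show "Prin K A \<noteq> {}" by (auto simp: Prin_def)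
    show "I \<otimes>\<^bsub>Inv_group K A star\<^esub> J \<in> Prin K A" if "I \<in> Prin K A" "J \<in> Prin K A" for I J
      using that mult nonzero_mult unfolding Prin_def by blast
    fix I assume "I \<in> Prin K A"
    then obtain x where x: "x \<in> carrier K - {\<zero>}" "I = A #> x" by (auto simp: Prin_def)
    note ix = nonzero_inv[OF x(1)]
    have "(A #> inv x) \<otimes>\<^bsub>Inv_group K A star\<^esub> I = \<one>\<^bsub>Inv_group K A star\<^esub>"
      using mult[OF ix(1) x(1)] ix(2) one by (simp add: x(2) Inv_group_one)
    then have "inv\<^bsub>Inv_group K A star\<^esub> I = A #> inv x"
      using Inv_scale[OF Inv_self] x ix(1) by (intro G.inv_equality) auto
    then show "inv\<^bsub>Inv_group K A star\<^esub> I \<in> Prin K A" using ix(1) by (auto simp: Prin_def)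
  qed
qed

lemma Prin_normal: "Prin K A \<lhd> Inv_group K A star"
  using comm_group.normal_iff_subgroup[OF Inv_comm_group] Prin_subgroup by blast

lemma Cl_comm_group: "comm_group (Cl_group K A star)"
  unfolding Cl_group_def using Inv_comm_group Prin_subgroup by (rule comm_group.abelian_FactGroup)

text \<open>Multiplication by a principal ideal is scaling, and a scaled closed ideal is again
  closed. A class is therefore an orbit under nonzero scalars, which lets later arguments avoid
  cosets.\<close>

lemma ideal_class_eq:
  assumes "I \<in> carrier (Inv_group K A star)"
  shows "ideal_class K A star I = {I #> x | x. x \<in> carrier K - {\<zero>}}"
proof -
  have "(A #> x) \<otimes>\<^bsub>Inv_group K A star\<^esub> I = I #> x" if "x \<in> carrier K - {\<zero>}" for x
    using Prin_prod[OF Inv_frac[OF assms] that] Inv_scale[OF assms that]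
    by (simp add: Inv_group_mult Inv_group_carrier)
  moreover have "ideal_class K A star I
      = (\<lambda>J. J \<otimes>\<^bsub>Inv_group K A star\<^esub> I) ` (\<lambda>x. A #> x) ` (carrier K - {\<zero>})"
    by (auto simp: ideal_class_def r_coset_def[of "Inv_group K A star"] Prin_def)
  ultimately show ?thesis by (auto simp: image_image)
qed

lemma ideal_class_eq_iff:
  assumes "I \<in> carrier (Inv_group K A star)" "J \<in> carrier (Inv_group K A star)"
  shows "ideal_class K A star I = ideal_class K A star J \<longleftrightarrow> (\<exists>x\<in>carrier K - {\<zero>}. I = J #> x)"
proof
  note Ic = frac_idealsE(2)[OF Inv_frac[OF assms(1)]]
  assume "ideal_class K A star I = ideal_class K A star J"
  moreover have "I = I #> \<one>" using Ic by (force simp: r_coset_def)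
  then have "I \<in> ideal_class K A star I" unfolding ideal_class_eq[OF assms(1)] using one_not_zero by blast
  ultimately show "\<exists>x\<in>carrier K - {\<zero>}. I = J #> x" by (auto simp: ideal_class_eq[OF assms(2)])
next
  note Jc = frac_idealsE(2)[OF Inv_frac[OF assms(2)]]
  assume "\<exists>x\<in>carrier K - {\<zero>}. I = J #> x"
  then obtain x where x: "x \<in> carrier K - {\<zero>}" "I = J #> x" by blast
  note ix = nonzero_inv[OF x(1)]
  have "I #> y = J #> (x \<otimes> y)" if "y \<in> carrier K" for y
    using scale_scale[OF Jc, of x y] x that by simp
  moreover have "J #> y = I #> (inv x \<otimes> y)" if "y \<in> carrier K" for y
    using scale_scale[OF Jc, of x "inv x \<otimes> y"] x ix that inv_cancel(1)[OF x(1) that] by simp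
  ultimately have "I #> y = J #> (x \<otimes> y)" "J #> y = I #> (inv x \<otimes> y)"
    "x \<otimes> y \<in> carrier K - {\<zero>}" "inv x \<otimes> y \<in> carrier K - {\<zero>}" if "y \<in> carrier K - {\<zero>}" for y
    using that nonzero_mult[OF x(1) that] nonzero_mult[OF ix(1) that] by auto
  note * = this
  show "ideal_class K A star I = ideal_class K A star J"
    unfolding ideal_class_eq[OF assms(1)] ideal_class_eq[OF assms(2)]
  proof (intro equalityI subsetI)
    fix L assume "L \<in> {I #> x |x. x \<in> carrier K - {\<zero>}}"
    then obtain y where "y \<in> carrier K - {\<zero>}" "L = I #> y" by blast
    with *[of y] show "L \<in> {J #> x |x. x \<in> carrier K - {\<zero>}}" by (metis (mono_tags, lifting) mem_Collect_eq)
  next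
    fix L assume "L \<in> {J #> x |x. x \<in> carrier K - {\<zero>}}"
    then obtain y where "y \<in> carrier K - {\<zero>}" "L = J #> y" by blast
    with *[of y] show "L \<in> {I #> x |x. x \<in> carrier K - {\<zero>}}" by (metis (mono_tags, lifting) mem_Collect_eq)
  qed
qed

lemma Cl_carrier: "carrier (Cl_group K A star) = ideal_class K A star ` carrier (Inv_group K A star)"
  by (auto simp: Cl_group_def FactGroup_def RCOSETS_def ideal_class_def)

lemma ideal_class_hom: "ideal_class K A star \<in> hom (Inv_group K A star) (Cl_group K A star)"
  using normal.r_coset_hom_Mod[OF Prin_normal] by (simp add: Cl_group_def ideal_class_def[abs_def])

lemma Cl_one: "\<one>\<^bsub>Cl_group K A star\<^esub> = ideal_class K A star A"
proof -
  have "\<one>\<^bsub>Cl_group K A star\<^esub> = Prin K A" by (simp add: Cl_group_def)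
  also have "\<dots> = ideal_class K A star A"
    unfolding ideal_class_eq[OF Inv_self] by (auto simp: Prin_def)
  finally show ?thesis .
qed

end

section \<open>The t-operation as a star operation\<close>

context qf_subring
begin

lemma t_op_subalgebra:
  assumes "E \<in> frac_ideals K A"
  shows "subalgebra A (t_op K A E) K"
  unfolding t_op_eq[OF assms]
proof (rule subalgebraI, goal_cases)
  case 1
  then show ?case using v_op_carrier[of K A] by blast
next
  case 2
  then show ?case using subalgebraE(3)[OF v_op_subalgebra[OF subr]] by blast
next
  case (3 x y)
  then obtain S S' where S: "finite S" "S \<subseteq> E" "x \<in> v_op K A S" "finite S'" "S' \<subseteq> E" "y \<in> v_op K A S'"
    by blast
  then have "x \<in> v_op K A (S \<union> S')" "y \<in> v_op K A (S \<union> S')" using v_op_mono[of _ "S \<union> S'" K A] by auto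
  then have "x \<oplus> y \<in> v_op K A (S \<union> S')" by (rule subalgebraE(4)[OF v_op_subalgebra[OF subr]])
  then show ?case using S by blast
next
  case (4 x)
  then show ?case using subalgebraE(5)[OF v_op_subalgebra[OF subr]] by blast
next
  case (5 a x)
  then show ?case using subalgebraE(6)[OF v_op_subalgebra[OF subr]] by blast
qed

lemma t_op_extensive:
  assumes "E \<in> frac_ideals K A"
  shows "E \<subseteq> t_op K A E"
proof
  fix x assume "x \<in> E"
  then show "x \<in> t_op K A E"
    using v_op_extensive[of "{x}" A] frac_idealsE(2)[OF assms] 
    by (auto simp: t_op_eq[OF assms] intro!: exI[of _ "{x}"])
qed

lemma t_op_mono: "E \<subseteq> F \<Longrightarrow> t_op K A E \<subseteq> t_op K A F"
  unfolding t_op_def finite_type_def by blast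

lemma t_op_subset_v_op:
  assumes "S \<subseteq> carrier K"
  shows "t_op K A S \<subseteq> v_op K A S"
  unfolding t_op_def finite_type_def using v_op_mono[of _ S K A] by blast

lemma t_op_frac:
  assumes "E \<in> frac_ideals K A"
  shows "t_op K A E \<in> frac_ideals K A"
proof -
  note E = frac_idealsE[OF assms]
  obtain e d where e: "e \<in> E" "e \<noteq> \<zero>" and d: "d \<in> carrier K - {\<zero>}" "\<forall>x\<in>E. d \<otimes> x \<in> A"
    using E by blast
  show ?thesis
  proof (rule frac_idealsI[OF t_op_subalgebra[OF assms] _ e(2) d(1)])
    show "e \<in> t_op K A E" using e t_op_extensive[OF assms] by blast
    show "d \<otimes> x \<in> A" if "x \<in> t_op K A E" for x
      using v_op_mult_mem[of E A d x A] t_op_subset_v_op[OF E(2)] that d E(2) A_carrier v_op_self[OF subr] by auto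
  qed
qed

lemma t_op_scale:
  assumes "E \<in> frac_ideals K A" "x \<in> carrier K - {\<zero>}"
  shows "t_op K A (E #> x) = t_op K A E #> x"
proof -
  have *: "t_op K A E #> x \<subseteq> t_op K A (E #> x)" if E: "E \<in> frac_ideals K A" and x: "x \<in> carrier K - {\<zero>}" for E x
  proof
    fix y assume "y \<in> t_op K A E #> x"
    then obtain z S where z: "y = z \<otimes> x" "finite S" "S \<subseteq> E" "z \<in> v_op K A S"
      by (auto simp: r_coset_mem t_op_eq[OF E])
    have "S \<subseteq> carrier K" using z(3) frac_idealsE(2)[OF E] by blast
    then have "y \<in> v_op K A (S #> x)" using scale_in_scale[OF z(4)] v_op_scale[OF _ x] z(1) by simp
    moreover have "finite (S #> x)" using z(2) by (simp add: r_coset_def)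
    ultimately show "y \<in> t_op K A (E #> x)"
      using scale_mono[OF z(3)] unfolding t_op_eq[OF frac_ideals_scale[OF E x]] by blast
  qed
  \<comment> \<open>The opposite inclusion comes from applying the one above to
    \<open>E #> x\<close> and \<open>inv x\<close>.\<close>
  note Ex = frac_ideals_scale[OF assms] and ix = nonzero_inv[OF assms(2)]
  have "t_op K A (E #> x) #> inv x \<subseteq> t_op K A E"
    using *[OF Ex ix(1)] scale_inv(1)[OF frac_idealsE(2)[OF assms(1)] assms(2)] by simp
  then have "(t_op K A (E #> x) #> inv x) #> x \<subseteq> t_op K A E #> x" by (rule scale_mono)
  then show ?thesis
    using *[OF assms] scale_inv(2)[OF frac_idealsE(2)[OF t_op_frac[OF Ex]] assms(2)] by simp
qed

text \<open>Each element of a finite subset of the closure is controlled by a finite part of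
  \<open>E\<close>. The union of these parts is finite and controls the whole subset, after which
  idempotence of the v-closure finishes.\<close>

lemma t_op_idem:
  assumes "E \<in> frac_ideals K A"
  shows "t_op K A (t_op K A E) = t_op K A E"
proof
  note tE = t_op_frac[OF assms]
  show "t_op K A E \<subseteq> t_op K A (t_op K A E)" using tE by (rule t_op_extensive)
  show "t_op K A (t_op K A E) \<subseteq> t_op K A E"
  proof
    fix y assume "y \<in> t_op K A (t_op K A E)"
    then obtain S where S: "finite S" "S \<subseteq> t_op K A E" "y \<in> v_op K A S" by (auto simp: t_op_eq[OF tE])
    have "\<forall>s\<in>S. \<exists>S'. finite S' \<and> S' \<subseteq> E \<and> s \<in> v_op K A S'" using S(2) t_op_eq[OF assms] by auto
    then obtain f where f: "\<forall>s\<in>S. finite (f s) \<and> f s \<subseteq> E \<and> s \<in> v_op K A (f s)" by (rule bchoice[THEN exE])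
    let ?U = "\<Union>(f ` S)"
    have U: "finite ?U" "?U \<subseteq> E" using f S(1) by auto
    have "S \<subseteq> v_op K A ?U" using f v_op_mono[of _ ?U K A] by blast
    then have "v_op K A S \<subseteq> v_op K A ?U" using U frac_idealsE(2)[OF assms] by (intro v_op_least) auto
    then show "y \<in> t_op K A E" unfolding t_op_eq[OF assms] using S(3) U by blast
  qed
qed

lemma t_op_star_operation: "star_operation K A (t_op K A)"
proof unfold_locales
  show "t_op K A A = A"
    using t_op_extensive[OF frac_ideals_self] t_op_subset_v_op[OF A_carrier] v_op_self[OF subr] by simp
qed (auto simp: t_op_frac t_op_idem t_op_scale subsetD[OF t_op_mono] subsetD[OF t_op_extensive])

sublocale t: star_operation K A "t_op K A" by (rule t_op_star_operation)

end

subsection \<open>The pullback\<close>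

text \<open>The residue field is an arbitrary field \<open>k\<close> with a surjection
  \<open>\<phi>\<close> whose kernel is \<open>M\<close>. This keeps cosets out of the argument, and
  elements of \<open>k\<close> may have a type of their own. \<open>lift_unit\<close> is
  surjectivity of U(T) onto the nonzero residues modulo U(D), expressed by elements.\<close>

locale pullback = field K + k: field k for K (structure) and k +
  fixes \<phi> and T M D R
  assumes T_subring: "subring T K" and T_qf: "is_quotient_field K T"
    and \<phi>_hom: "\<phi> \<in> ring_hom (K\<lparr>carrier := T\<rparr>) k" and \<phi>_surj: "\<phi> ` T = carrier k"
    and M_def: "M = {x \<in> T. \<phi> x = \<zero>\<^bsub>k\<^esub>}" and M_nontrivial: "M \<noteq> {\<zero>}"
    and D_subring: "subring D k" and D_proper: "D \<noteq> carrier k" and D_qf: "is_quotient_field k D"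
    and R_def: "R = {x \<in> T. \<phi> x \<in> D}"
    and lift_unit: "\<And>c. c \<in> carrier k - {\<zero>\<^bsub>k\<^esub>} \<Longrightarrow>
      \<exists>u \<in> T - {\<zero>}. inv u \<in> T \<and> (\<exists>d \<in> D - {\<zero>\<^bsub>k\<^esub>}. inv\<^bsub>k\<^esub> d \<in> D \<and> c = \<phi> u \<otimes>\<^bsub>k\<^esub> d)"
begin

sublocale T: qf_subring K T
  using T_subring T_qf by (intro qf_subring.intro qf_subring_axioms.intro field_axioms)

sublocale D: qf_subring k D
  using D_subring D_qf by (intro qf_subring.intro qf_subring_axioms.intro k.field_axioms)

lemmas T_closed = subringE[OF T_subring]
lemmas D_closed = subringE[OF D_subring]

lemma T_carrier: "x \<in> T \<Longrightarrow> x \<in> carrier K"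
  using T_closed(1) by blast

lemma \<phi>_closed: "x \<in> T \<Longrightarrow> \<phi> x \<in> carrier k"
  using \<phi>_surj by blast

lemma \<phi>_add: "x \<in> T \<Longrightarrow> y \<in> T \<Longrightarrow> \<phi> (x \<oplus> y) = \<phi> x \<oplus>\<^bsub>k\<^esub> \<phi> y"
  and \<phi>_mult: "x \<in> T \<Longrightarrow> y \<in> T \<Longrightarrow> \<phi> (x \<otimes> y) = \<phi> x \<otimes>\<^bsub>k\<^esub> \<phi> y"
  and \<phi>_one: "\<phi> \<one> = \<one>\<^bsub>k\<^esub>"
  using ring_hom_add[OF \<phi>_hom] ring_hom_mult[OF \<phi>_hom] ring_hom_one[OF \<phi>_hom] by auto

lemma \<phi>_zero: "\<phi> \<zero> = \<zero>\<^bsub>k\<^esub>"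
proof -
  have "\<phi> \<zero> \<oplus>\<^bsub>k\<^esub> \<phi> \<zero> = \<phi> \<zero>"
    using \<phi>_add[of \<zero> \<zero>] T_closed(2) by simp
  then show ?thesis using \<phi>_closed[OF T_closed(2)] by (metis k.add.l_cancel_one')
qed

lemma \<phi>_minus:
  assumes "x \<in> T"
  shows "\<phi> (\<ominus> x) = \<ominus>\<^bsub>k\<^esub> \<phi> x"
proof -
  have "\<phi> x \<oplus>\<^bsub>k\<^esub> \<phi> (\<ominus> x) = \<zero>\<^bsub>k\<^esub>"
    using \<phi>_add[of x "\<ominus> x"] assms T_closed(5)[OF assms] T_carrier[OF assms] \<phi>_zero by (simp add: r_neg)
  then show ?thesis
    using \<phi>_closed[OF assms] \<phi>_closed[OF T_closed(5)[OF assms]] by (metis k.minus_equality k.add.m_comm)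
qed

lemma M_subalgebra: "subalgebra T M K"
  by (rule subalgebraI)
    (auto simp: M_def \<phi>_zero \<phi>_add \<phi>_minus \<phi>_mult \<phi>_closed T_carrier T_closed)

lemma M_subset_T: "M \<subseteq> T" and M_subset_R: "M \<subseteq> R" and R_subset_T: "R \<subseteq> T"
  using D_closed(2) by (auto simp: M_def R_def)

lemma M_mult_T: "m \<in> M \<Longrightarrow> t \<in> T \<Longrightarrow> m \<otimes> t \<in> M"
  using subalgebraE(2,6)[OF M_subalgebra] T_carrier by (metis m_comm)

lemma \<phi>_image_R: "\<phi> ` R = D"
  using \<phi>_surj D_closed(1) unfolding R_def by (auto; blast)

lemma R_subring: "subring R K"
  by (rule subringI)
    (auto simp: R_def \<phi>_one \<phi>_add \<phi>_minus \<phi>_mult T_carrier T_closed D_closed)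

lemma obtain_M:
  obtains m where "m \<in> M" "m \<noteq> \<zero>" "m \<in> carrier K - {\<zero>}"
  using M_nontrivial subalgebraE(2,3)[OF M_subalgebra] by blast

lemma R_qf: "is_quotient_field K R"
  unfolding is_quotient_field_def
proof
  fix x assume "x \<in> carrier K"
  then obtain a b where ab: "a \<in> T" "b \<in> T - {\<zero>}" "x = a \<otimes> inv b"
    using T_qf unfolding is_quotient_field_def by blast
  \<comment> \<open>Multiplying numerator and denominator by a nonzero element of \<open>M\<close>
    moves both from \<open>T\<close> into \<open>M\<close>, hence into \<open>R\<close>.\<close>
  obtain m where m: "m \<in> M" "m \<in> carrier K - {\<zero>}" using obtain_M by blast
  have c: "a \<in> carrier K" "b \<in> carrier K - {\<zero>}" using ab T_carrier by auto
  have bm: "m \<otimes> b \<in> carrier K - {\<zero>}" using nonzero_mult[OF m(2) c(2)] .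
  have xc: "x \<in> carrier K" by fact
  have "a = x \<otimes> b" using ab(3) inv_cancel(4)[OF c(2,1)] by simp
  then have "m \<otimes> a = x \<otimes> (m \<otimes> b)" using c m xc by (simp add: m_lcomm)
  then have "x = (m \<otimes> a) \<otimes> inv (m \<otimes> b)" using inv_cancel(3)[OF bm xc] by simp
  moreover have "m \<otimes> a \<in> R" "m \<otimes> b \<in> R - {\<zero>}"
    using M_mult_T[OF m(1)] ab M_subset_R bm by auto
  ultimately show "\<exists>a\<in>R. \<exists>b\<in>R - {\<zero>}. x = a \<otimes> inv b" by blast
qed

sublocale R: qf_subring K R
  using R_subring R_qf by (intro qf_subring.intro qf_subring_axioms.intro field_axioms)

text \<open>The residue of \<open>f\<close> is invertible in the field \<open>k\<close>; a lift
  \<open>t\<close> of its inverse makes \<open>f \<otimes> t\<close> congruent to one modulo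
  \<open>M\<close>.\<close>

lemma comaximal:
  assumes "f \<in> T" "f \<notin> M"
  obtains t m where "t \<in> T" "m \<in> M" "\<one> = f \<otimes> t \<oplus> m"
proof -
  have "\<phi> f \<in> carrier k - {\<zero>\<^bsub>k\<^esub>}" using assms \<phi>_closed by (auto simp: M_def)
  note i = k.nonzero_inv[OF this]
  obtain t where t: "t \<in> T" "\<phi> t = inv\<^bsub>k\<^esub> \<phi> f" using i(1) \<phi>_surj by (metis DiffD1 imageE)
  have ft: "f \<otimes> t \<in> T" "f \<otimes> t \<in> carrier K" using assms t T_closed T_carrier by auto
  have "\<phi> (\<ominus> (f \<otimes> t) \<oplus> \<one>) = \<zero>\<^bsub>k\<^esub>"
    using assms t ft i(2) T_closed by (simp add: \<phi>_add \<phi>_minus \<phi>_mult \<phi>_one k.l_neg)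
  then have "\<ominus> (f \<otimes> t) \<oplus> \<one> \<in> M" using ft T_closed by (simp add: M_def)
  moreover have "\<one> = f \<otimes> t \<oplus> (\<ominus> (f \<otimes> t) \<oplus> \<one>)" using ft by (simp add: r_neg2)
  ultimately show thesis using that t(1) by blast
qed

lemma comaximal_one:
  assumes "i \<in> T" "\<phi> i = \<one>\<^bsub>k\<^esub>"
  obtains m where "m \<in> M" "\<one> = i \<oplus> m"
proof -
  have "\<phi> (\<ominus> i \<oplus> \<one>) = \<zero>\<^bsub>k\<^esub>"
    using assms T_closed by (simp add: \<phi>_add \<phi>_minus \<phi>_one k.l_neg)
  then have "\<ominus> i \<oplus> \<one> \<in> M" using assms(1) T_closed by (simp add: M_def)
  moreover have "\<one> = i \<oplus> (\<ominus> i \<oplus> \<one>)" using T_carrier[OF assms(1)] by (simp add: r_neg2)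
  ultimately show thesis using that by blast
qed

text \<open>With \<open>1 = f t + m\<close>, the element \<open>y\<close> is the sum of
  \<open>t (f y)\<close> and \<open>m y\<close>. In the applications, multiplication by
  \<open>M\<close> bridges the gap between \<open>R\<close> and \<open>T\<close>, and a single
  \<open>f\<close> outside \<open>M\<close> removes this factor again.\<close>

lemma mem_by_comaximality:
  assumes "subalgebra T Y K" "y \<in> carrier K" "f \<in> T" "f \<notin> M" "f \<otimes> y \<in> Y" "\<And>m. m \<in> M \<Longrightarrow> m \<otimes> y \<in> Y"
  shows "y \<in> Y"
proof -
  obtain t m where t: "t \<in> T" "m \<in> M" "\<one> = f \<otimes> t \<oplus> m" using comaximal[OF assms(3,4)] .
  have c: "t \<in> carrier K" "m \<in> carrier K" "f \<in> carrier K" using t assms(3) M_subset_T T_carrier by auto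
  have "y = \<one> \<otimes> y" using assms(2) by simp
  also have "\<dots> = t \<otimes> (f \<otimes> y) \<oplus> m \<otimes> y"
    unfolding t(3) using c assms(2) l_distr[of "f \<otimes> t" m y] by (simp add: m_ac)
  also have "\<dots> \<in> Y" using subalgebraE(4,6)[OF assms(1)] t assms(5,6) by blast
  finally show ?thesis .
qed

subsection \<open>Extension of fractional ideals\<close>

lemma frac_ideals_T_R:
  assumes "E \<in> frac_ideals K T"
  shows "E \<in> frac_ideals K R"
proof -
  note E = T.frac_idealsE[OF assms]
  obtain e d where e: "e \<in> E" "e \<noteq> \<zero>" and d: "d \<in> carrier K - {\<zero>}" "\<forall>x\<in>E. d \<otimes> x \<in> T"
    using E by blast
  \<comment> \<open>\<open>M\<close> multiplies \<open>T\<close> into \<open>R\<close>, so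
    \<open>m\<close> turns a denominator over \<open>T\<close> into one over
    \<open>R\<close>.\<close>
  obtain m where m: "m \<in> M" "m \<in> carrier K - {\<zero>}" using obtain_M by blast
  show ?thesis
  proof (rule R.frac_idealsI[OF subalgebra_subset[OF E(1) R_subset_T] e])
    show "m \<otimes> d \<in> carrier K - {\<zero>}" using m(2) d(1) by (rule nonzero_mult)
    show "m \<otimes> d \<otimes> x \<in> R" if "x \<in> E" for x
      using M_mult_T[OF m(1), of "d \<otimes> x"] d that m(2) subsetD[OF E(2) that] M_subset_R m_assoc[of m d x] by auto
  qed
qed

lemma extension_frac:
  assumes "E \<in> frac_ideals K R"
  shows "E \<cdot> T \<in> frac_ideals K T"
proof -
  note E = R.frac_idealsE[OF assms]
  obtain e d where e: "e \<in> E" "e \<noteq> \<zero>" and d: "d \<in> carrier K - {\<zero>}" "\<forall>x\<in>E. d \<otimes> x \<in> R"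
    using E by blast
  show ?thesis
  proof (rule T.frac_idealsI[OF _ _ e(2) d(1)])
    show "subalgebra T (E \<cdot> T) K"
      using subring_subalgebra[OF T_subring] E T_closed(1) by (intro ideal_prod_subalgebra) auto
    show "e \<in> E \<cdot> T" using ideal_prod.prod[OF e(1) T_closed(3), of K] e(1) E(2) by (simp add: subsetD)
    show "d \<otimes> x \<in> T" if "x \<in> E \<cdot> T" for x
      by (rule ideal_prod_colon_subset[OF _ E(2) T_closed(1) _ _ that])
        (use d R_subset_T T_closed in auto)
  qed
qed

lemma extension_subalgebra: "E \<subseteq> carrier K \<Longrightarrow> E \<noteq> {} \<Longrightarrow> subalgebra T (E \<cdot> T) K"
  using subring_subalgebra[OF T_subring] T_closed(1) by (intro ideal_prod_subalgebra) auto

lemma extension_superset: "E \<subseteq> carrier K \<Longrightarrow> E \<subseteq> E \<cdot> T"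
proof
  fix e assume "E \<subseteq> carrier K" "e \<in> E"
  then show "e \<in> E \<cdot> T" using ideal_prod.prod[OF _ T_closed(3), of e E K] by (simp add: subsetD)
qed

lemma extension_least:
  assumes "subalgebra T Y K" "E \<subseteq> Y"
  shows "E \<cdot> T \<subseteq> Y"
proof (rule ideal_prod_least)
  note Y = subalgebraE[OF assms(1)]
  show "e \<otimes> t \<in> Y" if "e \<in> E" "t \<in> T" for e t
    using Y(6)[OF that(2), of e] that assms(2) Y(2) T_carrier by (metis m_comm subsetD)
qed (rule subalgebraE(4)[OF assms(1)])

lemma extension_prod:
  assumes "E \<subseteq> carrier K" "F \<subseteq> carrier K"
  shows "E \<cdot> T \<cdot> (F \<cdot> T) = E \<cdot> F \<cdot> T"
proof -
  have "T \<cdot> T = T" using ideal_prod_subring[OF subring_subalgebra[OF T_subring] T_subring] .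
  then show ?thesis
    using assms T_closed(1) by (metis ideal_prod_assoc ideal_prod_carrier ideal_prod_comm)
qed

text \<open>A coefficient \<open>t\<close> from \<open>T\<close> is absorbed by \<open>m\<close>,
  because \<open>m \<otimes> t\<close> stays in \<open>M\<close> and so lies in
  \<open>R\<close>.\<close>

lemma M_mult_extension:
  assumes "subalgebra R E K" "m \<in> M" "y \<in> E \<cdot> T"
  shows "m \<otimes> y \<in> E"
proof (rule ideal_prod_colon_subset[OF _ _ T_closed(1) _ _ assms(3)])
  note E = subalgebraE[OF assms(1)]
  show "E \<subseteq> carrier K" "\<And>x y. x \<in> E \<Longrightarrow> y \<in> E \<Longrightarrow> x \<oplus> y \<in> E" using E by auto
  show m: "m \<in> carrier K" using assms(2) M_subset_T T_carrier by blast
  show "m \<otimes> e \<otimes> t \<in> E" if "e \<in> E" "t \<in> T" for e t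
  proof -
    have "m \<otimes> e \<otimes> t = m \<otimes> t \<otimes> e" using m E(2)[OF that(1)] T_carrier[OF that(2)] by (simp add: m_ac)
    then show ?thesis using E(6)[OF _ that(1)] M_mult_T[OF assms(2) that(2)] M_subset_R by auto
  qed
qed

text \<open>Since \<open>T\<close> multiplies \<open>M\<close> into \<open>R\<close>, every
  \<open>x\<close> in the closure multiplies \<open>T\<close> into \<open>R\<close>. If such an
  \<open>x\<close> were outside \<open>M\<close>, then \<open>1 = x t + m\<close> would place all of
  \<open>T\<close> inside \<open>R\<close>, contradicting that \<open>D\<close> is a proper
  subring.\<close>

lemma v_op_M: "v_op K R M = M"
proof
  have Mc: "M \<subseteq> carrier K" using M_subset_T T_carrier by blast
  show "M \<subseteq> v_op K R M" using Mc by (rule v_op_extensive)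
  show "v_op K R M \<subseteq> M"
  proof
    fix x assume x: "x \<in> v_op K R M"
    have xT: "x \<otimes> t \<in> R" if "t \<in> T" for t
    proof -
      have "t \<in> colon K R M"
        using that M_mult_T M_subset_R T_carrier Mc by (intro colonI) (auto simp: m_comm subsetD)
      then show ?thesis using x unfolding v_op_def by (auto dest: colonD)
    qed
    have xc: "x \<in> carrier K" using x v_op_carrier[of K R M] by blast
    then have xin: "x \<in> T" using xT[OF T_closed(3)] R_subset_T by auto
    show "x \<in> M"
    proof (rule ccontr)
      assume "x \<notin> M"
      then obtain t m where t: "t \<in> T" "m \<in> M" "\<one> = x \<otimes> t \<oplus> m" using comaximal[OF xin] by blast
      have "T \<subseteq> R"
      proof
        fix y assume y: "y \<in> T"
        have "y = \<one> \<otimes> y" using T_carrier[OF y] by simp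
        also have "\<dots> = x \<otimes> (t \<otimes> y) \<oplus> m \<otimes> y"
          unfolding t(3) using xc t y Mc T_carrier by (simp add: l_distr m_assoc subsetD)
        also have "\<dots> \<in> R"
          using subringE(7)[OF R_subring xT[OF T_closed(6)[OF t(1) y]]] M_mult_T[OF t(2) y] M_subset_R by blast
        finally show "y \<in> R" .
      qed
      then have "carrier k \<subseteq> D" using \<phi>_surj \<phi>_image_R by blast
      then show False using D_closed(1) D_proper by blast
    qed
  qed
qed

lemma t_op_M:
  assumes "E \<subseteq> M" "x \<in> t_op K R E"
  shows "x \<in> M"
proof -
  have "M \<subseteq> carrier K" using M_subset_T T_carrier by blast
  then show ?thesis using R.t_op_mono[OF assms(1)] R.t_op_subset_v_op v_op_M assms(2) by blast
qed

text \<open>A product inside \<open>M\<close> would have its t-closure inside \<open>M\<close>,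
  which does not contain one; as \<open>M\<close> is closed under addition, a single product of
  elements already leaves \<open>M\<close>. This provides the test elements for
  \<open>mem_by_comaximality\<close>, the scalar in \<open>exists_comax\<close> and the denominators
  in \<open>extension_T_residual\<close>.\<close>

lemma M_summands:
  assumes "E \<subseteq> carrier K" "F \<subseteq> carrier K" "\<one> \<in> t_op K R (E \<cdot> F)"
  obtains e f where "e \<in> E" "f \<in> F" "e \<otimes> f \<notin> M"
proof -
  have "\<not> E \<cdot> F \<subseteq> M"
  proof
    assume "E \<cdot> F \<subseteq> M"
    then have "\<one> \<in> M" using t_op_M assms(3) by blast
    then show False using k.one_not_zero by (simp add: M_def \<phi>_one)
  qed
  then show thesis using that ideal_prod_least[of E F K M] subalgebraE(4)[OF M_subalgebra] by blast
qed

text \<open>Multiplication by an element of \<open>T\<close> maps \<open>E\<close> to itself, hence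
  also its closure over \<open>R\<close>.\<close>

lemma t_op_T_subalgebra:
  assumes "E \<in> frac_ideals K T"
  shows "subalgebra T (t_op K R E) K"
proof (rule subalgebraI)
  note E = frac_ideals_T_R[OF assms]
  note tE = subalgebraE[OF R.t_op_subalgebra[OF E]]
  show "t_op K R E \<subseteq> carrier K" "\<zero> \<in> t_op K R E" "\<And>x y. x \<in> t_op K R E \<Longrightarrow> y \<in> t_op K R E \<Longrightarrow> x \<oplus> y \<in> t_op K R E"
     "\<And>x. x \<in> t_op K R E \<Longrightarrow> \<ominus> x \<in> t_op K R E" using tE by auto
  show "t \<otimes> x \<in> t_op K R E" if "t \<in> T" "x \<in> t_op K R E" for t x
    using subalgebraE(6)[OF T.frac_idealsE(1)[OF assms] that(1)] that T_carrier
    by (intro R.t.star_mult_mem[OF E E]) auto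
qed

text \<open>The factor \<open>v_op K T E\<close> supplies the common denominator over
  \<open>T\<close> and, as \<open>v_op K T T = T\<close>, forces \<open>T\<close> to be closed. The
  remaining axioms pass to the intersection from the two closures.\<close>

sublocale e: star_operation K T "star_ext K T (t_op K R)"
proof unfold_locales
  fix E assume E: "E \<in> frac_ideals K T"
  note Ef = T.frac_idealsE[OF E] and ER = frac_ideals_T_R[OF E]
  show ext: "E \<subseteq> star_ext K T (t_op K R) E"
    using R.t_op_extensive[OF ER] v_op_extensive[OF Ef(2)] by (auto simp: star_ext_def)
  obtain e d where e: "e \<in> E" "e \<noteq> \<zero>" "d \<in> carrier K - {\<zero>}" "\<forall>x\<in>v_op K T E. d \<otimes> x \<in> T"
    using Ef T.frac_idealsE(4)[OF T.frac_ideals_v_op[OF E]] by blast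
  show fr: "star_ext K T (t_op K R) E \<in> frac_ideals K T"
    unfolding star_ext_def
    by (rule T.frac_idealsI[of _ e d])
      (use e t_op_T_subalgebra[OF E] v_op_subalgebra[OF T_subring] ext in \<open>auto intro: subalgebra_Int simp: star_ext_def\<close>)
  show "star_ext K T (t_op K R) (E #> x) = star_ext K T (t_op K R) E #> x"
    if x: "x \<in> carrier K - {\<zero>}" for x
  proof -
    have "(Y #> x) \<inter> (Z #> x) = (Y \<inter> Z) #> x" if "Y \<subseteq> carrier K" "Z \<subseteq> carrier K" for Y Z
    proof -
      have "Y #> x \<subseteq> carrier K" "(Y \<inter> Z) #> x \<subseteq> carrier K"
        using scale_carrier[of Y x] scale_carrier[of "Y \<inter> Z" x] that x by blast+
      moreover have "y \<in> (Y #> x) \<inter> (Z #> x) \<longleftrightarrow> y \<in> (Y \<inter> Z) #> x" if "y \<in> carrier K" for y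
        using scale_mem_iff[OF _ x that] \<open>Y \<subseteq> _\<close> \<open>Z \<subseteq> _\<close> by (metis Int_iff inf.coboundedI1)
      ultimately show ?thesis by blast
    qed
    then show ?thesis
      using R.t_op_scale[OF ER x] v_op_scale[OF Ef(2) x] v_op_carrier[of K T E]
        R.frac_idealsE(2)[OF R.t_op_frac[OF ER]] by (simp add: star_ext_def)
  qed
  show mono: "star_ext K T (t_op K R) E \<subseteq> star_ext K T (t_op K R) F" if "E \<subseteq> F" for F
    using R.t_op_mono[OF that] v_op_mono[OF that, of K T] by (auto simp: star_ext_def)
  show "star_ext K T (t_op K R) (star_ext K T (t_op K R) E) = star_ext K T (t_op K R) E"
  proof
    have "star_ext K T (t_op K R) E \<subseteq> t_op K R E" "star_ext K T (t_op K R) E \<subseteq> v_op K T E"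
      by (auto simp: star_ext_def)
    then have "t_op K R (star_ext K T (t_op K R) E) \<subseteq> t_op K R E"
      "v_op K T (star_ext K T (t_op K R) E) \<subseteq> v_op K T E"
      using R.t_op_mono[of "star_ext K T (t_op K R) E" "t_op K R E"] R.t_op_idem[OF ER]
       v_op_least[OF _ Ef(2)] by auto
    then show "star_ext K T (t_op K R) (star_ext K T (t_op K R) E) \<subseteq> star_ext K T (t_op K R) E"
      by (auto simp: star_ext_def)
    show "star_ext K T (t_op K R) E \<subseteq> star_ext K T (t_op K R) (star_ext K T (t_op K R) E)"
      using R.t_op_extensive[OF frac_ideals_T_R[OF fr]] v_op_extensive[OF T.frac_idealsE(2)[OF fr]]
      by (auto simp: star_ext_def)
  qed
next
  show "star_ext K T (t_op K R) T = T"
    using R.t_op_extensive[OF frac_ideals_T_R[OF T.frac_ideals_self]] v_op_self[OF T_subring]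
    by (auto simp: star_ext_def)
qed

subsection \<open>Preimages of fractional ideals\<close>

definition pre where "pre J = {x \<in> T. \<phi> x \<in> J}"

lemma \<phi>_image_pre: "J \<subseteq> carrier k \<Longrightarrow> \<phi> ` pre J = J"
  using \<phi>_surj by (auto simp: pre_def)

lemma pre_D: "pre D = R"
  by (simp add: pre_def R_def)

text \<open>If \<open>x\<close> multiplies \<open>S\<close> into \<open>R\<close>, it multiplies
  \<open>S \<cdot> T\<close> into \<open>T\<close>; as this product contains one, \<open>x\<close>
  itself lies in \<open>T\<close>. From then on everything is decided by residues.\<close>

lemma colon_pre:
  assumes "S \<subseteq> T" "\<one> \<in> S \<cdot> T"
  shows "colon K R S = pre (colon k D (\<phi> ` S))"
proof (intro equalityI subsetI)
  fix x assume x: "x \<in> colon K R S"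
  have Sc: "S \<subseteq> carrier K" using assms(1) T_carrier by blast
  have "x \<otimes> \<one> \<in> T"
  proof (rule ideal_prod_colon_subset[OF _ Sc T_closed(1) _ _ assms(2)])
    show "x \<otimes> s \<otimes> t \<in> T" if "s \<in> S" "t \<in> T" for s t
      using colonD[OF x that(1)] that(2) R_subset_T T_closed(6) by blast
  qed (use colon_carrier[OF x] T_closed in auto)
  then have xT: "x \<in> T" using colon_carrier[OF x] by simp
  have "\<phi> x \<otimes>\<^bsub>k\<^esub> \<phi> s \<in> D" if "s \<in> S" for s
    using colonD[OF x that] \<phi>_mult[OF xT, of s] assms(1) that by (auto simp: R_def)
  then show "x \<in> pre (colon k D (\<phi> ` S))" using xT \<phi>_closed by (auto simp: pre_def intro!: colonI)
next
  fix x assume x: "x \<in> pre (colon k D (\<phi> ` S))"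
  show "x \<in> colon K R S"
  proof (rule colonI)
    show "x \<in> carrier K" using x T_carrier by (simp add: pre_def)
    show "x \<otimes> s \<in> R" if "s \<in> S" for s
      using x that assms(1) \<phi>_mult[of x s] T_closed(6)[of x s] colonD[of "\<phi> x" k D "\<phi> ` S" "\<phi> s"]
      by (auto simp: pre_def R_def)
  qed
qed

text \<open>A lift \<open>u\<close> of the nonzero residue \<open>c\<close> is comaximal to
  \<open>M\<close>, and \<open>M\<close> is contained in \<open>pre J\<close> because
  \<open>J\<close> contains zero.\<close>

lemma pre_extension_one:
  assumes "\<zero>\<^bsub>k\<^esub> \<in> J" "c \<in> J" "c \<in> carrier k - {\<zero>\<^bsub>k\<^esub>}"
  shows "\<one> \<in> pre J \<cdot> T"
proof -
  obtain u where u: "u \<in> T" "\<phi> u = c" using assms(3) \<phi>_surj by (metis DiffD1 imageE)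
  then have "u \<notin> M" using assms(3) by (simp add: M_def)
  then obtain t m where t: "t \<in> T" "m \<in> M" "\<one> = u \<otimes> t \<oplus> m" using comaximal[OF u(1)] by blast
  have "u \<in> pre J" "m \<in> pre J" using u t assms(1,2) by (auto simp: pre_def M_def)
  then have "u \<otimes> t \<in> pre J \<cdot> T" "m \<otimes> \<one> \<in> pre J \<cdot> T" using t(1) T_closed(3) by (auto intro: ideal_prod.prod)
  moreover have "m \<otimes> \<one> = m" using t(2) M_subset_T T_carrier by auto
  ultimately show ?thesis using t(3) ideal_prod.sum[of "u \<otimes> t" K "pre J" T m] by simp
qed

text \<open>Two applications of \<open>colon_pre\<close>. The second concerns the preimage of the
  colon in \<open>k\<close>, which generates \<open>T\<close> only when that colon is nonzero; hence
  the witness \<open>c\<close>.\<close>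

lemma v_op_pre:
  assumes "S \<subseteq> T" "\<one> \<in> S \<cdot> T" "c \<in> colon k D (\<phi> ` S)" "c \<noteq> \<zero>\<^bsub>k\<^esub>"
  shows "v_op K R S = pre (v_op k D (\<phi> ` S))"
proof -
  let ?C = "colon k D (\<phi> ` S)"
  have Sk: "\<phi> ` S \<subseteq> carrier k" using assms(1) \<phi>_closed by blast
  have C: "subalgebra D ?C k"
    using k.subring_subalgebra[OF D_subring] Sk D_closed(1) by (rule k.colon_subalgebra)
  have "v_op K R S = colon K R (pre ?C)" by (simp add: v_op_def colon_pre[OF assms(1,2)])
  also have "\<dots> = pre (colon k D (\<phi> ` pre ?C))"
    using pre_extension_one[OF subalgebraE(3)[OF C] assms(3)] assms(4) colon_carrier[OF assms(3)]
    by (intro colon_pre) (auto simp: pre_def)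
  also have "\<phi> ` pre ?C = ?C" using subalgebraE(1)[OF C] by (rule \<phi>_image_pre)
  finally show ?thesis by (simp add: v_op_def)
qed

text \<open>Up to t-closure, these are the preimages of the fractional ideals of D.\<close>

definition residual where
  "residual E \<longleftrightarrow> E \<in> frac_ideals K R \<and> E \<cdot> T = T \<and> \<phi> ` E \<in> frac_ideals k D"

lemma residualD:
  assumes "residual E"
  shows "E \<in> frac_ideals K R" "E \<cdot> T = T" "\<phi> ` E \<in> frac_ideals k D" "E \<subseteq> T" "\<one> \<in> E \<cdot> T"
proof -
  show E: "E \<in> frac_ideals K R" "E \<cdot> T = T" "\<phi> ` E \<in> frac_ideals k D" using assms by (auto simp: residual_def)
  show "E \<subseteq> T" using extension_superset[OF R.frac_idealsE(2)[OF E(1)]] E(2) by simp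
  show "\<one> \<in> E \<cdot> T" using E(2) T_closed(3) by simp
qed

lemma extension_eq_T:
  assumes "E \<subseteq> T" "\<one> \<in> E \<cdot> T"
  shows "E \<cdot> T = T"
proof
  have Tm: "subalgebra T T K" using T_subring by (rule subring_subalgebra)
  show "E \<cdot> T \<subseteq> T" using Tm assms(1) by (rule extension_least)
  have ne: "E \<noteq> {}" using assms(2) ideal_prod_least[of E T K "{}"] by blast
  have Ec: "E \<subseteq> carrier K" using assms(1) T_carrier by blast
  show "T \<subseteq> E \<cdot> T"
    using subalgebraE(6)[OF extension_subalgebra[OF Ec ne] _ assms(2)] T_carrier by force
qed

lemma colon_residual: "residual E \<Longrightarrow> colon K R E = pre (colon k D (\<phi> ` E))"
  using residualD by (intro colon_pre)

lemma residual_colon_nonzero: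
  assumes "residual E"
  obtains c where "c \<in> colon k D (\<phi> ` E)" "c \<noteq> \<zero>\<^bsub>k\<^esub>"
  using D.frac_idealsE(3)[OF D.frac_ideals_colon[OF residualD(3)[OF assms]]] by blast

lemma t_op_residual:
  assumes "residual E"
  shows "t_op K R E = pre (t_op k D (\<phi> ` E))"
proof -
  note E = residualD[OF assms]
  obtain c where c: "c \<in> colon k D (\<phi> ` E)" "c \<noteq> \<zero>\<^bsub>k\<^esub>" using residual_colon_nonzero[OF assms] .
  \<comment> \<open>\<open>S0\<close> is a finite part of \<open>E\<close> that generates
    \<open>T\<close>. Adjoining it to a finite subset of \<open>E\<close> keeps the subset finite
    and makes \<open>v_op_pre\<close> applicable.\<close>
  obtain S0 where S0: "finite S0" "S0 \<subseteq> E" "\<one> \<in> S0 \<cdot> T" using ideal_prod_finite_support[OF E(5)] .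
  have v: "v_op K R (S \<union> S0) = pre (v_op k D (\<phi> ` (S \<union> S0)))" if "S \<subseteq> E" for S
  proof (rule v_op_pre)
    show "S \<union> S0 \<subseteq> T" using that S0(2) E(4) by blast
    show "\<one> \<in> (S \<union> S0) \<cdot> T" using S0(3) ideal_prod_mono[of S0 "S \<union> S0" T T K] by blast
    \<comment> \<open>One \<open>c\<close> serves all \<open>S\<close>, since the colon only grows
      when \<open>E\<close> is replaced by a subset.\<close>
    show "c \<in> colon k D (\<phi> ` (S \<union> S0))"
      using c(1) colon_antimono[of "\<phi> ` (S \<union> S0)" "\<phi> ` E" k D] that S0(2) by blast
  qed (rule c(2))
  show ?thesis
  proof (intro equalityI subsetI)
    fix x assume "x \<in> t_op K R E"
    then obtain S where S: "finite S" "S \<subseteq> E" "x \<in> v_op K R S" by (auto simp: R.t_op_eq[OF E(1)])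
    then have "x \<in> v_op K R (S \<union> S0)" using v_op_mono[of S "S \<union> S0" K R] by blast
    then have "x \<in> T" "\<phi> x \<in> v_op k D (\<phi> ` (S \<union> S0))" using v[OF S(2)] by (auto simp: pre_def)
    then show "x \<in> pre (t_op k D (\<phi> ` E))"
      using S S0 by (auto simp: pre_def D.t_op_eq[OF E(3)] intro!: exI[of _ "\<phi> ` (S \<union> S0)"])
  next
    fix x assume "x \<in> pre (t_op k D (\<phi> ` E))"
    then obtain G where G: "x \<in> T" "finite G" "G \<subseteq> \<phi> ` E" "\<phi> x \<in> v_op k D G"
      by (auto simp: pre_def D.t_op_eq[OF E(3)])
    then obtain S where S: "S \<subseteq> E" "finite S" "G = \<phi> ` S" using finite_subset_image by metis
    have "\<phi> x \<in> v_op k D (\<phi> ` (S \<union> S0))"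
      using G(4) S(3) v_op_mono[of G "\<phi> ` (S \<union> S0)" k D] by blast
    then have "x \<in> v_op K R (S \<union> S0)" using v[OF S(1)] G(1) by (simp add: pre_def)
    then show "x \<in> t_op K R E" unfolding R.t_op_eq[OF E(1)] using S S0 by blast
  qed
qed

lemma image_subalgebra:
  assumes "subalgebra R E K" "E \<subseteq> T"
  shows "subalgebra D (\<phi> ` E) k"
proof (rule k.subalgebraI)
  note E = subalgebraE[OF assms(1)]
  show "\<phi> ` E \<subseteq> carrier k" using assms(2) \<phi>_closed by blast
  show "\<zero>\<^bsub>k\<^esub> \<in> \<phi> ` E" using E(3) \<phi>_zero by force
  show "\<And>x y. x \<in> \<phi> ` E \<Longrightarrow> y \<in> \<phi> ` E \<Longrightarrow> x \<oplus>\<^bsub>k\<^esub> y \<in> \<phi> ` E"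
    using E(4) assms(2) \<phi>_add by (force simp: subset_iff)
  show "\<And>x. x \<in> \<phi> ` E \<Longrightarrow> \<ominus>\<^bsub>k\<^esub> x \<in> \<phi> ` E"
    using E(5) assms(2) \<phi>_minus by (force simp: subset_iff)
  fix a x assume "a \<in> D" "x \<in> \<phi> ` E"
  then obtain r e where "r \<in> R" "a = \<phi> r" "e \<in> E" "x = \<phi> e" using \<phi>_image_R by blast
  then show "a \<otimes>\<^bsub>k\<^esub> x \<in> \<phi> ` E"
    using E(6)[of r e] assms(2) R_subset_T \<phi>_mult[of r e] by force
qed

lemma residual_pre:
  assumes "J \<in> frac_ideals k D"
  shows "residual (pre J)"
proof -
  note J = D.frac_idealsE[OF assms] and J' = subalgebraE[OF D.frac_idealsE(1)[OF assms]]
  obtain c d where c: "c \<in> J" "c \<noteq> \<zero>\<^bsub>k\<^esub>" and d: "d \<in> carrier k - {\<zero>\<^bsub>k\<^esub>}" "\<forall>x\<in>J. d \<otimes>\<^bsub>k\<^esub> x \<in> D"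
    using J by blast
  have ck: "c \<in> carrier k - {\<zero>\<^bsub>k\<^esub>}" using c J by auto
  \<comment> \<open>Lifts of a nonzero element and of a denominator of \<open>J\<close> play the
    same roles for the preimage.\<close>
  obtain u e where u: "u \<in> T" "\<phi> u = c" and e: "e \<in> T" "\<phi> e = d"
    using ck d(1) \<phi>_surj by (metis DiffD1 imageE)
  have one: "\<one> \<in> pre J \<cdot> T" using J'(3) c(1) ck by (rule pre_extension_one)
  have preT: "pre J \<subseteq> T" by (auto simp: pre_def)
  have "pre J \<in> frac_ideals K R"
  proof (rule R.frac_idealsI)
    show "subalgebra R (pre J) K"
      by (rule subalgebraI)
        (use J' in \<open>auto simp: pre_def R_def \<phi>_zero \<phi>_add \<phi>_minus \<phi>_mult T_carrier T_closed\<close>)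
    show "u \<in> pre J" using u c(1) by (simp add: pre_def)
    show "u \<noteq> \<zero>" using u c(2) \<phi>_zero by auto
    show "e \<in> carrier K - {\<zero>}" using e d(1) \<phi>_zero T_carrier by auto
    show "e \<otimes> x \<in> R" if "x \<in> pre J" for x
      using that e d(2) by (auto simp: pre_def R_def \<phi>_mult T_closed)
  qed
  then show ?thesis
    using extension_eq_T[OF preT one] \<phi>_image_pre[OF J(2)] assms by (simp add: residual_def)
qed

lemma image_prod:
  assumes "E \<subseteq> T" "F \<subseteq> T"
  shows "E \<cdot> F \<subseteq> T" "\<phi> ` (E \<cdot> F) = ideal_prod k (\<phi> ` E) (\<phi> ` F)"
proof -
  show EF: "E \<cdot> F \<subseteq> T" using assms T_closed(6,7) by (intro ideal_prod_least) auto
  have "\<phi> x \<in> ideal_prod k (\<phi> ` E) (\<phi> ` F)" if "x \<in> E \<cdot> F" for x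
    using that
  proof (induction x rule: ideal_prod.induct)
    case (prod i j)
    then show ?case using assms by (auto simp: \<phi>_mult subset_iff intro!: ideal_prod.prod)
  next
    case (sum x y)
    then show ?case using EF by (auto simp: \<phi>_add subset_iff intro!: ideal_prod.sum)
  qed
  moreover have "ideal_prod k (\<phi> ` E) (\<phi> ` F) \<subseteq> \<phi> ` (E \<cdot> F)"
  proof (rule ideal_prod_least)
    fix i j assume "i \<in> \<phi> ` E" "j \<in> \<phi> ` F"
    then obtain e f where "e \<in> E" "i = \<phi> e" "f \<in> F" "j = \<phi> f" by blast
    then show "i \<otimes>\<^bsub>k\<^esub> j \<in> \<phi> ` (E \<cdot> F)"
      using assms \<phi>_mult[of e f] ideal_prod.prod[of e E f F K] by (metis image_eqI subsetD)
  next
    fix i j assume "i \<in> \<phi> ` (E \<cdot> F)" "j \<in> \<phi> ` (E \<cdot> F)"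
    then obtain x y where "x \<in> E \<cdot> F" "i = \<phi> x" "y \<in> E \<cdot> F" "j = \<phi> y" by blast
    then show "i \<oplus>\<^bsub>k\<^esub> j \<in> \<phi> ` (E \<cdot> F)"
      using EF \<phi>_add[of x y] ideal_prod.sum[of x K E F y] by (metis image_eqI subsetD)
  qed
  ultimately show "\<phi> ` (E \<cdot> F) = ideal_prod k (\<phi> ` E) (\<phi> ` F)" by blast
qed

lemma residual_prod:
  assumes "residual E" "residual F"
  shows "residual (E \<cdot> F)"
proof -
  note E = residualD[OF assms(1)] and F = residualD[OF assms(2)]
  note c = R.frac_idealsE(2)[OF E(1)] R.frac_idealsE(2)[OF F(1)]
  have "E \<cdot> F \<cdot> T = T"
    using ideal_prod_assoc[OF c T_closed(1)] E(2) F(2) by simp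
  then show ?thesis
    using R.frac_ideals_prod[OF E(1) F(1)] D.frac_ideals_prod[OF E(3) F(3)] image_prod(2)[OF E(4) F(4)]
    by (simp add: residual_def)
qed

lemma pre_inj: "J \<subseteq> carrier k \<Longrightarrow> J' \<subseteq> carrier k \<Longrightarrow> pre J = pre J' \<Longrightarrow> J = J'"
  using \<phi>_image_pre by metis

text \<open>The product of two preimages is residual even where it is not itself a preimage, so its
  t-closure depends only on its image in \<open>k\<close>.\<close>

lemma t_op_pre_prod:
  assumes "J \<in> frac_ideals k D" "L \<in> frac_ideals k D"
  shows "t_op K R (pre J \<cdot> pre L) = pre (t_op k D (ideal_prod k J L))"
proof -
  note r = residual_pre[OF assms(1)] residual_pre[OF assms(2)]
  have "t_op K R (pre J \<cdot> pre L) = pre (t_op k D (\<phi> ` (pre J \<cdot> pre L)))"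
    using residual_prod[OF r] by (rule t_op_residual)
  also have "\<phi> ` (pre J \<cdot> pre L) = ideal_prod k J L"
    using image_prod(2)[OF residualD(4)[OF r(1)] residualD(4)[OF r(2)]]
      \<phi>_image_pre D.frac_idealsE(2) assms by simp
  finally show ?thesis .
qed

lemma colon_pre_frac:
  assumes "J \<in> frac_ideals k D"
  shows "colon K R (pre J) = pre (colon k D J)"
  using colon_residual[OF residual_pre[OF assms]] \<phi>_image_pre[OF D.frac_idealsE(2)[OF assms]] by simp

text \<open>Up to t-closure \<open>pre\<close> commutes with products, it commutes with colons and
  closures, and it is injective, so each defining condition transfers both ways. One direction makes
  \<open>\<alpha>\<close> land in the group of \<open>R\<close>, the other finds preimages for the
  kernel of \<open>\<beta>\<close>.\<close>

lemma Inv_pre_iff: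
  assumes "J \<in> frac_ideals k D"
  shows "pre J \<in> carrier (Inv_group K R (t_op K R)) \<longleftrightarrow> J \<in> carrier (Inv_group k D (t_op k D))"
proof -
  note J' = D.frac_ideals_colon[OF assms]
  note p = D.frac_ideals_prod[OF assms J']
  note c = D.frac_idealsE(2)
  have "t_op K R (pre J) = pre (t_op k D J)"
    using t_op_residual[OF residual_pre[OF assms]] \<phi>_image_pre[OF c[OF assms]] by simp
  then have 1: "t_op K R (pre J) = pre J \<longleftrightarrow> t_op k D J = J"
    using pre_inj[OF c[OF D.t_op_frac[OF assms]] c[OF assms]] by auto
  have "t_op K R (pre J \<cdot> colon K R (pre J)) = pre (t_op k D (ideal_prod k J (colon k D J)))"
    using t_op_pre_prod[OF assms J'] colon_pre_frac[OF assms] by simp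
  then have 2: "t_op K R (pre J \<cdot> colon K R (pre J)) = R \<longleftrightarrow> t_op k D (ideal_prod k J (colon k D J)) = D"
    using pre_inj[OF c[OF D.t_op_frac[OF p]] D_closed(1)] pre_D by auto
  show ?thesis
    unfolding R.t.Inv_group_carrier D.t.Inv_group_carrier R.t.invertible_def D.t.invertible_def
    using 1 2 assms residualD(1)[OF residual_pre[OF assms]] by blast
qed

text \<open>With \<open>c = \<phi> u \<otimes> d\<close> and \<open>d\<close> a unit of
  \<open>D\<close>, the ideals generated by \<open>c\<close> and by \<open>\<phi> u\<close> agree;
  since \<open>u\<close> is a unit of \<open>T\<close>, an element of \<open>T\<close> has residue
  in this ideal exactly when its quotient by \<open>u\<close> lies in \<open>R\<close>.\<close>

lemma pre_principal:
  assumes "c \<in> carrier k - {\<zero>\<^bsub>k\<^esub>}"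
  shows "\<exists>u \<in> carrier K - {\<zero>}. pre (D #>\<^bsub>k\<^esub> c) = R #> u"
proof -
  obtain u d where u: "u \<in> T - {\<zero>}" "inv u \<in> T" "d \<in> D - {\<zero>\<^bsub>k\<^esub>}" "inv\<^bsub>k\<^esub> d \<in> D" "c = \<phi> u \<otimes>\<^bsub>k\<^esub> d"
    using lift_unit[OF assms] by blast
  have uc: "u \<in> carrier K - {\<zero>}" using u(1) T_carrier by auto
  have dc: "d \<in> carrier k - {\<zero>\<^bsub>k\<^esub>}" using u(3) D_closed(1) by auto
  have \<phi>u: "\<phi> u \<in> carrier k" using u(1) \<phi>_closed by blast
  have R: "R #> u \<subseteq> carrier K" using uc R_subset_T T_carrier by (intro scale_carrier) auto
  have "x \<in> pre (D #>\<^bsub>k\<^esub> c) \<longleftrightarrow> x \<in> R #> u" for x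
  proof
    assume x: "x \<in> pre (D #>\<^bsub>k\<^esub> c)"
    then obtain a where a: "x \<in> T" "a \<in> D" "\<phi> x = a \<otimes>\<^bsub>k\<^esub> c" by (auto simp: pre_def r_coset_mem)
    have xu: "x \<otimes> inv u \<in> T" using a(1) u(2) T_closed(6) by blast
    have "\<phi> u \<otimes>\<^bsub>k\<^esub> \<phi> (inv u) = \<one>\<^bsub>k\<^esub>"
      using \<phi>_mult[of u "inv u"] u(1,2) nonzero_inv(2)[OF uc] \<phi>_one by simp
    moreover have "\<phi> (x \<otimes> inv u) = (a \<otimes>\<^bsub>k\<^esub> d) \<otimes>\<^bsub>k\<^esub> (\<phi> u \<otimes>\<^bsub>k\<^esub> \<phi> (inv u))"
      using a u(2) u(5) \<phi>u dc D_closed(1) \<phi>_closed[OF u(2)] by (simp add: \<phi>_mult k.m_ac subsetD)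
    ultimately have "\<phi> (x \<otimes> inv u) = a \<otimes>\<^bsub>k\<^esub> d" using a(2) dc D_closed(1) by (simp add: subsetD)
    then have "x \<otimes> inv u \<in> R" using xu a(2) u(3) D_closed(6) by (simp add: R_def)
    then show "x \<in> R #> u"
      using scale_mem_iff[OF _ uc T_carrier[OF a(1)]] R_subset_T T_closed(1) by blast
  next
    assume "x \<in> R #> u"
    then obtain r where r: "r \<in> R" "x = r \<otimes> u" by (auto simp: r_coset_mem)
    have rD: "\<phi> r \<in> D" "\<phi> r \<in> carrier k" using r(1) D_closed(1) by (auto simp: R_def)
    have "\<phi> x = \<phi> r \<otimes>\<^bsub>k\<^esub> \<phi> u" using r u(1) R_subset_T by (auto simp: \<phi>_mult)
    also have "\<dots> = (\<phi> r \<otimes>\<^bsub>k\<^esub> inv\<^bsub>k\<^esub> d \<otimes>\<^bsub>k\<^esub> d) \<otimes>\<^bsub>k\<^esub> \<phi> u"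
      using k.inv_cancel(4)[OF dc rD(2)] by simp
    also have "\<dots> = (\<phi> r \<otimes>\<^bsub>k\<^esub> inv\<^bsub>k\<^esub> d) \<otimes>\<^bsub>k\<^esub> c"
      using rD(2) k.nonzero_inv(1)[OF dc] dc \<phi>u by (simp add: u(5) k.m_ac)
    finally have "\<phi> x = (\<phi> r \<otimes>\<^bsub>k\<^esub> inv\<^bsub>k\<^esub> d) \<otimes>\<^bsub>k\<^esub> c" .
    moreover have "\<phi> r \<otimes>\<^bsub>k\<^esub> inv\<^bsub>k\<^esub> d \<in> D" using rD(1) u(4) D_closed(6) by blast
    ultimately have "\<phi> x \<in> D #>\<^bsub>k\<^esub> c" by (auto simp: r_coset_mem)
    then show "x \<in> pre (D #>\<^bsub>k\<^esub> c)" using r u(1) R_subset_T T_closed(6) by (auto simp: pre_def)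
  qed
  then show ?thesis using uc by blast
qed

text \<open>The generator \<open>x\<close> belongs to \<open>R #> x = pre J\<close>, hence to
  \<open>T\<close>, so it has a residue, and this residue generates \<open>J\<close>. This gives
  injectivity of \<open>\<alpha>\<close>.\<close>

lemma principal_of_pre:
  assumes "J \<in> frac_ideals k D" "x \<in> carrier K - {\<zero>}" "pre J = R #> x"
  shows "J \<in> Prin k D"
proof -
  have "x \<in> R #> x" using subringE(3)[OF R_subring] assms(2) by (force simp: r_coset_mem)
  then have x: "x \<in> T" using assms(3) by (auto simp: pre_def)
  have "J = \<phi> ` (R #> x)" using \<phi>_image_pre[OF D.frac_idealsE(2)[OF assms(1)]] assms(3) by simp
  also have "\<dots> = D #>\<^bsub>k\<^esub> \<phi> x"
    using x R_subset_T by (force simp: r_coset_def \<phi>_image_R[symmetric] \<phi>_mult subset_iff image_iff)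
  finally have J: "J = D #>\<^bsub>k\<^esub> \<phi> x" .
  have "\<phi> x \<noteq> \<zero>\<^bsub>k\<^esub>"
  proof
    assume "\<phi> x = \<zero>\<^bsub>k\<^esub>"
    then have "J \<subseteq> {\<zero>\<^bsub>k\<^esub>}" using k.r_null subsetD[OF D_closed(1)] by (auto simp: J r_coset_mem)
    then show False using D.frac_idealsE(3)[OF assms(1)] by blast
  qed
  then show ?thesis using J \<phi>_closed[OF x] by (auto simp: Prin_def)
qed

subsection \<open>Extension of t-invertible ideals\<close>

abbreviation star_T where "star_T \<equiv> star_ext K T (t_op K R)"
abbreviation Inv_R where "Inv_R \<equiv> Inv_group K R (t_op K R)"
abbreviation Inv_T where "Inv_T \<equiv> Inv_group K T star_T"
abbreviation Inv_D where "Inv_D \<equiv> Inv_group k D (t_op k D)"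

text \<open>Both inclusions use \<open>mem_by_comaximality\<close> with a product of some
  \<open>e\<close> in \<open>E\<close> and some \<open>e'\<close> in (R : E) outside
  \<open>M\<close>. If \<open>y\<close> is in the closure of ET, then y(R : E) lies in
  \<open>T\<close>, so \<open>m y\<close> multiplies E(R : E) into \<open>E\<close>. In the other
  direction, \<open>M\<close> multiplies (T : ET) into (R : E), which is also the colon of the
  t-closure of \<open>E\<close>.\<close>

lemma star_extension:
  assumes "R.t.invertible E"
  shows "star_T (E \<cdot> T) = t_op K R E \<cdot> T"
proof
  note E = R.t.invertible_frac[OF assms]
  let ?E' = "colon K R E" and ?H = "t_op K R E"
  note Ec = R.frac_idealsE(2)[OF E] and E' = R.frac_ideals_colon[OF E] and H = R.t_op_frac[OF E]
  note E'c = R.frac_idealsE(2)[OF E'] and Hc = R.frac_idealsE(2)[OF H]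
  note ET = extension_frac[OF E]
  note ETR = frac_ideals_T_R[OF ET]
  have inv: "t_op K R (E \<cdot> ?E') = R" using assms by (simp add: R.t.invertible_def)
  obtain e e' where e: "e \<in> E" "e' \<in> ?E'" "e \<otimes> e' \<notin> M"
    using M_summands[OF Ec E'c] inv subringE(3)[OF R_subring] by blast
  have ec: "e \<in> carrier K" "e' \<in> carrier K" using e Ec E'c by auto
  have ee: "e \<otimes> e' \<in> T"
    using colonD[OF e(2,1)] ec R_subset_T by (auto simp: m_comm)
  show "star_T (E \<cdot> T) \<subseteq> ?H \<cdot> T"
  proof
    fix y assume y: "y \<in> star_T (E \<cdot> T)"
    then have yv: "y \<in> v_op K T (E \<cdot> T)" by (simp add: star_ext_def)
    then have yc: "y \<in> carrier K" using v_op_carrier[of K T "E \<cdot> T"] by blast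
    have "E \<subseteq> ?H" using E by (rule R.t_op_extensive)
    then have ETH: "E \<cdot> T \<subseteq> ?H \<cdot> T" by (intro ideal_prod_mono) auto
    show "y \<in> ?H \<cdot> T"
    proof (rule mem_by_comaximality[OF T.frac_idealsE(1)[OF extension_frac[OF H]] yc ee e(3)])
      have "e' \<in> colon K T (E \<cdot> T)"
      proof (rule colonI[OF ec(2)])
        show "e' \<otimes> x \<in> T" if "x \<in> E \<cdot> T" for x
          by (rule ideal_prod_colon_subset[OF _ Ec T_closed(1) ec(2) _ that])
            (use T_closed(6,7) subsetD[OF R_subset_T] colonD[OF e(2)] in auto)
      qed
      then have "y \<otimes> e' \<in> T" using yv unfolding v_op_def by (auto dest: colonD)
      then have "e \<otimes> (y \<otimes> e') \<in> ?H \<cdot> T" using e(1) ETH by (auto intro: ideal_prod.prod)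
      then show "e \<otimes> e' \<otimes> y \<in> ?H \<cdot> T" using ec yc by (simp add: m_ac)
      fix m assume m: "m \<in> M"
      have mc: "m \<in> carrier K" using m M_subset_T T_carrier by blast
      have "m \<otimes> y \<otimes> x \<in> E" if x: "x \<in> E \<cdot> ?E'" for x
      proof (rule ideal_prod_colon_subset[OF _ Ec E'c _ _ x])
        fix i j assume i: "i \<in> E" and j: "j \<in> ?E'"
        have ic: "i \<in> carrier K" and jc: "j \<in> carrier K" using i j Ec E'c by auto
        have "j \<in> colon K T (E \<cdot> T)"
        proof (rule colonI[OF jc])
          show "j \<otimes> x \<in> T" if "x \<in> E \<cdot> T" for x
            by (rule ideal_prod_colon_subset[OF _ Ec T_closed(1) jc _ that])
              (use T_closed(6,7) subsetD[OF R_subset_T] colonD[OF j] in auto)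
        qed
        then have "y \<otimes> j \<in> T" using yv unfolding v_op_def by (auto dest: colonD)
        then have "i \<otimes> (y \<otimes> j) \<in> E \<cdot> T" using i by (auto intro: ideal_prod.prod)
        then have "m \<otimes> (i \<otimes> (y \<otimes> j)) \<in> E" using M_mult_extension[OF R.frac_idealsE(1)[OF E] m] by blast
        then show "m \<otimes> y \<otimes> i \<otimes> j \<in> E" using ic jc yc mc by (simp add: m_ac)
      qed (use mc yc subalgebraE(4)[OF R.frac_idealsE(1)[OF E]] in auto)
      \<comment> \<open>The t-closure of \<open>E \<cdot> ?E'\<close> contains one by invertibility,
        and \<open>m \<otimes> y\<close> maps it into the t-closure of \<open>E\<close>.\<close>
      then have "m \<otimes> y \<otimes> \<one> \<in> ?H"
        using inv subringE(3)[OF R_subring] mc yc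
        by (intro R.t.star_mult_mem[OF R.frac_ideals_prod[OF E E'] E]) auto
      then show "m \<otimes> y \<in> ?H \<cdot> T" using mc yc extension_superset[OF Hc] by auto
    qed
  qed
  have "?H \<subseteq> star_T (E \<cdot> T)"
  proof
    fix y assume y: "y \<in> ?H"
    then have yc: "y \<in> carrier K" using Hc by blast
    have "y \<in> t_op K R (E \<cdot> T)" using R.t_op_mono[OF extension_superset[OF Ec]] y by blast
    moreover have "y \<in> v_op K T (E \<cdot> T)"
      unfolding v_op_def
    proof (rule colonI[OF yc])
      fix x assume x: "x \<in> colon K T (E \<cdot> T)"
      have xc: "x \<in> carrier K" using x by (rule colon_carrier)
      have xE: "x \<otimes> i \<in> T" if "i \<in> E" for i
        using colonD[OF x] extension_superset[OF Ec] that by blast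
      show "y \<otimes> x \<in> T"
      proof (rule mem_by_comaximality[OF subring_subalgebra[OF T_subring] _ ee e(3)])
        have "e' \<otimes> y \<in> R"
          using e(2) y R.t.colon_star[OF E] by (auto dest: colonD)
        then have "(x \<otimes> e) \<otimes> (e' \<otimes> y) \<in> T" using xE[OF e(1)] R_subset_T T_closed(6) by blast
        then show "e \<otimes> e' \<otimes> (y \<otimes> x) \<in> T" using ec xc yc by (simp add: m_ac)
        fix m assume m: "m \<in> M"
        have mc: "m \<in> carrier K" using m M_subset_T T_carrier by blast
        \<comment> \<open>\<open>x\<close> multiplies \<open>E\<close> into \<open>T\<close> only;
          the additional factor from \<open>M\<close> brings the products into
          \<open>R\<close>.\<close>
        have "m \<otimes> x \<in> colon K R E"
        proof (rule colonI)
          show "m \<otimes> x \<otimes> i \<in> R" if "i \<in> E" for i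
            using M_mult_T[OF m xE[OF that]] M_subset_R mc xc subsetD[OF Ec that] by (auto simp: m_assoc)
        qed (use mc xc in auto)
        then have "m \<otimes> x \<otimes> y \<in> R" using y R.t.colon_star[OF E] by (auto dest: colonD)
        then show "m \<otimes> (y \<otimes> x) \<in> T" using R_subset_T mc xc yc by (auto simp: m_ac)
      qed (use xc yc in auto)
    qed
    ultimately show "y \<in> star_T (E \<cdot> T)" by (simp add: star_ext_def)
  qed
  then show "?H \<cdot> T \<subseteq> star_T (E \<cdot> T)"
    using T.frac_idealsE(1)[OF e.star_frac[OF ET]] by (intro extension_least)
qed

lemma extension_Inv:
  assumes "H \<in> carrier Inv_R"
  shows "H \<cdot> T \<in> carrier Inv_T"
proof -
  have H: "R.t.invertible H" "t_op K R H = H" using assms by (auto simp: R.t.Inv_group_carrier)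
  note Hf = R.t.Inv_frac[OF assms]
  let ?H' = "colon K R H"
  note H' = R.frac_ideals_colon[OF Hf]
  note HH' = R.frac_ideals_prod[OF Hf H']
  have inv: "t_op K R (H \<cdot> ?H') = R" using H(1) by (simp add: R.t.invertible_def)
  \<comment> \<open>\<open>star_extension\<close> is applied to the product itself, which is
    invertible although it need not be closed; its t-closure is \<open>R\<close>.\<close>
  have "R.t.invertible (H \<cdot> ?H')" using H(1) R.t.invertible_colon R.t.invertible_prod by blast
  then have "star_T (H \<cdot> ?H' \<cdot> T) = R \<cdot> T" using star_extension inv by simp
  also have "R \<cdot> T = T"
    using ideal_prod_subring[OF subalgebra_subset[OF subring_subalgebra[OF T_subring] R_subset_T] R_subring]
      ideal_prod_comm[OF T_closed(1) subringE(1)[OF R_subring]] by simp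
  finally have "star_T (H \<cdot> T \<cdot> (?H' \<cdot> T)) = T"
    using extension_prod[OF R.frac_idealsE(2)[OF Hf] R.frac_idealsE(2)[OF H']] by simp
  then have "e.invertible (H \<cdot> T)"
    using extension_frac[OF Hf] extension_frac[OF H'] by (intro e.invertibleI)
  then show ?thesis using star_extension[OF H(1)] H(2) by (simp add: e.Inv_group_carrier)
qed

lemma extension_hom: "(\<lambda>H. H \<cdot> T) \<in> hom Inv_R Inv_T"
proof (rule homI)
  show "H \<cdot> T \<in> carrier Inv_T" if "H \<in> carrier Inv_R" for H using that by (rule extension_Inv)
  fix H L assume HL: "H \<in> carrier Inv_R" "L \<in> carrier Inv_R"
  have "t_op K R (H \<cdot> L) \<cdot> T = star_T (H \<cdot> L \<cdot> T)"
    using star_extension[of "H \<cdot> L"] HL R.t.invertible_prod by (simp add: R.t.Inv_group_carrier)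
  also have "H \<cdot> L \<cdot> T = H \<cdot> T \<cdot> (L \<cdot> T)"
    using extension_prod HL R.t.Inv_frac R.frac_idealsE(2) by metis
  finally show "(H \<otimes>\<^bsub>Inv_R\<^esub> L) \<cdot> T = H \<cdot> T \<otimes>\<^bsub>Inv_T\<^esub> (L \<cdot> T)"
    by (simp add: R.t.Inv_group_mult e.Inv_group_mult)
qed

lemma extension_scale:
  assumes "E \<subseteq> carrier K" "x \<in> carrier K - {\<zero>}"
  shows "(E #> x) \<cdot> T = (E \<cdot> T) #> x"
  using assms(1) T_closed(1) assms(2) by (rule ideal_prod_scale)

subsection \<open>Ideals of T that are comaximal to M\<close>

text \<open>Every class of invertible ideals of T contains ideals comaximal to M; on these the
  splitting is the contraction to R.\<close>

definition comax where
  "comax I \<longleftrightarrow> I \<in> carrier Inv_T \<and> I \<subseteq> T \<and> \<not> I \<subseteq> M"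

text \<open>Scaling by \<open>b\<close> in (T : I) makes the ideal integral, and choosing
  \<open>b\<close> with some \<open>a \<otimes> b\<close> outside \<open>M\<close> keeps the result
  from being contained in \<open>M\<close>.\<close>

lemma exists_comax:
  assumes "I \<in> carrier Inv_T"
  obtains x where "x \<in> carrier K - {\<zero>}" "comax (I #> x)"
proof -
  note If = e.Inv_frac[OF assms]
  let ?I' = "colon K T I"
  have "star_T (I \<cdot> ?I') = T" using assms by (auto simp: e.Inv_group_carrier e.invertible_def)
  \<comment> \<open>The closure on \<open>T\<close> is contained in the t-closure over
    \<open>R\<close>, so \<open>M_summands\<close>, which relies on the divisoriality of
    \<open>M\<close> in \<open>R\<close>, also applies to ideals of \<open>T\<close>.\<close>
  then have "\<one> \<in> t_op K R (I \<cdot> ?I')" using T_closed(3) by (auto simp: star_ext_def)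
  then obtain a b where ab: "a \<in> I" "b \<in> ?I'" "a \<otimes> b \<notin> M"
    using M_summands[of I ?I'] T.frac_idealsE(2)[OF If] T.frac_idealsE(2)[OF T.frac_ideals_colon[OF If]] by blast
  have ac: "a \<in> carrier K" and bc: "b \<in> carrier K"
    using ab T.frac_idealsE(2)[OF If] colon_carrier[OF ab(2)] by auto
  have "b \<noteq> \<zero>" using ab(3) ac subalgebraE(3)[OF M_subalgebra] by auto
  then have b: "b \<in> carrier K - {\<zero>}" using bc by simp
  have "I #> b \<subseteq> T"
  proof
    fix y assume "y \<in> I #> b"
    then obtain i where "i \<in> I" "y = i \<otimes> b" by (auto simp: r_coset_mem)
    then show "y \<in> T"
      using colonD[OF ab(2)] bc T.frac_idealsE(2)[OF If] m_comm[of i b] by auto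
  qed
  moreover have "\<not> I #> b \<subseteq> M" using scale_in_scale[OF ab(1)] ab(3) by blast
  ultimately show thesis using that b e.Inv_scale[OF assms b] by (simp add: comax_def)
qed

text \<open>Multiplying by a lift of the inverse residue normalises the residue to one. Such an
  element lies in \<open>R\<close>, and multiplication by it does not change residues.\<close>

lemma comax_unit:
  assumes "subalgebra T I K" "I \<subseteq> T" "\<not> I \<subseteq> M"
  obtains i where "i \<in> I" "\<phi> i = \<one>\<^bsub>k\<^esub>"
proof -
  obtain f where f: "f \<in> I" "f \<notin> M" using assms(3) by blast
  have fT: "f \<in> T" using f(1) assms(2) by blast
  have "\<phi> f \<in> carrier k - {\<zero>\<^bsub>k\<^esub>}" using f(2) fT \<phi>_closed by (auto simp: M_def)
  note i = k.nonzero_inv[OF this]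
  obtain t where t: "t \<in> T" "\<phi> t = inv\<^bsub>k\<^esub> \<phi> f" using i(1) \<phi>_surj by (metis DiffD1 imageE)
  have "t \<otimes> f \<in> I" using subalgebraE(6)[OF assms(1) t(1) f(1)] .
  moreover have "\<phi> (t \<otimes> f) = \<one>\<^bsub>k\<^esub>" using t fT i(3) by (simp add: \<phi>_mult)
  ultimately show thesis using that by blast
qed

lemma comaxD:
  assumes "comax I"
  shows "I \<in> carrier Inv_T" "I \<in> frac_ideals K T" "I \<subseteq> T" "\<exists>i\<in>I. \<phi> i = \<one>\<^bsub>k\<^esub>"
proof -
  show I: "I \<in> carrier Inv_T" "I \<subseteq> T" using assms by (auto simp: comax_def)
  show If: "I \<in> frac_ideals K T" using I(1) by (rule e.Inv_frac)
  show "\<exists>i\<in>I. \<phi> i = \<one>\<^bsub>k\<^esub>"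
    using comax_unit[OF T.frac_idealsE(1)[OF If] I(2)] assms by (auto simp: comax_def)
qed

text \<open>An element \<open>i\<close> of residue one lies in the contraction, so
  \<open>i \<otimes> x\<close> is in its extension for every \<open>x\<close> in \<open>T\<close>,
  while \<open>M\<close> multiplies \<open>I\<close> into \<open>I \<inter> R\<close>. Comaximality
  combines the two.\<close>

lemma contraction_extension:
  assumes "comax I"
  shows "(I \<inter> R) \<cdot> T = I"
proof
  note I = comaxD[OF assms]
  note Ia = T.frac_idealsE(1)[OF I(2)]
  show "(I \<inter> R) \<cdot> T \<subseteq> I" using Ia by (rule extension_least) blast
  obtain i where i: "i \<in> I" "\<phi> i = \<one>\<^bsub>k\<^esub>" using I(4) by blast
  have iT: "i \<in> T" using i I(3) by blast
  have iR: "i \<in> I \<inter> R" using i iT D_closed(3) by (simp add: R_def)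
  have sub: "I \<inter> R \<subseteq> carrier K" using I(3) T_closed(1) by blast
  have iM: "i \<notin> M" using i(2) by (simp add: M_def)
  show "I \<subseteq> (I \<inter> R) \<cdot> T"
  proof
    fix x assume x: "x \<in> I"
    then have xT: "x \<in> T" using I(3) by blast
    show "x \<in> (I \<inter> R) \<cdot> T"
    proof (rule mem_by_comaximality[OF extension_subalgebra[OF sub] T_carrier[OF xT] iT iM])
      show "I \<inter> R \<noteq> {}" using iR by blast
      show "i \<otimes> x \<in> (I \<inter> R) \<cdot> T" using iR xT by (rule ideal_prod.prod)
      show "m \<otimes> x \<in> (I \<inter> R) \<cdot> T" if "m \<in> M" for m
      proof -
        have "m \<otimes> x \<in> I \<inter> R"
          using subalgebraE(6)[OF Ia _ x, of m] M_mult_T[OF that xT] that M_subset_T M_subset_R by blast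
        then show ?thesis using extension_superset[OF sub] by blast
      qed
    qed
  qed
qed

lemma contraction_frac:
  assumes "comax I"
  shows "I \<inter> R \<in> frac_ideals K R"
proof -
  note I = comaxD[OF assms]
  note Ia = T.frac_idealsE(1)[OF I(2)]
  obtain i where i: "i \<in> I" "\<phi> i = \<one>\<^bsub>k\<^esub>" using I(4) by blast
  have iR: "i \<in> I \<inter> R" using i I(3) D_closed(3) by (auto simp: R_def)
  have i0: "i \<noteq> \<zero>" using i(2) \<phi>_zero by auto
  have "subalgebra R (I \<inter> R) K"
    using subalgebra_subset[OF Ia R_subset_T] subring_subalgebra[OF R_subring] by (rule subalgebra_Int)
  then show ?thesis using iR i0
    by (rule R.frac_idealsI[of _ i \<one>]) (use subringE(1)[OF R_subring] in auto)
qed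

text \<open>Closedness: an element of the t-closure of the contraction lies in \<open>R\<close> and,
  tested against \<open>i\<close> and \<open>M\<close>, in the v-closure of \<open>I\<close> over
  \<open>T\<close>; hence it lies in \<open>I\<close>. Invertibility: the closure of the contraction
  times its colon contains \<open>M\<close> by the invertibility of \<open>I\<close>, and it
  contains \<open>i\<close>, which has residue one, so it contains one.\<close>

lemma contraction_Inv:
  assumes "comax I"
  shows "I \<inter> R \<in> carrier Inv_R"
proof -
  note I = comaxD[OF assms]
  let ?H = "I \<inter> R" and ?I' = "colon K T I"
  note Ia = T.frac_idealsE(1)[OF I(2)]
  note Hf = contraction_frac[OF assms]
  note I' = T.frac_ideals_colon[OF I(2)]
  let ?C = "colon K R ?H"
  note C = R.frac_ideals_colon[OF Hf]
  obtain i where i: "i \<in> I" "\<phi> i = \<one>\<^bsub>k\<^esub>" using I(4) by blast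
  have iT: "i \<in> T" and iR: "i \<in> ?H" using i I(3) D_closed(3) by (auto simp: R_def)
  have ic: "i \<in> carrier K" using iT T_carrier by blast
  have iM: "i \<notin> M" using i(2) by (simp add: M_def)
  have inI': "x \<in> carrier K" "\<And>y. y \<in> I \<Longrightarrow> x \<otimes> y \<in> T" if "x \<in> ?I'" for x
    using colon_carrier[OF that] colonD[OF that] by auto
  have inv: "star_T (I \<cdot> ?I') = T" "star_T I = I"
    using I(1) by (auto simp: e.Inv_group_carrier e.invertible_def)
  \<comment> \<open>The single product \<open>x \<otimes> i\<close> decides: as \<open>i\<close> has
    residue one, the residue of \<open>x \<otimes> h\<close> is that of \<open>x \<otimes> i\<close>
    times that of \<open>h\<close>.\<close>
  have inC: "x \<in> ?C" if x: "x \<in> ?I'" "x \<otimes> i \<in> R" for x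
  proof (rule colonI[OF inI'(1)[OF x(1)]])
    fix h assume h: "h \<in> ?H"
    have hT: "h \<in> T" using h I(3) by blast
    note xh = inI'(2)[OF x(1), of h] and xi = inI'(2)[OF x(1) i(1)]
    have "\<phi> (x \<otimes> h) = \<phi> (x \<otimes> h) \<otimes>\<^bsub>k\<^esub> \<phi> i" using i(2) \<phi>_closed[OF xh] h by simp
    also have "\<dots> = \<phi> ((x \<otimes> i) \<otimes> h)"
      using \<phi>_mult[OF xh iT] h inI'(1)[OF x(1)] ic T_carrier[OF hT] by (simp add: m_ac)
    also have "\<dots> = \<phi> (x \<otimes> i) \<otimes>\<^bsub>k\<^esub> \<phi> h" using xi hT by (rule \<phi>_mult)
    also have "\<dots> \<in> D" using x(2) h D_closed(6) by (auto simp: R_def)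
    finally show "x \<otimes> h \<in> R" using xh h by (simp add: R_def)
  qed
  have "t_op K R ?H \<subseteq> ?H"
  proof
    fix y assume y: "y \<in> t_op K R ?H"
    then have yR: "y \<in> R" using R.t_op_mono[of ?H R] R.t.star_self by auto
    then have yT: "y \<in> T" and yc: "y \<in> carrier K" using R_subset_T T_carrier by auto
    have "y \<in> v_op K T I"
      unfolding v_op_def
    proof (rule colonI[OF yc])
      fix x assume x: "x \<in> ?I'"
      note xc = inI'(1)[OF x]
      show "y \<otimes> x \<in> T"
      \<comment> \<open>\<open>x \<otimes> i\<close> already lies in \<open>T\<close>, and
        \<open>m \<otimes> x\<close> multiplies the contraction into \<open>R\<close>, hence its
        t-closure too.\<close>
      proof (rule mem_by_comaximality[OF subring_subalgebra[OF T_subring] _ iT iM])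
        have "(x \<otimes> i) \<otimes> y \<in> T" using inI'(2)[OF x i(1)] yT T_closed(6) by blast
        then show "i \<otimes> (y \<otimes> x) \<in> T" using ic yc xc by (simp add: m_ac)
        fix m assume m: "m \<in> M"
        have mc: "m \<in> carrier K" using m M_subset_T T_carrier by blast
        have "m \<otimes> x \<otimes> y \<in> t_op K R R"
        proof (rule R.t.star_mult_mem[OF Hf R.frac_ideals_self _ _ y])
          show "m \<otimes> x \<otimes> h \<in> R" if "h \<in> ?H" for h
          proof -
            have "h \<in> carrier K" using that I(3) T_carrier by blast
            then have "m \<otimes> x \<otimes> h = m \<otimes> (x \<otimes> h)" using mc xc by (simp add: m_assoc)
            then show ?thesis using M_mult_T[OF m inI'(2)[OF x]] that M_subset_R by auto
          qed
        qed (use mc xc in auto)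
        then have "m \<otimes> x \<otimes> y \<in> T" using R.t.star_self R_subset_T by auto
        then show "m \<otimes> (y \<otimes> x) \<in> T" using mc xc yc by (simp add: m_ac)
      qed (use xc yc in auto)
    qed
    moreover have "y \<in> t_op K R I" using y R.t_op_mono[of ?H I] by blast
    ultimately have "y \<in> star_T I" by (simp add: star_ext_def)
    then show "y \<in> ?H" using inv(2) yR by simp
  qed
  then have tH: "t_op K R ?H = ?H" using R.t_op_extensive[OF Hf] by blast
  let ?E = "?H \<cdot> ?C"
  note E = R.frac_ideals_prod[OF Hf C]
  note Ea = R.frac_idealsE(1)[OF E] and tE = R.t_op_subalgebra[OF E]
  have tER: "t_op K R ?E \<subseteq> R"
    using R.t_op_mono[OF R.t.prod_colon_subset[OF Hf]] R.t.star_self by simp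
  have MtE: "m \<in> t_op K R ?E" if m: "m \<in> M" for m
  proof -
    have mc: "m \<in> carrier K" using m M_subset_T T_carrier by blast
    \<comment> \<open>Since \<open>I\<close> is the extension of its contraction, \<open>x\<close>
      may be replaced by a product \<open>h \<otimes> t\<close>. Moving \<open>t\<close> next to
      \<open>m\<close> gives a factor from \<open>M\<close>, and then
      \<open>(m \<otimes> t) \<otimes> x'\<close> passes the test \<open>inC\<close>.\<close>
    have step: "m \<otimes> x' \<otimes> x \<in> ?E" if x': "x' \<in> ?I'" and x: "x \<in> I" for x' x
    proof -
      note x'c = inI'(1)[OF x']
      have xH: "x \<in> ?H \<cdot> T" using x contraction_extension[OF assms] by simp
      show ?thesis
      proof (rule ideal_prod_colon_subset[OF _ _ T_closed(1) _ _ xH])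
        fix h t assume h: "h \<in> ?H" and t: "t \<in> T"
        have hc: "h \<in> carrier K" and tc: "t \<in> carrier K" using h t I(3) T_carrier by auto
        have mt: "m \<otimes> t \<in> M" using M_mult_T[OF m t] .
        have "(m \<otimes> t) \<otimes> x' \<in> ?C"
        proof (rule inC)
          show "(m \<otimes> t) \<otimes> x' \<in> ?I'"
            using subalgebraE(6)[OF T.frac_idealsE(1)[OF I'] _ x'] mt M_subset_T by blast
          have "(m \<otimes> t) \<otimes> (x' \<otimes> i) \<in> R" using M_mult_T[OF mt inI'(2)[OF x' i(1)]] M_subset_R by blast
          then show "m \<otimes> t \<otimes> x' \<otimes> i \<in> R" using mc tc x'c ic by (simp add: m_assoc)
        qed
        then have "h \<otimes> ((m \<otimes> t) \<otimes> x') \<in> ?E" using h by (intro ideal_prod.prod)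
        then show "m \<otimes> x' \<otimes> h \<otimes> t \<in> ?E" using mc tc x'c hc by (simp add: m_ac)
      next
        show "?H \<subseteq> carrier K" using I(3) T_closed(1) by blast
        show "m \<otimes> x' \<in> carrier K" using mc x'c by simp
      qed (rule ideal_prod.sum)
    qed
    have II': "I \<cdot> ?I' \<in> frac_ideals K T" using T.frac_ideals_prod[OF I(2) I'] .
    \<comment> \<open>The invertibility of \<open>I\<close> over \<open>T\<close> is used as a
      statement about t-closures over \<open>R\<close>: one lies in the t-closure of
      \<open>I \<cdot> ?I'\<close>, and \<open>m\<close> multiplies this product into
      \<open>?E\<close>.\<close>
    have "m \<otimes> \<one> \<in> t_op K R ?E"
    proof (rule R.t.star_mult_mem[OF frac_ideals_T_R[OF II'] E mc])
      show "\<one> \<in> t_op K R (I \<cdot> ?I')" using inv(1) T_closed(3) by (auto simp: star_ext_def)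
      show "m \<otimes> z \<in> ?E" if z: "z \<in> I \<cdot> ?I'" for z
      proof (rule ideal_prod_colon_subset[OF _ _ _ mc _ z])
        show "I \<subseteq> carrier K" "?I' \<subseteq> carrier K" using T.frac_idealsE(2) I(2) I' by auto
        fix x x' assume x: "x \<in> I" "x' \<in> ?I'"
        have "x \<in> carrier K" using x(1) I(3) T_carrier by blast
        then show "m \<otimes> x \<otimes> x' \<in> ?E" using step[OF x(2,1)] mc inI'(1)[OF x(2)] by (simp add: m_ac)
      qed (rule ideal_prod.sum)
    qed
    then show ?thesis using mc by simp
  qed
  have "\<one> \<in> ?C" using subringE(1)[OF R_subring] by (intro colonI) auto
  then have "i \<otimes> \<one> \<in> ?E" using iR by (intro ideal_prod.prod)
  then have "i \<in> t_op K R ?E" using R.t_op_extensive[OF E] ic by auto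
  moreover obtain m where "m \<in> M" "\<one> = i \<oplus> m" using comaximal_one[OF iT i(2)] .
  ultimately have "\<one> \<in> t_op K R ?E" using MtE subalgebraE(4)[OF tE] by metis
  then have "R \<subseteq> t_op K R ?E" using subalgebraE(6)[OF tE, of _ \<one>] subringE(1)[OF R_subring] by force
  then have "t_op K R ?E = R" using tER by blast
  then show ?thesis using Hf tH by (simp add: R.t.Inv_group_carrier R.t.invertible_def)
qed

text \<open>Write \<open>1 = a + m\<close>. For \<open>y\<close> in the intersection,
  \<open>y \<otimes> a\<close> is in \<open>A\<close> because \<open>y\<close> is in
  \<open>R\<close>, and \<open>m \<otimes> y\<close> is in \<open>A\<close> because \<open>y\<close>
  is in the extension.\<close>

lemma extension_contraction:
  assumes "A \<in> frac_ideals K R" "A \<subseteq> R" "a \<in> A" "\<phi> a = \<one>\<^bsub>k\<^esub>"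
  shows "A \<cdot> T \<inter> R = A"
proof
  note Aa = R.frac_idealsE(1)[OF assms(1)]
  show "A \<subseteq> A \<cdot> T \<inter> R" using extension_superset[OF R.frac_idealsE(2)[OF assms(1)]] assms(2) by blast
  show "A \<cdot> T \<inter> R \<subseteq> A"
  proof
    fix y assume y: "y \<in> A \<cdot> T \<inter> R"
    have aT: "a \<in> T" using assms(2,3) R_subset_T by blast
    obtain m where m: "m \<in> M" "\<one> = a \<oplus> m" using comaximal_one[OF aT assms(4)] .
    have c: "a \<in> carrier K" "m \<in> carrier K" "y \<in> carrier K" using aT m(1) y M_subset_T R_subset_T T_carrier by auto
    have "y = (a \<oplus> m) \<otimes> y" using c(3) by (simp flip: m(2))
    also have "\<dots> = y \<otimes> a \<oplus> m \<otimes> y" using c l_distr[of a m y] by (simp add: m_comm)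
    also have "\<dots> \<in> A"
      using subalgebraE(4)[OF Aa] subalgebraE(6)[OF Aa, of y a] M_mult_extension[OF Aa m(1), of y] y assms(3) by blast
    finally show "y \<in> A" .
  qed
qed

text \<open>The closed product of the contractions has the closed product of \<open>I\<close> and
  \<open>J\<close> as its extension to \<open>T\<close>, and it contains the element
  \<open>i \<otimes> j\<close> of residue one. So it is recovered by
  \<open>extension_contraction\<close>.\<close>

lemma comax_prod:
  assumes "comax I" "comax J"
  shows "comax (star_T (I \<cdot> J))" "star_T (I \<cdot> J) \<inter> R = t_op K R ((I \<inter> R) \<cdot> (J \<inter> R))"
proof -
  note I = comaxD[OF assms(1)] and J = comaxD[OF assms(2)]
  interpret G: comm_group Inv_T by (rule e.Inv_comm_group)
  note IJ = T.frac_ideals_prod[OF I(2) J(2)]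
  obtain i j where i: "i \<in> I" "\<phi> i = \<one>\<^bsub>k\<^esub>" and j: "j \<in> J" "\<phi> j = \<one>\<^bsub>k\<^esub>" using I(4) J(4) by blast
  have T: "i \<in> T" "j \<in> T" using i j I(3) J(3) by auto
  have ij: "\<phi> (i \<otimes> j) = \<one>\<^bsub>k\<^esub>" using i j T by (simp add: \<phi>_mult)
  have "I \<cdot> J \<subseteq> T" using I(3) J(3) T_closed(6,7) by (intro ideal_prod_least) auto
  then have sub: "star_T (I \<cdot> J) \<subseteq> T"
    using e.star_mono[OF IJ T.frac_ideals_self] e.star_self by simp
  have "i \<otimes> j \<in> star_T (I \<cdot> J)" using i j e.star_extensive[OF IJ] by (auto intro: ideal_prod.prod)
  moreover have "i \<otimes> j \<notin> M" using ij by (simp add: M_def)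
  ultimately show "comax (star_T (I \<cdot> J))"
    using sub G.m_closed[OF I(1) J(1)] by (auto simp: comax_def e.Inv_group_mult)
  let ?A = "I \<inter> R" and ?B = "J \<inter> R"
  have A: "?A \<in> carrier Inv_R" and B: "?B \<in> carrier Inv_R"
    using assms contraction_Inv by auto
  note AB = R.frac_ideals_prod[OF R.t.Inv_frac[OF A] R.t.Inv_frac[OF B]]
  have "t_op K R (?A \<cdot> ?B) \<cdot> T = star_T (I \<cdot> J)"
    using hom_mult[OF extension_hom A B] contraction_extension assms
    by (simp add: R.t.Inv_group_mult e.Inv_group_mult)
  moreover have "t_op K R (?A \<cdot> ?B) \<cdot> T \<inter> R = t_op K R (?A \<cdot> ?B)"
  proof (rule extension_contraction[OF R.t_op_frac[OF AB] _ _ ij])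
    have "?A \<cdot> ?B \<subseteq> R" using subringE(6,7)[OF R_subring] by (intro ideal_prod_least) auto
    then show "t_op K R (?A \<cdot> ?B) \<subseteq> R" using R.t_op_mono R.t.star_self by metis
    have "i \<in> ?A" "j \<in> ?B" using i j T D_closed(3) by (auto simp: R_def)
    then show "i \<otimes> j \<in> t_op K R (?A \<cdot> ?B)"
      using R.t_op_extensive[OF AB] by (auto intro: ideal_prod.prod)
  qed
  ultimately show "star_T (I \<cdot> J) \<inter> R = t_op K R (?A \<cdot> ?B)" by simp
qed

text \<open>On residues of \<open>J\<close>, scaling by \<open>x\<close> acts as multiplication by
  that of \<open>j \<otimes> x\<close>, where \<open>j\<close> has residue one. Dividing
  \<open>x\<close> by a suitable unit \<open>u\<close> of \<open>T\<close> leaves \<open>I\<close>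
  unchanged and makes this factor a unit \<open>d\<close> of \<open>D\<close>, so that membership in
  \<open>R\<close> is preserved both ways.\<close>

lemma comax_scale:
  assumes "comax I" "comax J" "x \<in> carrier K - {\<zero>}" "I = J #> x"
  shows "\<exists>y\<in>carrier K - {\<zero>}. I \<inter> R = (J \<inter> R) #> y"
proof -
  note I = comaxD[OF assms(1)] and J = comaxD[OF assms(2)]
  note Jc = T.frac_idealsE(2)[OF J(2)]
  obtain i where i: "i \<in> I" "\<phi> i = \<one>\<^bsub>k\<^esub>" using I(4) by blast
  obtain j where j: "j \<in> J" "\<phi> j = \<one>\<^bsub>k\<^esub>" using J(4) by blast
  \<comment> \<open>\<open>f\<close> serves to show that \<open>j \<otimes> x\<close> has nonzero
    residue: the residues of \<open>j \<otimes> x\<close> and \<open>f\<close> multiply to those of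
    \<open>f \<otimes> x = i\<close> and \<open>j\<close>, that is, to one.\<close>
  obtain f where f: "f \<in> J" "i = f \<otimes> x" using i(1) assms(4) by (auto simp: r_coset_mem)
  have jT: "j \<in> T" and fT: "f \<in> T" and jx: "j \<otimes> x \<in> T" and fx: "f \<otimes> x \<in> T"
    using j(1) f J(3) I(3) scale_in_scale[of _ J x] assms(4) by auto
  have c: "x \<in> carrier K" "j \<in> carrier K" "f \<in> carrier K" using assms(3) jT fT T_carrier by auto
  have "\<phi> (j \<otimes> x) \<otimes>\<^bsub>k\<^esub> \<phi> f = \<phi> (f \<otimes> x) \<otimes>\<^bsub>k\<^esub> \<phi> j"
    using \<phi>_mult[OF jx fT] \<phi>_mult[OF fx jT] c by (simp add: m_ac)
  then have "\<phi> (j \<otimes> x) \<otimes>\<^bsub>k\<^esub> \<phi> f = \<one>\<^bsub>k\<^esub>" using i(2) j(2) f(2) by simp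
  then have "\<phi> (j \<otimes> x) \<noteq> \<zero>\<^bsub>k\<^esub>" using \<phi>_closed[OF fT] by auto
  then have "\<phi> (j \<otimes> x) \<in> carrier k - {\<zero>\<^bsub>k\<^esub>}" using \<phi>_closed[OF jx] by simp
  then obtain u d where u: "u \<in> T - {\<zero>}" "inv u \<in> T" "d \<in> D - {\<zero>\<^bsub>k\<^esub>}" "inv\<^bsub>k\<^esub> d \<in> D"
    "\<phi> (j \<otimes> x) = \<phi> u \<otimes>\<^bsub>k\<^esub> d" using lift_unit by blast
  have uc: "u \<in> carrier K - {\<zero>}" using u(1) T_carrier by auto
  note iu = nonzero_inv[OF uc]
  have dc: "d \<in> carrier k - {\<zero>\<^bsub>k\<^esub>}" using u(3) D_closed(1) by auto
  let ?y = "x \<otimes> inv u"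
  have y: "?y \<in> carrier K - {\<zero>}" using assms(3) iu(1) by (rule nonzero_mult)
  note Ia = T.frac_idealsE(1)[OF I(2)]
  have unit: "I #> v \<subseteq> I" if "v \<in> T" for v
    using subalgebraE(6)[OF Ia that] subalgebraE(2)[OF Ia] T_carrier[OF that]
    by (auto simp: r_coset_mem m_comm)
  have "I #> inv u \<subseteq> I" using unit u(2) .
  moreover have "(I #> u) #> inv u \<subseteq> I #> inv u" using unit u(1) by (intro scale_mono) auto
  ultimately have "I #> inv u = I" using scale_inv(1)[OF subalgebraE(1)[OF Ia] uc] by auto
  then have IJ: "I = J #> ?y" using scale_scale[OF Jc c(1), of "inv u"] iu(1) assms(4) by simp
  have "j \<otimes> ?y = (j \<otimes> x) \<otimes> inv u" using c iu(1) by (simp add: m_assoc)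
  then have "\<phi> (j \<otimes> ?y) = \<phi> u \<otimes>\<^bsub>k\<^esub> d \<otimes>\<^bsub>k\<^esub> \<phi> (inv u)" using \<phi>_mult[OF jx u(2)] u(5) by simp
  also have "\<dots> = (\<phi> u \<otimes>\<^bsub>k\<^esub> \<phi> (inv u)) \<otimes>\<^bsub>k\<^esub> d"
    using \<phi>_closed u(1,2) dc by (simp add: k.m_ac)
  also have "\<phi> u \<otimes>\<^bsub>k\<^esub> \<phi> (inv u) = \<one>\<^bsub>k\<^esub>"
    using \<phi>_mult[of u "inv u"] u(1,2) iu(2) \<phi>_one by simp
  finally have jy: "\<phi> (j \<otimes> ?y) = d" using dc by simp
  have key: "h \<otimes> ?y \<in> R \<longleftrightarrow> h \<in> R" if h: "h \<in> J" for h
  proof -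
    have hT: "h \<in> T" and hy: "h \<otimes> ?y \<in> T" and jyT: "j \<otimes> ?y \<in> T"
      using h j(1) J(3) I(3) IJ scale_in_scale[of _ J ?y] by auto
    have "\<phi> (h \<otimes> ?y) = \<phi> (h \<otimes> ?y) \<otimes>\<^bsub>k\<^esub> \<phi> j" using j(2) \<phi>_closed[OF hy] by simp
    also have "\<dots> = \<phi> (h \<otimes> (j \<otimes> ?y))"
      using \<phi>_mult[OF hy jT] T_carrier[OF hT] c y by (simp add: m_ac)
    also have "\<dots> = \<phi> h \<otimes>\<^bsub>k\<^esub> d" using \<phi>_mult[OF hT jyT] jy by simp
    finally have eq: "\<phi> (h \<otimes> ?y) = \<phi> h \<otimes>\<^bsub>k\<^esub> d" .
    then have "\<phi> h = \<phi> (h \<otimes> ?y) \<otimes>\<^bsub>k\<^esub> inv\<^bsub>k\<^esub> d"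
      using k.inv_cancel(3)[OF dc \<phi>_closed[OF hT]] by simp
    then have "\<phi> (h \<otimes> ?y) \<in> D \<longleftrightarrow> \<phi> h \<in> D" using eq u(3,4) D_closed(6) by (metis DiffD1)
    then show ?thesis using hT hy by (simp add: R_def)
  qed
  have "I \<inter> R = (J \<inter> R) #> ?y"
    unfolding IJ using key unfolding r_coset_def by blast
  then show ?thesis using y by blast
qed

section \<open>Classes of comaximal ideals and ideals that extend to T\<close>

lemma exists_comax_class:
  assumes "I \<in> carrier Inv_T"
  obtains J where "comax J" "ideal_class K T star_T J = ideal_class K T star_T I"
proof -
  obtain x where x: "x \<in> carrier K - {\<zero>}" "comax (I #> x)" using exists_comax[OF assms] .
  then have "ideal_class K T star_T (I #> x) = ideal_class K T star_T I"
    using e.ideal_class_eq_iff[OF e.Inv_scale[OF assms x(1)] assms] by blast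
  then show thesis using that x(2) by blast
qed

lemma contraction_class_cong:
  assumes "comax I" "comax J" "ideal_class K T star_T I = ideal_class K T star_T J"
  shows "ideal_class K R (t_op K R) (I \<inter> R) = ideal_class K R (t_op K R) (J \<inter> R)"
proof -
  obtain x where x: "x \<in> carrier K - {\<zero>}" "I = J #> x"
    using e.ideal_class_eq_iff[OF comaxD(1)[OF assms(1)] comaxD(1)[OF assms(2)]] assms(3) by blast
  show ?thesis
    using R.t.ideal_class_eq_iff[OF contraction_Inv[OF assms(1)] contraction_Inv[OF assms(2)]]
      comax_scale[OF assms(1,2) x] by blast
qed

text \<open>By invertibility some \<open>h\<close> in \<open>H\<close> and \<open>x\<close> in (R :
  H) have product outside \<open>M\<close>. Both lie in \<open>T\<close> with nonzero residues, and
  these are a nonzero element and a denominator of the image of \<open>H\<close>.\<close>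

lemma extension_T_residual:
  assumes "H \<in> carrier Inv_R" "H \<cdot> T = T"
  shows "residual H"
proof -
  note Hf = R.t.Inv_frac[OF assms(1)]
  note H = R.frac_idealsE[OF Hf]
  note C = R.frac_ideals_colon[OF Hf]
  have HT: "H \<subseteq> T" using extension_superset[OF H(2)] assms(2) by simp
  have "t_op K R (H \<cdot> colon K R H) = R"
    using assms(1) by (simp add: R.t.Inv_group_carrier R.t.invertible_def)
  then obtain h x where hx: "h \<in> H" "x \<in> colon K R H" "h \<otimes> x \<notin> M"
    using M_summands[OF H(2) R.frac_idealsE(2)[OF C]] subringE(3)[OF R_subring] by blast
  have xc: "x \<in> carrier K" using hx(2) by (rule colon_carrier)
  have hT: "h \<in> T" using hx(1) HT by blast
  have "\<one> \<in> H \<cdot> T" using assms(2) T_closed(3) by simp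
  then have "x \<in> pre (colon k D (\<phi> ` H))" using colon_pre[OF HT] hx(2) by blast
  then have x: "x \<in> T" "\<phi> x \<in> colon k D (\<phi> ` H)" by (auto simp: pre_def)
  have nz: "\<phi> h \<noteq> \<zero>\<^bsub>k\<^esub>" "\<phi> x \<noteq> \<zero>\<^bsub>k\<^esub>"
    using hx(3) hT x(1) \<phi>_mult[OF hT x(1)] \<phi>_closed[OF hT] \<phi>_closed[OF x(1)] T_closed(6)[OF hT x(1)]
    by (auto simp: M_def)
  have "\<phi> ` H \<in> frac_ideals k D"
  proof (rule D.frac_idealsI[OF image_subalgebra[OF H(1) HT]])
    show "\<phi> h \<in> \<phi> ` H" using hx(1) by blast
    show "\<phi> x \<in> carrier k - {\<zero>\<^bsub>k\<^esub>}" using nz(2) \<phi>_closed[OF x(1)] by simp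
    show "\<phi> x \<otimes>\<^bsub>k\<^esub> y \<in> D" if "y \<in> \<phi> ` H" for y using colonD[OF x(2) that] .
  qed (rule nz(1))
  then show ?thesis using Hf assms(2) by (simp add: residual_def)
qed

lemma pre_of_extension_T:
  assumes "H \<in> carrier Inv_R" "H \<cdot> T = T"
  obtains J where "J \<in> carrier Inv_D" "H = pre J"
proof -
  have r: "residual H" using assms by (rule extension_T_residual)
  note J = residualD(3)[OF r]
  have "t_op K R H = H" using assms(1) by (simp add: R.t.Inv_group_carrier)
  then have H: "H = pre (t_op k D (\<phi> ` H))" using t_op_residual[OF r] by simp
  then show thesis using that Inv_pre_iff[OF D.t_op_frac[OF J]] assms(1) by metis
qed

lemma pre_hom: "pre \<in> hom Inv_D Inv_R"
proof (rule homI)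
  show "pre J \<in> carrier Inv_R" if "J \<in> carrier Inv_D" for J
    using that Inv_pre_iff[OF D.t.Inv_frac[OF that]] by simp
  show "pre (J \<otimes>\<^bsub>Inv_D\<^esub> L) = pre J \<otimes>\<^bsub>Inv_R\<^esub> pre L" if "J \<in> carrier Inv_D" "L \<in> carrier Inv_D" for J L
    using t_op_pre_prod[OF D.t.Inv_frac[OF that(1)] D.t.Inv_frac[OF that(2)]]
    by (simp add: R.t.Inv_group_mult D.t.Inv_group_mult)
qed

section \<open>The homomorphisms between the class groups and split exactness\<close>

abbreviation class_D where "class_D \<equiv> ideal_class k D (t_op k D)"
abbreviation class_R where "class_R \<equiv> ideal_class K R (t_op K R)"
abbreviation class_T where "class_T \<equiv> ideal_class K T star_T"
abbreviation Cl_D where "Cl_D \<equiv> Cl_group k D (t_op k D)"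
abbreviation Cl_R where "Cl_R \<equiv> Cl_group K R (t_op K R)"
abbreviation Cl_T where "Cl_T \<equiv> Cl_group K T star_T"

lemma pre_class_hom:
  obtains \<alpha> where "\<alpha> \<in> hom Cl_D Cl_R" "\<And>J. J \<in> carrier Inv_D \<Longrightarrow> \<alpha> (class_D J) = class_R (pre J)"
proof -
  have h: "(\<lambda>J. class_R (pre J)) \<in> hom Inv_D Cl_R"
    using hom_compose[OF pre_hom R.t.ideal_class_hom] by (simp add: comp_def)
  obtain g where "g \<in> hom (Inv_D Mod Prin k D) Cl_R"
    "\<And>J. J \<in> carrier Inv_D \<Longrightarrow> g (Prin k D #>\<^bsub>Inv_D\<^esub> J) = class_R (pre J)"
  proof (rule FactGroup_universal[OF h D.t.Prin_normal])
    fix J L assume JL: "J \<in> carrier Inv_D" "L \<in> carrier Inv_D" "Prin k D #>\<^bsub>Inv_D\<^esub> J = Prin k D #>\<^bsub>Inv_D\<^esub> L"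
    then obtain c where c: "c \<in> carrier k - {\<zero>\<^bsub>k\<^esub>}" "J = L #>\<^bsub>k\<^esub> c"
      using D.t.ideal_class_eq_iff[OF JL(1,2)] by (auto simp: ideal_class_def)
    note Lf = D.t.Inv_frac[OF JL(2)] and Df = D.frac_ideals_scale[OF D.frac_ideals_self c(1)]
    obtain u where u: "u \<in> carrier K - {\<zero>}" "pre (D #>\<^bsub>k\<^esub> c) = R #> u" using pre_principal[OF c(1)] by blast
    \<comment> \<open>Scaling by \<open>c\<close> is rewritten as multiplication by a principal
      ideal, whose preimage is principal by the condition on units.\<close>
    have "J = (D #>\<^bsub>k\<^esub> c) \<otimes>\<^bsub>Inv_D\<^esub> L"
      using D.t.Prin_prod[OF Lf c(1)] JL(1) c(2) by (simp add: D.t.Inv_group_mult D.t.Inv_group_carrier)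
    then have "pre J = t_op K R ((R #> u) \<cdot> pre L)"
      using t_op_pre_prod[OF Df Lf] u(2) by (simp add: D.t.Inv_group_mult)
    also have "\<dots> = pre L #> u"
      using R.t.Prin_prod[OF residualD(1)[OF residual_pre[OF Lf]] u(1)]
        R.t.Inv_scale[OF hom_in_carrier[OF pre_hom JL(2)] u(1)] by (simp add: R.t.Inv_group_carrier)
    finally show "class_R (pre J) = class_R (pre L)"
      using R.t.ideal_class_eq_iff hom_in_carrier[OF pre_hom] JL(1,2) u(1) by blast
  qed blast
  then show thesis using that by (simp add: Cl_group_def ideal_class_def)
qed

lemma extension_class_hom:
  obtains \<beta> where "\<beta> \<in> hom Cl_R Cl_T" "\<And>H. H \<in> carrier Inv_R \<Longrightarrow> \<beta> (class_R H) = class_T (H \<cdot> T)"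
proof -
  have h: "(\<lambda>H. class_T (H \<cdot> T)) \<in> hom Inv_R Cl_T"
    using hom_compose[OF extension_hom e.ideal_class_hom] by (simp add: comp_def)
  obtain g where "g \<in> hom (Inv_R Mod Prin K R) Cl_T"
    "\<And>H. H \<in> carrier Inv_R \<Longrightarrow> g (Prin K R #>\<^bsub>Inv_R\<^esub> H) = class_T (H \<cdot> T)"
  proof (rule FactGroup_universal[OF h R.t.Prin_normal])
    fix H L assume HL: "H \<in> carrier Inv_R" "L \<in> carrier Inv_R" "Prin K R #>\<^bsub>Inv_R\<^esub> H = Prin K R #>\<^bsub>Inv_R\<^esub> L"
    then obtain x where x: "x \<in> carrier K - {\<zero>}" "H = L #> x"
      using R.t.ideal_class_eq_iff[OF HL(1,2)] by (auto simp: ideal_class_def)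
    have "H \<cdot> T = (L \<cdot> T) #> x"
      using extension_scale[OF R.frac_idealsE(2)[OF R.t.Inv_frac[OF HL(2)]] x(1)] x(2) by simp
    then show "class_T (H \<cdot> T) = class_T (L \<cdot> T)"
      using e.ideal_class_eq_iff extension_Inv HL(1,2) x(1) by blast
  qed blast
  then show thesis using that by (simp add: Cl_group_def ideal_class_def)
qed

text \<open>Contraction is under control only for ideals comaximal to \<open>M\<close>. A comaximal
  representative \<open>c I\<close> is therefore chosen for every \<open>I\<close>; since the class
  of the contraction depends only on that of the representative, the choice still yields a
  homomorphism.\<close>

lemma contraction_class_hom:
  obtains s where "s \<in> hom Cl_T Cl_R" "\<And>I. comax I \<Longrightarrow> s (class_T I) = class_R (I \<inter> R)"
proof -
  define c where "c I = (SOME J. comax J \<and> class_T J = class_T I)" for I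
  have c: "comax (c I)" "class_T (c I) = class_T I" if I: "I \<in> carrier Inv_T" for I
  proof -
    have "\<exists>J. comax J \<and> class_T J = class_T I" by (rule exists_comax_class[OF I]) (intro exI conjI)
    then have "comax (c I) \<and> class_T (c I) = class_T I" unfolding c_def by (rule someI_ex)
    then show "comax (c I)" "class_T (c I) = class_T I" by auto
  qed
  interpret G: comm_group Inv_T by (rule e.Inv_comm_group)
  have h: "(\<lambda>I. class_R (c I \<inter> R)) \<in> hom Inv_T Cl_R"
  proof (rule homI)
    show "class_R (c I \<inter> R) \<in> carrier Cl_R" if "I \<in> carrier Inv_T" for I
      using contraction_Inv[OF c(1)[OF that]] R.t.Cl_carrier by blast
    fix I J assume I: "I \<in> carrier Inv_T" and J: "J \<in> carrier Inv_T"
    note IJ = G.m_closed[OF I J]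
    note cI = c[OF I] and cJ = c[OF J]
    \<comment> \<open>The closed product of the representatives and the representative of the
      product need not agree, but both are comaximal to \<open>M\<close> and belong to the same
      class.\<close>
    have "class_T (star_T (c I \<cdot> c J)) = class_T (c I) \<otimes>\<^bsub>Cl_T\<^esub> class_T (c J)"
      using hom_mult[OF e.ideal_class_hom comaxD(1)[OF cI(1)] comaxD(1)[OF cJ(1)]]
      by (simp add: e.Inv_group_mult)
    also have "\<dots> = class_T (I \<otimes>\<^bsub>Inv_T\<^esub> J)"
      using hom_mult[OF e.ideal_class_hom I J] cI(2) cJ(2) by simp
    also have "\<dots> = class_T (c (I \<otimes>\<^bsub>Inv_T\<^esub> J))" using c(2)[OF IJ] by simp
    finally have "class_R (star_T (c I \<cdot> c J) \<inter> R) = class_R (c (I \<otimes>\<^bsub>Inv_T\<^esub> J) \<inter> R)"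
      using contraction_class_cong[OF comax_prod(1)[OF cI(1) cJ(1)] c(1)[OF IJ]] by blast
    moreover have "class_R (star_T (c I \<cdot> c J) \<inter> R) = class_R (c I \<inter> R) \<otimes>\<^bsub>Cl_R\<^esub> class_R (c J \<inter> R)"
      using hom_mult[OF R.t.ideal_class_hom contraction_Inv[OF cI(1)] contraction_Inv[OF cJ(1)]]
        comax_prod(2)[OF cI(1) cJ(1)] by (simp add: R.t.Inv_group_mult)
    ultimately show "class_R (c (I \<otimes>\<^bsub>Inv_T\<^esub> J) \<inter> R) = class_R (c I \<inter> R) \<otimes>\<^bsub>Cl_R\<^esub> class_R (c J \<inter> R)"
      by simp
  qed
  obtain g where g: "g \<in> hom (Inv_T Mod Prin K T) Cl_R"
    "\<And>I. I \<in> carrier Inv_T \<Longrightarrow> g (Prin K T #>\<^bsub>Inv_T\<^esub> I) = class_R (c I \<inter> R)"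
  proof (rule FactGroup_universal[OF h e.Prin_normal])
    fix I J assume IJ: "I \<in> carrier Inv_T" "J \<in> carrier Inv_T" "Prin K T #>\<^bsub>Inv_T\<^esub> I = Prin K T #>\<^bsub>Inv_T\<^esub> J"
    then have "class_T I = class_T J" by (simp add: ideal_class_def)
    then show "class_R (c I \<inter> R) = class_R (c J \<inter> R)"
      using contraction_class_cong c IJ(1,2) by simp
  qed blast
  show thesis
  proof (rule that[of g])
    show "g \<in> hom Cl_T Cl_R" using g(1) by (simp add: Cl_group_def)
    show "g (class_T I) = class_R (I \<inter> R)" if I: "comax I" for I
      using g(2)[OF comaxD(1)[OF I]] contraction_class_cong[OF c(1) I c(2)] comaxD(1)[OF I]
      by (simp add: ideal_class_def)
  qed
qed

theorem split_exact:
  "\<exists>\<alpha> \<beta>.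
     (\<forall>J \<in> carrier Inv_D. pre J \<in> carrier Inv_R \<and> \<alpha> (class_D J) = class_R (pre J)) \<and>
     (\<forall>H \<in> carrier Inv_R. H \<cdot> T \<in> carrier Inv_T \<and> \<beta> (class_R H) = class_T (H \<cdot> T)) \<and>
     split_short_exact Cl_D \<alpha> Cl_R \<beta> Cl_T"
proof -
  obtain \<alpha> where \<alpha>: "\<alpha> \<in> hom Cl_D Cl_R" "\<And>J. J \<in> carrier Inv_D \<Longrightarrow> \<alpha> (class_D J) = class_R (pre J)"
    using pre_class_hom by blast
  obtain \<beta> where \<beta>: "\<beta> \<in> hom Cl_R Cl_T" "\<And>H. H \<in> carrier Inv_R \<Longrightarrow> \<beta> (class_R H) = class_T (H \<cdot> T)"
    using extension_class_hom by blast
  obtain s where s: "s \<in> hom Cl_T Cl_R" "\<And>I. comax I \<Longrightarrow> s (class_T I) = class_R (I \<inter> R)"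
    using contraction_class_hom by blast
  interpret D': comm_group Cl_D by (rule D.t.Cl_comm_group)
  interpret R': comm_group Cl_R by (rule R.t.Cl_comm_group)
  interpret T': comm_group Cl_T by (rule e.Cl_comm_group)
  have "z = \<one>\<^bsub>Cl_D\<^esub>" if z: "z \<in> carrier Cl_D" "\<alpha> z = \<one>\<^bsub>Cl_R\<^esub>" for z
  proof -
    obtain J where J: "J \<in> carrier Inv_D" "z = class_D J" using z(1) D.t.Cl_carrier by blast
    have "class_R (pre J) = class_R R" using z(2) J \<alpha>(2) R.t.Cl_one by simp
    then obtain x where "x \<in> carrier K - {\<zero>}" "pre J = R #> x"
      using R.t.ideal_class_eq_iff[OF hom_in_carrier[OF pre_hom J(1)] R.t.Inv_self] by blast
    then have "J \<in> Prin k D" using principal_of_pre D.t.Inv_frac[OF J(1)] by blast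
    then have "class_D J = class_D D"
      using D.t.ideal_class_eq_iff[OF J(1) D.t.Inv_self] by (auto simp: Prin_def)
    then show ?thesis using J(2) D.t.Cl_one by simp
  qed
  then have mon: "\<alpha> \<in> mon Cl_D Cl_R"
    using \<alpha>(1) mon_iff_hom_one[OF D'.is_group R'.is_group] by blast
  have split: "\<beta> (s z) = z" if z: "z \<in> carrier Cl_T" for z
  proof -
    obtain I' where "I' \<in> carrier Inv_T" "z = class_T I'" using z e.Cl_carrier by blast
    then obtain I where I: "comax I" "z = class_T I" using exists_comax_class by metis
    then show ?thesis
      using s(2)[OF I(1)] \<beta>(2)[OF contraction_Inv[OF I(1)]] contraction_extension[OF I(1)] by simp
  qed
  \<comment> \<open>Surjectivity is a consequence of the right inverse \<open>s\<close>.\<close>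
  have "\<beta> ` carrier Cl_R = carrier Cl_T"
    using hom_in_carrier[OF \<beta>(1)] hom_in_carrier[OF s(1)] split by (metis (no_types) image_eqI image_subsetI subset_antisym subsetI)
  then have epi: "\<beta> \<in> epi Cl_R Cl_T" using \<beta>(1) by (simp add: epi_def)
  have "\<alpha> ` carrier Cl_D = kernel Cl_R Cl_T \<beta>"
  proof (intro equalityI subsetI)
    fix w assume "w \<in> \<alpha> ` carrier Cl_D"
    then obtain J where J: "J \<in> carrier Inv_D" "w = class_R (pre J)" using \<alpha>(2) D.t.Cl_carrier by auto
    note pJ = hom_in_carrier[OF pre_hom J(1)]
    have "pre J \<cdot> T = T" using residualD(2)[OF residual_pre[OF D.t.Inv_frac[OF J(1)]]] .
    then have "\<beta> w = \<one>\<^bsub>Cl_T\<^esub>" using \<beta>(2)[OF pJ] J(2) e.Cl_one by simp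
    then show "w \<in> kernel Cl_R Cl_T \<beta>" using J(2) pJ R.t.Cl_carrier by (auto simp: kernel_def)
  next
    fix w assume w: "w \<in> kernel Cl_R Cl_T \<beta>"
    then obtain H where H: "H \<in> carrier Inv_R" "w = class_R H" using R.t.Cl_carrier by (auto simp: kernel_def)
    note Hc = R.frac_idealsE(2)[OF R.t.Inv_frac[OF H(1)]]
    have "class_T (H \<cdot> T) = class_T T" using w H \<beta>(2) e.Cl_one by (simp add: kernel_def)
    then obtain x where x: "x \<in> carrier K - {\<zero>}" "H \<cdot> T = T #> x"
      using e.ideal_class_eq_iff[OF extension_Inv[OF H(1)] e.Inv_self] by blast
    note ix = nonzero_inv(1)[OF x(1)]
    \<comment> \<open>Dividing \<open>H\<close> by the generator of its principal extension keeps
      the class and makes the extension equal to \<open>T\<close>.\<close>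
    have H': "H #> inv x \<in> carrier Inv_R" using H(1) ix by (rule R.t.Inv_scale)
    have "(H #> inv x) \<cdot> T = T"
      using extension_scale[OF Hc ix] x scale_inv(1)[OF T_closed(1) x(1)] by simp
    then obtain J where J: "J \<in> carrier Inv_D" "H #> inv x = pre J" using pre_of_extension_T[OF H'] by blast
    have "w = class_R (pre J)"
      using R.t.ideal_class_eq_iff[OF H' H(1)] H(2) J(2) ix by auto
    then show "w \<in> \<alpha> ` carrier Cl_D" using \<alpha>(2)[OF J(1)] J(1) D.t.Cl_carrier by auto
  qed
  then have "split_short_exact Cl_D \<alpha> Cl_R \<beta> Cl_T"
    unfolding split_short_exact_def
    using mon epi split s(1) D.t.Cl_comm_group R.t.Cl_comm_group e.Cl_comm_group by blast
  then show ?thesis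
    by (intro exI[of _ \<alpha>] exI[of _ \<beta>] conjI ballI)
      (simp_all only: \<alpha>(2) \<beta>(2) hom_in_carrier[OF pre_hom] extension_Inv)
qed

end

text \<open>Passage from the quotient ring to the abstract residue field: the coset map supplies
  \<open>\<phi>\<close>, maximality of \<open>M\<close> makes \<open>k\<close> a field, and equality
  of cosets modulo U(D) turns into a factorisation by elements.\<close>

lemma residue_pullback:
  fixes K :: "('a, 'm) ring_scheme" and T M R :: "'a set"
    and k :: "'a set ring" and \<phi> :: "'a \<Rightarrow> 'a set" and D :: "'a set set"
  assumes "field K" and T: "subdomain T K" and qf: "is_quotient_field K T"
    and max: "maximalideal M (K\<lparr>carrier := T\<rparr>)" and M0: "M \<noteq> {\<zero>\<^bsub>K\<^esub>}"
    and k: "k = residue_field K T M" and \<phi>: "\<phi> = residue_map K T M"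
    and D: "subring D k" "D \<noteq> carrier k" "is_quotient_field k D"
    and R: "R = residue_preimage K T M D"
    and units: "(\<lambda>u. Units (k\<lparr>carrier := D\<rparr>) #>\<^bsub>mult_of k\<^esub> \<phi> u) ` Units (K\<lparr>carrier := T\<rparr>)
           = carrier (mult_of k Mod Units (k\<lparr>carrier := D\<rparr>))"
  shows "pullback K k \<phi> T M D R"
proof -
  interpret K: field K by fact
  interpret T: domain "K\<lparr>carrier := T\<rparr>" using T by (rule K.subdomain_is_domain)
  interpret M: maximalideal M "K\<lparr>carrier := T\<rparr>" by fact
  interpret k: field k
    unfolding k residue_field_def using T.is_cring by (rule M.quotient_is_field)
  have T': "subring T K" using T by (simp add: subdomain_def subcring_def)
  have \<phi>_eq: "\<phi> x = M +>\<^bsub>K\<lparr>carrier := T\<rparr>\<^esub> x" for x by (simp add: \<phi> residue_map_def)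
  have hom: "\<phi> \<in> ring_hom (K\<lparr>carrier := T\<rparr>) k"
    unfolding \<phi> k residue_field_def residue_map_def[abs_def] by (rule M.rcos_ring_hom)
  have surj: "\<phi> ` T = carrier k"
    by (auto simp: k residue_field_def FactRing_def A_RCOSETS_def' \<phi>_eq)
  have "\<zero>\<^bsub>k\<^esub> = M" by (simp add: k residue_field_def FactRing_def)
  moreover have "M +>\<^bsub>K\<lparr>carrier := T\<rparr>\<^esub> x = M \<longleftrightarrow> x \<in> M" if "x \<in> T" for x
    using M.rcos_const_imp_mem[of x] M.a_rcos_const[of x] that by auto
  ultimately have ker: "M = {x \<in> T. \<phi> x = \<zero>\<^bsub>k\<^esub>}"
    using M.a_subset by (auto simp: \<phi>_eq)
  show ?thesis
  proof (intro pullback.intro pullback_axioms.intro)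
    show "R = {x \<in> T. \<phi> x \<in> D}" by (simp add: R residue_preimage_def \<phi>)
    fix c assume c: "c \<in> carrier k - {\<zero>\<^bsub>k\<^esub>}"
    let ?U = "Units (k\<lparr>carrier := D\<rparr>)"
    have "?U #>\<^bsub>mult_of k\<^esub> c \<in> carrier (mult_of k Mod ?U)"
      using c by (auto simp: FactGroup_def RCOSETS_def)
    then obtain u where u: "u \<in> Units (K\<lparr>carrier := T\<rparr>)" "?U #>\<^bsub>mult_of k\<^esub> c = ?U #>\<^bsub>mult_of k\<^esub> \<phi> u"
      using units by (metis (no_types, lifting) imageE)
    \<comment> \<open>The coset of \<open>c\<close> contains \<open>c\<close> itself, so the
      equality of cosets expresses \<open>c\<close> as a unit of \<open>D\<close> times the residue
      of \<open>u\<close>.\<close>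
    have "\<one>\<^bsub>k\<^esub> \<in> ?U" using subringE(1,3)[OF D(1)] by (auto simp: Units_def intro!: bexI[of _ "\<one>\<^bsub>k\<^esub>"])
    then have "c \<in> ?U #>\<^bsub>mult_of k\<^esub> c" using c by (auto simp: r_coset_def intro!: bexI[of _ "\<one>\<^bsub>k\<^esub>"])
    then obtain d where d: "d \<in> ?U" "c = d \<otimes>\<^bsub>k\<^esub> \<phi> u" unfolding u(2) by (auto simp: r_coset_def)
    obtain v where v: "u \<in> T" "v \<in> T" "v \<otimes>\<^bsub>K\<^esub> u = \<one>\<^bsub>K\<^esub>" "u \<otimes>\<^bsub>K\<^esub> v = \<one>\<^bsub>K\<^esub>" using u(1) by (auto simp: Units_def)
    have vc: "u \<in> carrier K" "v \<in> carrier K" using v subringE(1)[OF T'] by auto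
    obtain e where e: "d \<in> D" "e \<in> D" "e \<otimes>\<^bsub>k\<^esub> d = \<one>\<^bsub>k\<^esub>" "d \<otimes>\<^bsub>k\<^esub> e = \<one>\<^bsub>k\<^esub>" using d(1) by (auto simp: Units_def)
    have ec: "d \<in> carrier k" "e \<in> carrier k" using e subringE(1)[OF D(1)] by auto
    \<comment> \<open>Inverses in the rings \<open>T\<close> and \<open>D\<close> are the inverses
      in the ambient fields, in terms of which \<open>lift_unit\<close> is formulated.\<close>
    have "inv\<^bsub>K\<^esub> u = v" using K.inv_char[OF vc v(4,3)] by simp
    moreover have "inv\<^bsub>k\<^esub> d = e" using k.inv_char[OF ec e(4,3)] by simp
    moreover have "u \<noteq> \<zero>\<^bsub>K\<^esub>" "d \<noteq> \<zero>\<^bsub>k\<^esub>" using v(3) e(3) vc ec by auto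
    moreover have "c = \<phi> u \<otimes>\<^bsub>k\<^esub> d" using d(2) k.m_comm[OF ec(1), of "\<phi> u"] surj v(1) by blast
    ultimately show "\<exists>u\<in>T - {\<zero>\<^bsub>K\<^esub>}. inv\<^bsub>K\<^esub> u \<in> T \<and>
        (\<exists>d\<in>D - {\<zero>\<^bsub>k\<^esub>}. inv\<^bsub>k\<^esub> d \<in> D \<and> c = \<phi> u \<otimes>\<^bsub>k\<^esub> d)"
      using v(1,2) e(1,2) by blast
  qed (fact T' qf hom surj ker M0 D K.field_axioms k.field_axioms)+
qed

theorem corollary2p18:
  fixes K :: "('a, 'm) ring_scheme" and T M R :: "'a set"
    and k :: "'a set ring" and \<phi> :: "'a \<Rightarrow> 'a set" and D :: "'a set set"
  assumes "field K" and "subdomain T K" and "is_quotient_field K T"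
    and "maximalideal M (K\<lparr>carrier := T\<rparr>)" and "M \<noteq> {\<zero>\<^bsub>K\<^esub>}"
    and "k = residue_field K T M" and "\<phi> = residue_map K T M"
    and "subring D k" and "D \<noteq> carrier k" and "is_quotient_field k D"
    and "R = residue_preimage K T M D"
    and "(\<lambda>u. Units (k\<lparr>carrier := D\<rparr>) #>\<^bsub>mult_of k\<^esub> \<phi> u) ` Units (K\<lparr>carrier := T\<rparr>)
           = carrier (mult_of k Mod Units (k\<lparr>carrier := D\<rparr>))"
  shows "\<exists>\<alpha> \<beta>.
     (\<forall>J \<in> carrier (Inv_group k D (t_op k D)).
        residue_preimage K T M J \<in> carrier (Inv_group K R (t_op K R)) \<and>
        \<alpha> (ideal_class k D (t_op k D) J)
          = ideal_class K R (t_op K R) (residue_preimage K T M J)) \<and>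
     (\<forall>H \<in> carrier (Inv_group K R (t_op K R)).
        ideal_prod K H T \<in> carrier (Inv_group K T (star_ext K T (t_op K R))) \<and>
        \<beta> (ideal_class K R (t_op K R) H)
          = ideal_class K T (star_ext K T (t_op K R)) (ideal_prod K H T)) \<and>
     split_short_exact
       (Cl_group k D (t_op k D)) \<alpha>
       (Cl_group K R (t_op K R)) \<beta>
       (Cl_group K T (star_ext K T (t_op K R)))"
proof -
  interpret pullback K k \<phi> T M D R using assms by (rule residue_pullback)
  have "residue_preimage K T M J = pre J" for J
    unfolding residue_preimage_def pre_def by (simp only: assms(7))
  then show ?thesis using split_exact by simp
qed

end
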